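(* Let $\{u_{m,k,l;n,r,t}\}_{(m,k,l;n,r,t)\in\Omega}$ be a sequence of complex numbers. There exists a non-negative Borel measure $\mu$ on $\mathbb{R}^2$ with $$\int_{\mathbb{R}^2} x_1^m (x_1+i)^k (x_1-i)^l x_2^n (x_2+i)^r (x_2-i)^t\, d\mu = u_{m,k,l;n,r,t},\qquad (m,k,l;n,r,t)\in\Omega, \quad ( * )$$ if and only if both of the following hold. (i) For all families of complex coefficients $\alpha_{m,k,l;n,r,t}$, $(m,k,l;n,r,t)\in\Omega$, all but finitely many of which are zero, $$\sum_{(m,k,l;n,r,t),(m',k',l';n',r',t')\in\Omega} \alpha_{m,k,l;n,r,t}\,\overline{\alpha_{m',k',l';n',r',t'}}\; u_{m+m',k+l',l+k';n+n',r+t',t+r'}\ \ge 0 .$$ (ii) For all $(m,k,l;n,r,t),(a,b,c;d,e,f)\in\Omega$, $$u_{m+1+a,k+c,l+b;n+d,r+f,t+e} + i\,u_{m+a,k+c,l+b;n+d,r+f,t+e} = u_{m+a,k+1+c,l+b;n+d,r+f,t+e},$$ $$u_{m+1+a,k+c,l+b;n+d,r+f,t+e} - i\,u_{m+a,k+c,l+b;n+d,r+f,t+e} = u_{m+a,k+c,l+1+b;n+d,r+f,t+e},$$ $$u_{m+a,k+c,l+b;n+1+d,r+f,t+e} + i\,u_{m+a,k+c,l+b;n+d,r+f,t+e} = u_{m+a,k+c,l+b;n+d,r+1+f,t+e},$$ $$u_{m+a,k+c,l+b;n+1+d,r+f,t+e} - i\,u_{m+a,k+c,l+b;n+d,r+f,t+e}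 = u_{m+a,k+c,l+b;n+d,r+f,t+1+e}.$$ If (i) and (ii) are satisfied, then the measure $\mu$ satisfying $( * )$ is unique, and it is given by $$\mu(\Delta) = (E(\Delta)\,x_{0,0,0;0,0,0},\,x_{0,0,0;0,0,0})_H,\qquad \Delta\in\mathfrak{B}(\mathbb{R}^2),$$ where $H$, $x_{0,0,0;0,0,0}$ and $E$ are constructed from $u$ as described in the context.
   Context: $\mathbb{Z}_+$ is the set of non-negative integers, $\mathfrak{B}(\mathbb{R}^2)$ is the Borel $\sigma$-algebra of $\mathbb{R}^2$, and $\Omega=\{(m,k,l;n,r,t): m,n\in\mathbb{Z}_+,\ k,l,r,t\in\mathbb{Z}\}$. The problem of finding a non-negative Borel measure $\mu$ satisfying $( * )$ for a given sequence $u$ is called the extended two-dimensional moment problem. Scalar products are linear in the first argument. A measure satisfying $( * )$ is understood to be such that all the integrands in $( * )$ are $\mu$-integrable. Construction of $H$, $x_{m,k,l;n,r,t}$, $E$ (assuming (i) and (ii)). Condition (i) yields a separable complex Hilbert space $H$ and a family $\{x_{m,k,l;n,r,t}\}_{(m,k,l;n,r,t)\in\Omega}$ in $H$ with dense linear span such that $$(x_{m,k,l;n,r,t},x_{m',k',l';n',r',t'})_H = u_{m+m',k+l',l+k';n+n',r+t',t+r'}$$ for all index tuples in $\Omega$. Let $L$ be the set of all (finite) linear combinations of the elements $x_{m,k,l;n,r,t}$. The linear operators $A_0,B_0$ with domain $L$ are defined by $$A_0 x_{m,k,l;n,r,t}=x_{m+1,k,l;n,r,t},\qquad B_0 x_{m,k,l;n,r,t}=x_{m,k,l;n+1,r,t}$$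 extended linearly. Their closures $A=\overline{A_0}$, $B=\overline{B_0}$ are commuting self-adjoint operators in $H$ (commuting in the sense that their Cayley transforms, equivalently spectral measures, commute), and $E$ is their joint orthogonal spectral measure on $\mathfrak{B}(\mathbb{R}^2)$, i.e. $A=\int_{\mathbb{R}^2}x_1\,dE(x)$ and $B=\int_{\mathbb{R}^2}x_2\,dE(x)$. *)

theory Defs
  imports "HOL-Analysis.Analysis" "HOL-Library.Function_Algebras"
begin

section \<open>Complex Hilbert spaces\<close>

text \<open>
  A complex inner product space is carried by a linear subspace \<open>points H\<close> of an ambient additive
  group with complex scalar multiplication \<open>smult H\<close>; the inner product \<open>cip H\<close> is linear in its
  first argument and is only relevant on \<open>points H\<close>.  Using a subspace rather than a whole type
  lets the space depend on other data.
\<close>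

record 'h ip_space =
  points :: "'h set"
  smult :: "complex \<Rightarrow> 'h \<Rightarrow> 'h"
  cip :: "'h \<Rightarrow> 'h \<Rightarrow> complex"

definition nrm :: "'h ip_space \<Rightarrow> 'h \<Rightarrow> real"
  where "nrm H h = sqrt (Re (cip H h h))"

text \<open>The library's metric spaces want symmetry and nonnegativity also off the carrier,
  hence the case distinction.\<close>

definition hdist :: "'h::ab_group_add ip_space \<Rightarrow> 'h \<Rightarrow> 'h \<Rightarrow> real"
  where "hdist H g h = (if g \<in> points H \<and> h \<in> points H then nrm H (g - h) else 0)"

abbreviation htop :: "'h::ab_group_add ip_space \<Rightarrow> 'h topology"
  where "htop H \<equiv> Metric_space.mtopology (points H) (hdist H)"

locale complex_ip_space = vector_space "smult H" for H :: "'h::ab_group_add ip_space" +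
  assumes subspace_points: "subspace (points H)"
    and cip_add_left:
      "\<lbrakk>x \<in> points H; y \<in> points H; z \<in> points H\<rbrakk> \<Longrightarrow> cip H (x + y) z = cip H x z + cip H y z"
    and cip_smult_left:
      "\<lbrakk>x \<in> points H; y \<in> points H\<rbrakk> \<Longrightarrow> cip H (smult H c x) y = c * cip H x y"
    and cip_commute: "\<lbrakk>x \<in> points H; y \<in> points H\<rbrakk> \<Longrightarrow> cip H x y = cnj (cip H y x)"
    and cip_nonneg: "x \<in> points H \<Longrightarrow> 0 \<le> Re (cip H x x)"
    and cip_eq_0: "\<lbrakk>x \<in> points H; cip H x x = 0\<rbrakk> \<Longrightarrow> x = 0"
begin

lemma cip_add_right:
  assumes "x \<in> points H" "y \<in> points H" "z \<in> points H"
  shows "cip H z (x + y) = cip H z x + cip H z y"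
  by (metis assms cip_add_left cip_commute complex_cnj_add subspace_add subspace_points)

lemma cip_smult_right:
  assumes "x \<in> points H" "y \<in> points H"
  shows "cip H x (smult H c y) = cnj c * cip H x y"
  by (metis assms cip_smult_left cip_commute complex_cnj_mult subspace_scale subspace_points)

lemma Re_cip_le_nrm:
  assumes "x \<in> points H" "y \<in> points H"
  shows "Re (cip H x y) \<le> nrm H x * nrm H y"
proof -
  let ?a = "Re (cip H x x)" and ?b = "Re (cip H x y)" and ?c = "Re (cip H y y)"
  have sym: "Re (cip H y x) = ?b"
    using cip_commute[OF assms] by simp
  have q: "0 \<le> ?a + 2 * t * ?b + t\<^sup>2 * ?c" for t :: real
  proof -
    let ?y = "smult H (of_real t) y"
    have y: "?y \<in> points H"
      using assms subspace_points subspace_scale by blast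
    then have xy: "x + ?y \<in> points H"
      using assms subspace_points subspace_add by blast
    have "cip H (x + ?y) (x + ?y)
        = cip H x x + of_real t * cip H x y + of_real t * cip H y x + of_real t * of_real t * cip H y y"
      using assms y xy
      by (simp add: cip_add_left cip_add_right cip_smult_left cip_smult_right algebra_simps)
    then have "Re (cip H (x + ?y) (x + ?y)) = ?a + 2 * t * ?b + t\<^sup>2 * ?c"
      using sym by (simp add: power2_eq_square)
    then show ?thesis
      using cip_nonneg[OF xy] by simp
  qed
  have ac: "0 \<le> ?a" "0 \<le> ?c"
    using assms cip_nonneg by auto
  have "?b\<^sup>2 \<le> ?a * ?c"
  proof (cases "?c = 0")
    case True
    have "?b = 0"
    proof (rule ccontr)
      assume "?b \<noteq> 0"
      with q[of "- (?a + 1) / (2 * ?b)"] True ac show False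
        by (simp add: field_simps)
    qed
    then show ?thesis
      using True by simp
  next
    case False
    with ac have c: "?c > 0"
      by simp
    have "0 \<le> ?c * (?a + 2 * (- ?b / ?c) * ?b + (- ?b / ?c)\<^sup>2 * ?c)"
      using q[of "- ?b / ?c"] c by simp
    also have "\<dots> = ?a * ?c - ?b\<^sup>2"
      using c by (simp add: field_simps power2_eq_square)
    finally show ?thesis
      by simp
  qed
  then have "?b \<le> sqrt (?a * ?c)"
    by (rule real_le_rsqrt)
  then show ?thesis
    by (simp add: nrm_def real_sqrt_mult)
qed

lemma nrm_nonneg: "x \<in> points H \<Longrightarrow> 0 \<le> nrm H x"
  by (simp add: nrm_def cip_nonneg)

lemma nrm_triangle:
  assumes "x \<in> points H" "y \<in> points H"
  shows "nrm H (x + y) \<le> nrm H x + nrm H y"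
proof -
  have xy: "x + y \<in> points H"
    using assms subspace_points subspace_add by blast
  have "Re (cip H (x + y) (x + y)) = (nrm H x)\<^sup>2 + 2 * Re (cip H x y) + (nrm H y)\<^sup>2"
    using assms xy cip_commute[OF assms]
    by (simp add: nrm_def cip_nonneg cip_add_left cip_add_right)
  also have "\<dots> \<le> (nrm H x + nrm H y)\<^sup>2"
    using Re_cip_le_nrm[OF assms] by (simp add: power2_sum)
  finally show ?thesis
    unfolding nrm_def[of H "x + y"]
    using assms nrm_nonneg by (intro real_le_lsqrt) (auto simp: cip_nonneg xy)
qed

lemma nrm_minus:
  assumes "x \<in> points H"
  shows "nrm H (- x) = nrm H x"
proof -
  have "- x = smult H (-1) x"
    by simp
  then show ?thesis
    using assms by (metis (no_types, lifting) nrm_def cip_smult_left cip_smult_right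
        complex_cnj_minus complex_cnj_one minus_mult_minus mult.assoc mult_1 subspace_points subspace_scale)
qed

lemma nrm_eq_0_iff:
  assumes "x \<in> points H"
  shows "nrm H x = 0 \<longleftrightarrow> x = 0"
proof
  assume "nrm H x = 0"
  then have "Re (cip H x x) = 0"
    using assms by (simp add: nrm_def)
  moreover have "Im (cip H x x) = 0"
    using cip_commute[OF assms assms] by (metis complex_cnj_cancel_iff Reals_cnj_iff complex_is_Real_iff)
  ultimately show "x = 0"
    using cip_eq_0[OF assms] by (simp add: complex_eq_iff)
next
  assume "x = 0"
  then show "nrm H x = 0"
    using cip_smult_left[OF assms assms, of 0] by (simp add: nrm_def)
qed

sublocale Metric_space "points H" "hdist H"
proof
  have diff: "x - y \<in> points H" if "x \<in> points H" "y \<in> points H" for x y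
    using that subspace_points subspace_diff by blast
  show "0 \<le> hdist H x y" for x y
    by (simp add: hdist_def diff nrm_nonneg)
  show "hdist H x y = hdist H y x" for x y
    by (simp add: hdist_def) (metis diff minus_diff_eq nrm_minus)
  show "hdist H x y = 0 \<longleftrightarrow> x = y" if "x \<in> points H" "y \<in> points H" for x y
    using that by (simp add: hdist_def diff nrm_eq_0_iff)
  show "hdist H x z \<le> hdist H x y + hdist H y z"
    if "x \<in> points H" "y \<in> points H" "z \<in> points H" for x y z
    using that nrm_triangle[of "x - y" "y - z"] by (simp add: hdist_def diff)
qed

end

locale complex_hilbert_space = complex_ip_space +
  assumes complete: mcomplete


section \<open>Unbounded operators, represented by their graphs\<close>

type_synonym 'h graph = "('h \<times> 'h) set"

definition linear_operator :: "'h::ab_group_add ip_space \<Rightarrow> 'h graph \<Rightarrow> bool"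
  where "linear_operator H T \<longleftrightarrow>
    T \<subseteq> points H \<times> points H \<and> single_valued T \<and> (0, 0) \<in> T \<and>
    (\<forall>(h, g) \<in> T. \<forall>(h', g') \<in> T. (h + h', g + g') \<in> T) \<and>
    (\<forall>c. \<forall>(h, g) \<in> T. (smult H c h, smult H c g) \<in> T)"

definition op_closure :: "'h::ab_group_add ip_space \<Rightarrow> 'h graph \<Rightarrow> 'h graph"
  where "op_closure H T = prod_topology (htop H) (htop H) closure_of T"

definition adjoint_op :: "'h::ab_group_add ip_space \<Rightarrow> 'h graph \<Rightarrow> 'h graph"
  where "adjoint_op H T =
    {(y, z). y \<in> points H \<and> z \<in> points H \<and> (\<forall>(h, g) \<in> T. cip H g y = cip H h z)}"

definition self_adjoint :: "'h::ab_group_add ip_space \<Rightarrow> 'h graph \<Rightarrow> bool"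
  where "self_adjoint H T \<longleftrightarrow>
    linear_operator H T \<and> htop H closure_of (Domain T) = points H \<and> adjoint_op H T = T"

text \<open>The graph of $(T - i)(T + i)^{-1}$.\<close>

definition cayley :: "'h::ab_group_add ip_space \<Rightarrow> 'h graph \<Rightarrow> 'h graph"
  where "cayley H T = {(g + smult H \<i> h, g - smult H \<i> h) | h g. (h, g) \<in> T}"

definition commuting :: "'h::ab_group_add ip_space \<Rightarrow> 'h graph \<Rightarrow> 'h graph \<Rightarrow> bool"
  where "commuting H S T \<longleftrightarrow> cayley H S O cayley H T = cayley H T O cayley H S"


section \<open>Orthogonal spectral measures on the plane\<close>

definition orth_projection :: "'h::ab_group_add ip_space \<Rightarrow> ('h \<Rightarrow> 'h) \<Rightarrow> bool"
  where "orth_projection H P \<longleftrightarrow>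
    (\<forall>h \<in> points H. P h \<in> points H) \<and>
    (\<forall>h \<in> points H. \<forall>g \<in> points H. P (h + g) = P h + P g) \<and>
    (\<forall>c. \<forall>h \<in> points H. P (smult H c h) = smult H c (P h)) \<and>
    (\<forall>h \<in> points H. P (P h) = P h) \<and>
    (\<forall>h \<in> points H. \<forall>g \<in> points H. cip H (P h) g = cip H h (P g))"

definition spectral_measure ::
    "'h::ab_group_add ip_space \<Rightarrow> ((real \<times> real) set \<Rightarrow> 'h \<Rightarrow> 'h) \<Rightarrow> bool"
  where "spectral_measure H E \<longleftrightarrow>
    (\<forall>\<Delta> \<in> sets borel. orth_projection H (E \<Delta>)) \<and>
    (\<forall>h \<in> points H. E UNIV h = h) \<and>
    (\<forall>\<Delta> \<in> sets borel. \<forall>\<Delta>' \<in> sets borel. \<forall>h \<in> points H. E (\<Delta> \<inter> \<Delta>') h = E \<Delta> (E \<Delta>' h)) \<and>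
    (\<forall>D :: nat \<Rightarrow> (real \<times> real) set. range D \<subseteq> sets borel \<longrightarrow> disjoint_family D \<longrightarrow>
      (\<forall>h \<in> points H.
        limitin (htop H) (\<lambda>n. \<Sum>j<n. E (D j) h) (E (\<Union>j. D j) h) sequentially))"

definition scalar_measure ::
    "'h ip_space \<Rightarrow> ((real \<times> real) set \<Rightarrow> 'h \<Rightarrow> 'h) \<Rightarrow> 'h \<Rightarrow> (real \<times> real) measure"
  where "scalar_measure H E h = measure_of UNIV (sets borel) (\<lambda>\<Delta>. ennreal (Re (cip H (E \<Delta> h) h)))"

definition simple_spectral_integral ::
    "'h::ab_group_add ip_space \<Rightarrow> ((real \<times> real) set \<Rightarrow> 'h \<Rightarrow> 'h) \<Rightarrow> (real \<times> real \<Rightarrow> real) \<Rightarrow> 'h \<Rightarrow> 'h"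
  where "simple_spectral_integral H E s h =
    (\<Sum>c \<in> range s. smult H (of_real c) (E (s -` {c}) h))"

text \<open>
  The graph of $\int f\,dE$ for a real Borel function $f$.  Its domain consists of the $h$ with
  $\int |f|^2\,d(Eh,h) < \infty$, where the value is the common limit of the integrals of all
  sequences of simple functions converging pointwise to $f$ and dominated by $|f|$.
\<close>

definition spectral_integral ::
    "'h::ab_group_add ip_space \<Rightarrow> ((real \<times> real) set \<Rightarrow> 'h \<Rightarrow> 'h) \<Rightarrow> (real \<times> real \<Rightarrow> real) \<Rightarrow> 'h graph"
  where "spectral_integral H E f =
    {(h, g). h \<in> points H \<and> g \<in> points H \<and>
      integrable (scalar_measure H E h) (\<lambda>p. (f p)\<^sup>2) \<and>
      (\<forall>s :: nat \<Rightarrow> real \<times> real \<Rightarrow> real.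
        (\<forall>n. simple_function borel (s n)) \<longrightarrow>
        (\<forall>p. (\<lambda>n. s n p) \<longlonglongrightarrow> f p) \<longrightarrow>
        (\<forall>n p. \<bar>s n p\<bar> \<le> \<bar>f p\<bar>) \<longrightarrow>
        limitin (htop H) (\<lambda>n. simple_spectral_integral H E (s n) h) g sequentially)}"

definition joint_spectral_measure ::
    "'h::ab_group_add ip_space \<Rightarrow> 'h graph \<Rightarrow> 'h graph \<Rightarrow> ((real \<times> real) set \<Rightarrow> 'h \<Rightarrow> 'h) \<Rightarrow> bool"
  where "joint_spectral_measure H S T E \<longleftrightarrow>
    spectral_measure H E \<and> S = spectral_integral H E fst \<and> T = spectral_integral H E snd"


section \<open>The extended two-dimensional moment problem\<close>

type_synonym idx = "nat \<times> int \<times> int \<times> nat \<times> int \<times> int"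

definition solves_moment_problem :: "(idx \<Rightarrow> complex) \<Rightarrow> (real \<times> real) measure \<Rightarrow> bool"
  where "solves_moment_problem u \<mu> \<longleftrightarrow> sets \<mu> = sets borel \<and>
    (\<forall>m k l n r t.
      has_bochner_integral \<mu>
        (\<lambda>(x1, x2). of_real x1 ^ m * (of_real x1 + \<i>) powi k * (of_real x1 - \<i>) powi l *
                    of_real x2 ^ n * (of_real x2 + \<i>) powi r * (of_real x2 - \<i>) powi t)
        (u (m, k, l, n, r, t)))"

definition positivity_condition :: "(idx \<Rightarrow> complex) \<Rightarrow> bool"
  where "positivity_condition u \<longleftrightarrow>
    (\<forall>\<alpha> :: idx \<Rightarrow> complex. finite {i. \<alpha> i \<noteq> 0} \<longrightarrow>
      (\<Sum>(m, k, l, n, r, t) \<in> {i. \<alpha> i \<noteq> 0}. \<Sum>(m', k', l', n', r', t') \<in> {i. \<alpha> i \<noteq> 0}.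
        \<alpha> (m, k, l, n, r, t) * cnj (\<alpha> (m', k', l', n', r', t')) *
        u (m + m', k + l', l + k', n + n', r + t', t + r')) \<in> \<real>\<^sub>\<ge>\<^sub>0)"

definition consistency_condition :: "(idx \<Rightarrow> complex) \<Rightarrow> bool"
  where "consistency_condition u \<longleftrightarrow>
    (\<forall>m k l n r t a b c d e f.
      u (m + 1 + a, k + c, l + b, n + d, r + f, t + e) + \<i> * u (m + a, k + c, l + b, n + d, r + f, t + e)
        = u (m + a, k + 1 + c, l + b, n + d, r + f, t + e) \<and>
      u (m + 1 + a, k + c, l + b, n + d, r + f, t + e) - \<i> * u (m + a, k + c, l + b, n + d, r + f, t + e)
        = u (m + a, k + c, l + 1 + b, n + d, r + f, t + e) \<and>
      u (m + a, k + c, l + b, n + 1 + d, r + f, t + e) + \<i> * u (m + a, k + c, l + b, n + d, r + f, t + e)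
        = u (m + a, k + c, l + b, n + d, r + 1 + f, t + e) \<and>
      u (m + a, k + c, l + b, n + 1 + d, r + f, t + e) - \<i> * u (m + a, k + c, l + b, n + d, r + f, t + e)
        = u (m + a, k + c, l + b, n + d, r + f, t + 1 + e))"

definition moment_model ::
    "(idx \<Rightarrow> complex) \<Rightarrow> 'h::ab_group_add ip_space \<Rightarrow> (idx \<Rightarrow> 'h) \<Rightarrow> bool"
  where "moment_model u H x \<longleftrightarrow>
    complex_hilbert_space H \<and> separable_space (htop H) \<and>
    range x \<subseteq> points H \<and> htop H closure_of (module.span (smult H) (range x)) = points H \<and>
    (\<forall>m k l n r t m' k' l' n' r' t'.
      cip H (x (m, k, l, n, r, t)) (x (m', k', l', n', r', t'))
        = u (m + m', k + l', l + k', n + n', r + t', t + r'))"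

text \<open>
  \<open>shift_operator H x \<sigma>\<close> is the graph of the linear extension of $x_i \mapsto x_{\sigma(i)}$ to the
  span of the $x_i$.  It is a relation that need not be single-valued for arbitrary \<open>x\<close>.
\<close>

definition shift_operator ::
    "'h::ab_group_add ip_space \<Rightarrow> (idx \<Rightarrow> 'h) \<Rightarrow> (idx \<Rightarrow> idx) \<Rightarrow> 'h graph"
  where "shift_operator H x \<sigma> =
    {(\<Sum>i\<in>I. smult H (c i) (x i), \<Sum>i\<in>I. smult H (c i) (x (\<sigma> i))) | I c. finite I}"

definition A0 :: "'h::ab_group_add ip_space \<Rightarrow> (idx \<Rightarrow> 'h) \<Rightarrow> 'h graph"
  where "A0 H x = shift_operator H x (\<lambda>(m, k, l, n, r, t). (m + 1, k, l, n, r, t))"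

definition B0 :: "'h::ab_group_add ip_space \<Rightarrow> (idx \<Rightarrow> 'h) \<Rightarrow> 'h graph"
  where "B0 H x = shift_operator H x (\<lambda>(m, k, l, n, r, t). (m, k, l, n + 1, r, t))"

end

theory Submission
  imports Defs "HOL-Probability.Probability"
begin

text \<open>
  The Cayley transform \<open>x \<mapsto> (x - i) / (x + i)\<close> in both variables carries the moment problem to the
  torus.  There, moments with respect to the characters determine a measure, since trigonometric
  polynomials are dense (\<open>torus_measure_eqI\<close>), and every positive definite sequence consists of such
  moments (\<open>Herglotz_torus\<close>).  For the latter, Fejer means sampled on grids of roots of unity give
  finitely supported measures with nearly the right moments.  To extract a limit, they are lifted
  along Schoenberg's space-filling curve to measures on an interval, where Helly's selection theorem
  for distributions on the line applies.

  Necessity of the conditions is a computation with the moment functions.  For sufficiency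
  (\<open>moment_solution_exists\<close>), consider for each \<open>K\<close> the subsequence belonging to the characters times
  \<open>\<bar>x1 + i\<bar>\<close> and \<open>\<bar>x2 + i\<bar>\<close> to the power \<open>2 K\<close>.  It is positive definite, and so it comes from a
  measure on the torus.  The consistency relations and uniqueness show that multiplying the measure
  number \<open>K + 1\<close> by a weight vanishing where a coordinate is 1 gives the measure number \<open>K\<close>.  Hence
  no measure charges the points missed by the Cayley transform, and the measure number 0, brought
  back to the plane, integrates all powers of \<open>x1 + i\<close> and \<open>x2 + i\<close>.  The remaining moments follow by
  linear relations.

  Once the solution \<open>\<mu>\<close> is known, Hilbert space questions become questions about the square integrable
  functions for \<open>\<mu>\<close>.  The moment functions are total there, so every model of the sequence is unitarily
  equivalent to this space (\<open>moment_model_l2_model\<close>), and the space of coefficients with respect to the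
  moment functions is a model.  The operators \<open>A0\<close> and \<open>B0\<close> become multiplications by the coordinates on
  the span of the moment functions.  This span is closed under division by \<open>x1 + i\<close> and \<open>x2 + i\<close>, so
  the closures are the multiplications with maximal domain (\<open>op_closure_shift_operator\<close>).  These are
  self-adjoint, they commute, and multiplication by indicators is a joint spectral measure.

  For an arbitrary joint spectral measure \<open>E\<close>, the vectors \<open>E \<Delta> x\<close>, where \<open>x\<close> is the vector with
  index 0, span a copy of the square integrable functions for its scalar measure.  In this copy the
  Cayley transforms of the two operators act by multiplication as well.  So the scalar measure and
  \<open>\<mu>\<close> have the same integrals of characters and coincide (\<open>scalar_measure_eq\<close>).
\<close>

section \<open>Square integrable functions\<close>

lemma borel_measurable_cnj' [measurable (raw)]:
  "f \<in> borel_measurable M \<Longrightarrow> (\<lambda>x. cnj (f x)) \<in> borel_measurable M"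
  by (rule measurable_compose[OF _ borel_measurable_continuous_onI]) (auto intro: continuous_intros)

definition square_integrable :: "'a measure \<Rightarrow> ('a \<Rightarrow> complex) \<Rightarrow> bool"
  where "square_integrable M f \<longleftrightarrow> f \<in> borel_measurable M \<and> integrable M (\<lambda>x. (cmod (f x))\<^sup>2)"

definition l2_inner :: "'a measure \<Rightarrow> ('a \<Rightarrow> complex) \<Rightarrow> ('a \<Rightarrow> complex) \<Rightarrow> complex"
  where "l2_inner M f g = (LINT x|M. f x * cnj (g x))"

definition l2_sqnorm :: "'a measure \<Rightarrow> ('a \<Rightarrow> complex) \<Rightarrow> real"
  where "l2_sqnorm M f = (LINT x|M. (cmod (f x))\<^sup>2)"

definition l2_tendsto :: "'a measure \<Rightarrow> (nat \<Rightarrow> 'a \<Rightarrow> complex) \<Rightarrow> ('a \<Rightarrow> complex) \<Rightarrow> bool"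
  where "l2_tendsto M F f \<longleftrightarrow>
    (\<forall>n. square_integrable M (F n)) \<and> square_integrable M f \<and>
    (\<lambda>n. l2_sqnorm M (\<lambda>x. F n x - f x)) \<longlonglongrightarrow> 0"

lemma square_integrable_measurable :
  "square_integrable M f \<Longrightarrow> f \<in> borel_measurable M"
  by (simp add: square_integrable_def)

lemma square_integrableD: "square_integrable M f \<Longrightarrow> integrable M (\<lambda>x. (cmod (f x))\<^sup>2)"
  by (simp add: square_integrable_def)

lemma square_integrable_bound:
  assumes "square_integrable M g" "f \<in> borel_measurable M" "\<And>x. x \<in> space M \<Longrightarrow> cmod (f x) \<le> C * cmod (g x)"
  shows "square_integrable M f"
proof -
  have 1: "integrable M (\<lambda>x. C\<^sup>2 * (cmod (g x))\<^sup>2)"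
    using square_integrableD[OF assms(1)] by simp
  have 2: "(cmod (f x))\<^sup>2 \<le> C\<^sup>2 * (cmod (g x))\<^sup>2" if "x \<in> space M" for x
    using power_mono[OF assms(3)[OF that], of 2] by (simp add: power_mult_distrib)
  have "integrable M (\<lambda>x. (cmod (f x))\<^sup>2)"
    by (rule Bochner_Integration.integrable_bound[OF 1]) (use assms(2) 2 in auto)
  then show ?thesis using assms(2) by (simp add: square_integrable_def)
qed

lemma square_integrable_cong:
  assumes "\<And>x. x \<in> space M \<Longrightarrow> f x = g x"
  shows "square_integrable M f \<longleftrightarrow> square_integrable M g"
proof -
  have "f \<in> borel_measurable M \<longleftrightarrow> g \<in> borel_measurable M" by (rule measurable_cong) (rule assms)
  moreover have "integrable M (\<lambda>x. (cmod (f x))\<^sup>2) \<longleftrightarrow> integrable M (\<lambda>x. (cmod (g x))\<^sup>2)"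
    by (rule Bochner_Integration.integrable_cong) (simp_all add: assms)
  ultimately show ?thesis by (simp add: square_integrable_def)
qed

lemma square_integrable_cong_AE:
  assumes f: "square_integrable M f" and g: "g \<in> borel_measurable M" and eq: "AE x in M. f x = g x"
  shows "square_integrable M g"
proof -
  have [measurable]: "f \<in> borel_measurable M" using f by (rule square_integrable_measurable)
  have "integrable M (\<lambda>x. (cmod (g x))\<^sup>2)"
    using square_integrableD[OF f] g eq
    by (subst integrable_cong_AE[of _ _ "\<lambda>x. (cmod (f x))\<^sup>2"]) auto
  then show ?thesis using g by (simp add: square_integrable_def)
qed

lemma cmod_add_sq_le: "(cmod (a + b))\<^sup>2 \<le> 2 * (cmod a)\<^sup>2 + 2 * (cmod b)\<^sup>2"
proof -
  have "(cmod (a + b))\<^sup>2 \<le> (cmod a + cmod b)\<^sup>2"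
    by (intro power_mono norm_triangle_ineq) auto
  also have "\<dots> \<le> 2 * (cmod a)\<^sup>2 + 2 * (cmod b)\<^sup>2"
    using sum_squares_bound[of "cmod a" "cmod b"] by (simp add: power2_sum)
  finally show ?thesis .
qed

lemma square_integrable_add:
  assumes "square_integrable M f" "square_integrable M g"
  shows "square_integrable M (\<lambda>x. f x + g x)"
proof -
  have "integrable M (\<lambda>x. 2 * (cmod (f x))\<^sup>2 + 2 * (cmod (g x))\<^sup>2)"
    by (intro Bochner_Integration.integrable_add integrable_mult_right square_integrableD assms)
  then have "integrable M (\<lambda>x. (cmod (f x + g x))\<^sup>2)"
    by (rule Bochner_Integration.integrable_bound) (use assms in \<open>auto simp: cmod_add_sq_le square_integrable_def\<close>)
  then show ?thesis using assms by (auto simp: square_integrable_def)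
qed

lemma square_integrable_cmult:
  "square_integrable M f \<Longrightarrow> square_integrable M (\<lambda>x. c * f x)"
  by (rule square_integrable_bound[where C = "cmod c"]) (auto simp: norm_mult square_integrable_def)

lemma square_integrable_minus:
  "square_integrable M f \<Longrightarrow> square_integrable M (\<lambda>x. - f x)"
  using square_integrable_cmult[of M f "-1"] by simp

lemma square_integrable_diff:
  "square_integrable M f \<Longrightarrow> square_integrable M g \<Longrightarrow> square_integrable M (\<lambda>x. f x - g x)"
  using square_integrable_add[OF _ square_integrable_minus, of M f g] by simp

lemma square_integrable_zero [simp]: "square_integrable M (\<lambda>_. 0)"
  by (simp add: square_integrable_def)

lemma square_integrable_sum:
  "(\<And>i. i \<in> I \<Longrightarrow> square_integrable M (f i)) \<Longrightarrow> square_integrable M (\<lambda>x. \<Sum>i\<in>I. f i x)"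
  by (induction I rule: infinite_finite_induct) (auto intro: square_integrable_add)

lemma square_integrable_indicator:
  assumes "square_integrable M f" "A \<in> sets M"
  shows "square_integrable M (\<lambda>x. indicator A x * f x)"
proof (rule square_integrable_bound[OF assms(1), where C = 1])
  show "(\<lambda>x. indicator A x * f x) \<in> borel_measurable M"
    using assms(2) square_integrable_measurable[OF assms(1)] by measurable
  show "cmod (indicator A x * f x) \<le> 1 * cmod (f x)" for x
    by (cases "x \<in> A") auto
qed

lemma square_integrable_bounded_mult:
  assumes "square_integrable M f" "g \<in> borel_measurable M" "\<And>x. x \<in> space M \<Longrightarrow> cmod (g x) \<le> C"
  shows "square_integrable M (\<lambda>x. g x * f x)"
  by (rule square_integrable_bound[OF assms(1), where C = C])
     (use assms in \<open>auto simp: norm_mult square_integrable_def intro: mult_right_mono\<close>)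

lemma square_integrable_bounded:
  assumes "finite_measure M" "f \<in> borel_measurable M" "\<And>x. x \<in> space M \<Longrightarrow> cmod (f x) \<le> C"
  shows "square_integrable M f"
proof (rule square_integrable_bound[where C = C and g = "\<lambda>_. 1"])
  interpret finite_measure M by fact
  show "square_integrable M (\<lambda>_. 1)" by (simp add: square_integrable_def)
qed (use assms in auto)

lemma square_integrable_mult_cnj:
  assumes "square_integrable M f" "square_integrable M g"
  shows "integrable M (\<lambda>x. f x * cnj (g x))"
proof (rule Bochner_Integration.integrable_bound)
  show "integrable M (\<lambda>x. (cmod (f x))\<^sup>2 + (cmod (g x))\<^sup>2)"
    by (intro Bochner_Integration.integrable_add integrable_mult_right square_integrableD assms)
  have "cmod (f x) * cmod (g x) \<le> (cmod (f x))\<^sup>2 + (cmod (g x))\<^sup>2" for x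
    using sum_squares_bound[of "cmod (f x)" "cmod (g x)"]
      mult_nonneg_nonneg[OF norm_ge_zero norm_ge_zero, of "f x" "g x"] by linarith
  then show "AE x in M. cmod (f x * cnj (g x)) \<le> norm ((cmod (f x))\<^sup>2 + (cmod (g x))\<^sup>2)"
    by (simp add: norm_mult)
qed (use assms in \<open>auto simp: square_integrable_def\<close>)

lemma square_integrable_integrable:
  assumes "finite_measure M" "square_integrable M f"
  shows "integrable M f"
  using square_integrable_mult_cnj[OF assms(2) square_integrable_bounded[OF assms(1), of "\<lambda>_. 1" 1]] by simp

lemma l2_sqnorm_nonneg: "0 \<le> l2_sqnorm M f"
  by (simp add: l2_sqnorm_def)

lemma l2_inner_self: "l2_inner M f f = of_real (l2_sqnorm M f)"
  unfolding l2_inner_def l2_sqnorm_def integral_complex_of_real[symmetric]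
  by (rule Bochner_Integration.integral_cong) (auto simp: complex_norm_square[symmetric])

lemma l2_inner_commute: "l2_inner M f g = cnj (l2_inner M g f)"
proof -
  have "cnj (l2_inner M g f) = (LINT x|M. cnj (g x * cnj (f x)))"
    unfolding l2_inner_def by (rule Bochner_Integration.integral_cnj[symmetric])
  then show ?thesis by (simp add: l2_inner_def mult.commute)
qed

lemma l2_inner_add_left:
  assumes "square_integrable M f" "square_integrable M g" "square_integrable M h"
  shows "l2_inner M (\<lambda>x. f x + g x) h = l2_inner M f h + l2_inner M g h"
  using assms by (simp add: l2_inner_def distrib_right square_integrable_mult_cnj)

lemma l2_inner_cmult_left: "l2_inner M (\<lambda>x. c * f x) h = c * l2_inner M f h"
  by (simp add: l2_inner_def mult.assoc)

lemma l2_inner_diff_left: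
  assumes "square_integrable M f" "square_integrable M g" "square_integrable M h"
  shows "l2_inner M (\<lambda>x. f x - g x) h = l2_inner M f h - l2_inner M g h"
  using assms by (simp add: l2_inner_def left_diff_distrib square_integrable_mult_cnj)

lemma l2_inner_cmult_right: "l2_inner M h (\<lambda>x. c * f x) = cnj c * l2_inner M h f"
proof -
  have "l2_inner M h (\<lambda>x. c * f x) = (LINT x|M. cnj c * (h x * cnj (f x)))"
    unfolding l2_inner_def by (rule Bochner_Integration.integral_cong) auto
  then show ?thesis by (simp add: l2_inner_def)
qed

lemma l2_inner_diff_right:
  assumes "square_integrable M f" "square_integrable M g" "square_integrable M h"
  shows "l2_inner M h (\<lambda>x. f x - g x) = l2_inner M h f - l2_inner M h g"
  using assms by (simp add: l2_inner_def right_diff_distrib square_integrable_mult_cnj)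

lemma l2_inner_sum_left:
  assumes "\<And>i. i \<in> I \<Longrightarrow> square_integrable M (f i)" "square_integrable M h"
  shows "l2_inner M (\<lambda>x. \<Sum>i\<in>I. f i x) h = (\<Sum>i\<in>I. l2_inner M (f i) h)"
  unfolding l2_inner_def sum_distrib_right
  by (rule Bochner_Integration.integral_sum) (use assms in \<open>auto intro: square_integrable_mult_cnj\<close>)

lemma l2_inner_sum_right:
  assumes "\<And>i. i \<in> I \<Longrightarrow> square_integrable M (f i)" "square_integrable M h"
  shows "l2_inner M h (\<lambda>x. \<Sum>i\<in>I. f i x) = (\<Sum>i\<in>I. l2_inner M h (f i))"
  unfolding l2_inner_def sum_distrib_left cnj_sum
  by (rule Bochner_Integration.integral_sum) (use assms in \<open>auto intro: square_integrable_mult_cnj\<close>)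

lemma l2_sqnorm_add_le:
  assumes "square_integrable M f" "square_integrable M g"
  shows "l2_sqnorm M (\<lambda>x. f x + g x) \<le> 2 * l2_sqnorm M f + 2 * l2_sqnorm M g"
proof -
  have "l2_sqnorm M (\<lambda>x. f x + g x) \<le> (LINT x|M. 2 * (cmod (f x))\<^sup>2 + 2 * (cmod (g x))\<^sup>2)"
    unfolding l2_sqnorm_def using assms square_integrable_add[OF assms]
    by (intro integral_mono) (auto intro!: square_integrableD assms square_integrable_add simp: cmod_add_sq_le)
  also have "\<dots> = 2 * l2_sqnorm M f + 2 * l2_sqnorm M g"
    unfolding l2_sqnorm_def using assms by (subst Bochner_Integration.integral_add) (auto intro!: square_integrableD)
  finally show ?thesis .
qed

lemma l2_sqnorm_diff_commute: "l2_sqnorm M (\<lambda>x. f x - g x) = l2_sqnorm M (\<lambda>x. g x - f x)"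
  by (simp add: l2_sqnorm_def norm_minus_commute)

lemma l2_sqnorm_triangle:
  assumes "square_integrable M f" "square_integrable M g" "square_integrable M h"
  shows "l2_sqnorm M (\<lambda>x. f x - h x) \<le> 2 * l2_sqnorm M (\<lambda>x. f x - g x) + 2 * l2_sqnorm M (\<lambda>x. g x - h x)"
  using l2_sqnorm_add_le[OF square_integrable_diff[OF assms(1,2)] square_integrable_diff[OF assms(2,3)]] by simp

lemma l2_sqnorm_cmult: "l2_sqnorm M (\<lambda>x. c * f x) = (cmod c)\<^sup>2 * l2_sqnorm M f"
  by (simp add: l2_sqnorm_def norm_mult power_mult_distrib)

lemma l2_sqnorm_mono:
  assumes "square_integrable M g" "f \<in> borel_measurable M" "\<And>x. x \<in> space M \<Longrightarrow> cmod (f x) \<le> cmod (g x)"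
  shows "l2_sqnorm M f \<le> l2_sqnorm M g"
proof -
  have "square_integrable M f"
    by (rule square_integrable_bound[where C = 1]) (use assms in auto)
  then show ?thesis
    unfolding l2_sqnorm_def using assms by (intro integral_mono) (auto intro!: square_integrableD power_mono)
qed

text \<open>The discriminant argument for \<open>t f - b g\<close>, where \<open>b\<close> is the inner product of \<open>f\<close> and \<open>g\<close>;
  with this factor every mixed term becomes real.\<close>

lemma l2_inner_Cauchy_Schwarz:
  assumes "square_integrable M f" "square_integrable M g"
  shows "cmod (l2_inner M f g) \<le> sqrt (l2_sqnorm M f) * sqrt (l2_sqnorm M g)"
proof -
  let ?a = "l2_sqnorm M f" and ?c = "l2_sqnorm M g" and ?b = "l2_inner M f g"
  have q: "0 \<le> ?a * t\<^sup>2 - 2 * t * (cmod ?b)\<^sup>2 + (cmod ?b)\<^sup>2 * ?c" for t :: real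
  proof -
    have tf: "square_integrable M (\<lambda>x. of_real t * f x)" and bg: "square_integrable M (\<lambda>x. ?b * g x)"
      using assms by (auto intro: square_integrable_cmult)
    let ?h = "\<lambda>x. of_real t * f x - ?b * g x"
    have b': "l2_inner M g f = cnj ?b" by (metis l2_inner_commute)
    have "of_real (l2_sqnorm M ?h) = l2_inner M ?h ?h"
      by (simp add: l2_inner_self)
    also have "\<dots> = of_real t * (of_real t * l2_inner M f f - cnj ?b * ?b)
        - ?b * (of_real t * l2_inner M g f - cnj ?b * l2_inner M g g)"
      using assms tf bg square_integrable_diff[OF tf bg]
      by (simp add: l2_inner_diff_left l2_inner_diff_right l2_inner_cmult_left l2_inner_cmult_right
          right_diff_distrib)
    also have "\<dots> = of_real (?a * t\<^sup>2) - 2 * of_real t * (?b * cnj ?b) + ?b * cnj ?b * of_real ?c"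
      unfolding l2_inner_self b' by (simp add: algebra_simps power2_eq_square)
    also have "?b * cnj ?b = of_real ((cmod ?b)\<^sup>2)"
      by (rule complex_norm_square[symmetric])
    also have "of_real (?a * t\<^sup>2) - 2 * of_real t * complex_of_real ((cmod ?b)\<^sup>2) + of_real ((cmod ?b)\<^sup>2) * of_real ?c
        = of_real (?a * t\<^sup>2 - 2 * t * (cmod ?b)\<^sup>2 + (cmod ?b)\<^sup>2 * ?c)"
      by simp
    finally have "l2_sqnorm M ?h = ?a * t\<^sup>2 - 2 * t * (cmod ?b)\<^sup>2 + (cmod ?b)\<^sup>2 * ?c"
      using of_real_eq_iff by blast
    then show ?thesis using l2_sqnorm_nonneg[of M ?h] by simp
  qed
  have ac: "0 \<le> ?a" "0 \<le> ?c" by (simp_all add: l2_sqnorm_nonneg)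
  have "(cmod ?b)\<^sup>2 \<le> ?a * ?c"
  proof (cases "?b = 0 \<or> ?a = 0")
    case True
    moreover have "?b = 0" if "?a = 0"
    proof (rule ccontr)
      assume b: "?b \<noteq> 0"
      have "0 \<le> (cmod ?b)\<^sup>2 * (?c - 2 * (?c + 1))"
        using q[of "?c + 1"] that by (simp add: algebra_simps)
      moreover have "(cmod ?b)\<^sup>2 > 0" using b by simp
      ultimately show False using ac by (simp add: zero_le_mult_iff)
    qed
    ultimately show ?thesis using ac by auto
  next
    case False
    then have a: "?a > 0" and b: "(cmod ?b)\<^sup>2 > 0" using ac by auto
    have "0 \<le> ?a * (?a * ((cmod ?b)\<^sup>2 / ?a)\<^sup>2 - 2 * ((cmod ?b)\<^sup>2 / ?a) * (cmod ?b)\<^sup>2 + (cmod ?b)\<^sup>2 * ?c)"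
      using q[of "(cmod ?b)\<^sup>2 / ?a"] a by simp
    also have "\<dots> = (cmod ?b)\<^sup>2 * (?a * ?c - (cmod ?b)\<^sup>2)"
      using a by (simp add: field_simps power2_eq_square)
    finally show ?thesis using b by (simp add: zero_le_mult_iff)
  qed
  then have "cmod ?b \<le> sqrt (?a * ?c)" by (rule real_le_rsqrt)
  then show ?thesis by (simp add: real_sqrt_mult)
qed

lemma l2_tendstoD:
  assumes "l2_tendsto M F f"
  shows "square_integrable M (F n)" "square_integrable M f"
    "(\<lambda>n. l2_sqnorm M (\<lambda>x. F n x - f x)) \<longlonglongrightarrow> 0"
  using assms by (auto simp: l2_tendsto_def)

lemma l2_tendsto_const: "square_integrable M f \<Longrightarrow> l2_tendsto M (\<lambda>_. f) f"
  by (simp add: l2_tendsto_def l2_sqnorm_def)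

text \<open>Dominated convergence carries pointwise limits over to the mean square.\<close>

lemma l2_tendsto_dominated:
  assumes "\<And>n. F n \<in> borel_measurable M" "f \<in> borel_measurable M" "square_integrable M g"
    and bound: "\<And>n x. x \<in> space M \<Longrightarrow> cmod (F n x) \<le> C * cmod (g x)"
    and lim: "\<And>x. x \<in> space M \<Longrightarrow> (\<lambda>n. F n x) \<longlonglongrightarrow> f x"
  shows "l2_tendsto M F f"
proof -
  have fb: "cmod (f x) \<le> C * cmod (g x)" if "x \<in> space M" for x
    using LIMSEQ_le_const2[OF tendsto_norm[OF lim[OF that]]] bound[OF that] by blast
  have "square_integrable M (F n)" for n
    by (rule square_integrable_bound[OF assms(3)]) (use assms in auto)
  moreover have "square_integrable M f"
    by (rule square_integrable_bound[OF assms(3)]) (use assms fb in auto)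
  moreover have "(\<lambda>n. LINT x|M. (cmod (F n x - f x))\<^sup>2) \<longlonglongrightarrow> (LINT x|M. 0)"
  proof (rule integral_dominated_convergence)
    show "integrable M (\<lambda>x. 4 * C\<^sup>2 * (cmod (g x))\<^sup>2)"
      using square_integrableD[OF assms(3)] by simp
    show "AE x in M. (\<lambda>n. (cmod (F n x - f x))\<^sup>2) \<longlonglongrightarrow> 0"
    proof (rule AE_I2)
      fix x assume "x \<in> space M"
      then have "(\<lambda>n. (cmod (F n x - f x))\<^sup>2) \<longlonglongrightarrow> (cmod (f x - f x))\<^sup>2"
        by (intro tendsto_intros lim)
      then show "(\<lambda>n. (cmod (F n x - f x))\<^sup>2) \<longlonglongrightarrow> 0" by simp
    qed
    show "AE x in M. norm ((cmod (F n x - f x))\<^sup>2) \<le> 4 * C\<^sup>2 * (cmod (g x))\<^sup>2" for n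
    proof (rule AE_I2)
      fix x assume x: "x \<in> space M"
      have "cmod (F n x - f x) \<le> 2 * C * cmod (g x)"
        using norm_triangle_ineq4[of "F n x" "f x"] bound[OF x, of n] fb[OF x] by simp
      then have "(cmod (F n x - f x))\<^sup>2 \<le> (2 * C * cmod (g x))\<^sup>2"
        by (intro power_mono) auto
      then show "norm ((cmod (F n x - f x))\<^sup>2) \<le> 4 * C\<^sup>2 * (cmod (g x))\<^sup>2"
        by (simp add: power_mult_distrib)
    qed
  qed (use assms in auto)
  ultimately show ?thesis by (simp add: l2_tendsto_def l2_sqnorm_def)
qed

lemma l2_tendsto_inner:
  assumes F: "l2_tendsto M F f" and G: "l2_tendsto M G g"
  shows "(\<lambda>n. l2_inner M (F n) (G n)) \<longlonglongrightarrow> l2_inner M f g"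
proof -
  note [simp] = l2_tendstoD(1,2)[OF F] l2_tendstoD(1,2)[OF G]
  define a where "a n = sqrt (l2_sqnorm M (\<lambda>x. F n x - f x))" for n
  define b where "b n = sqrt (l2_sqnorm M (\<lambda>x. G n x - g x))" for n
  have a: "a \<longlonglongrightarrow> 0" and b: "b \<longlonglongrightarrow> 0"
    using tendsto_real_sqrt[OF l2_tendstoD(3)[OF F]] tendsto_real_sqrt[OF l2_tendstoD(3)[OF G]]
    by (simp_all add: a_def[abs_def] b_def[abs_def])
  have "cmod (l2_inner M (F n) (G n) - l2_inner M f g)
      \<le> a n * b n + a n * sqrt (l2_sqnorm M g) + sqrt (l2_sqnorm M f) * b n" for n
  proof -
    have s: "square_integrable M (\<lambda>x. F n x - f x)" "square_integrable M (\<lambda>x. G n x - g x)"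
      by (auto intro: square_integrable_diff)
    have "l2_inner M (F n) (G n) - l2_inner M f g =
        l2_inner M (\<lambda>x. F n x - f x) (\<lambda>x. G n x - g x) + l2_inner M (\<lambda>x. F n x - f x) g
        + l2_inner M f (\<lambda>x. G n x - g x)"
      using s by (simp add: l2_inner_diff_left l2_inner_diff_right)
    moreover have "cmod (l2_inner M (\<lambda>x. F n x - f x) (\<lambda>x. G n x - g x)) \<le> a n * b n"
      "cmod (l2_inner M (\<lambda>x. F n x - f x) g) \<le> a n * sqrt (l2_sqnorm M g)"
      "cmod (l2_inner M f (\<lambda>x. G n x - g x)) \<le> sqrt (l2_sqnorm M f) * b n"
      unfolding a_def b_def by (rule l2_inner_Cauchy_Schwarz; simp add: s)+
    ultimately show ?thesis
      using norm_triangle_ineq[of "l2_inner M (\<lambda>x. F n x - f x) (\<lambda>x. G n x - g x) + l2_inner M (\<lambda>x. F n x - f x) g"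
          "l2_inner M f (\<lambda>x. G n x - g x)"]
        norm_triangle_ineq[of "l2_inner M (\<lambda>x. F n x - f x) (\<lambda>x. G n x - g x)" "l2_inner M (\<lambda>x. F n x - f x) g"]
      by simp
  qed
  moreover have "(\<lambda>n. a n * b n + a n * sqrt (l2_sqnorm M g) + sqrt (l2_sqnorm M f) * b n) \<longlonglongrightarrow>
      0 * 0 + 0 * sqrt (l2_sqnorm M g) + sqrt (l2_sqnorm M f) * 0"
    by (intro tendsto_intros a b)
  ultimately have "(\<lambda>n. l2_inner M (F n) (G n) - l2_inner M f g) \<longlonglongrightarrow> 0"
    by (rule_tac Lim_null_comparison[OF always_eventually]) simp_all
  then show ?thesis by (simp add: LIM_zero_iff)
qed

lemma l2_sqnorm_eq_0_iff:
  assumes "square_integrable M f"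
  shows "l2_sqnorm M f = 0 \<longleftrightarrow> (AE x in M. f x = 0)"
  unfolding l2_sqnorm_def
  by (subst integral_nonneg_eq_0_iff_AE) (auto intro!: square_integrableD assms)

section \<open>Completeness of the square integrable functions\<close>

lemma nn_integral_cmod_sq_le:
  assumes "square_integrable M f"
  shows "(\<integral>\<^sup>+x. ennreal ((cmod (f x))\<^sup>2) \<partial>M) = ennreal (l2_sqnorm M f)"
  unfolding l2_sqnorm_def by (rule nn_integral_eq_integral) (auto intro!: square_integrableD assms)

text \<open>Since the measure is finite, the increments are also summable in mean; hence their pointwise sums
  are finite almost everywhere and the sequence telescopes to a convergent series.\<close>

lemma l2_AE_convergent_if_fast_Cauchy:
  assumes "finite_measure M" and F: "\<And>n. square_integrable M (F n)"
    and fast: "\<And>n. l2_sqnorm M (\<lambda>x. F (Suc n) x - F n x) \<le> (1/4) ^ n"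
  shows "AE x in M. convergent (\<lambda>n. F n x)"
proof -
  interpret finite_measure M by fact
  define D where "D n x = F (Suc n) x - F n x" for n x
  have D: "square_integrable M (D n)" for n
    unfolding D_def by (intro square_integrable_diff F)
  have [measurable]: "D n \<in> borel_measurable M" for n using D by (rule square_integrable_measurable)
  define C where "C = sqrt (l2_sqnorm M (\<lambda>_. 1))"
  have one: "square_integrable M (\<lambda>_. 1)" by (simp add: square_integrable_def)
  have "(LINT x|M. cmod (D n x)) \<le> C * (1/2) ^ n" for n
  proof -
    have aD: "square_integrable M (\<lambda>x. of_real (cmod (D n x)))"
      using D[of n] by (simp add: square_integrable_def)
    have "of_real (LINT x|M. cmod (D n x)) = l2_inner M (\<lambda>x. of_real (cmod (D n x))) (\<lambda>_. 1)"
      by (simp add: l2_inner_def)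
    then have "\<bar>LINT x|M. cmod (D n x)\<bar> = cmod (l2_inner M (\<lambda>x. of_real (cmod (D n x))) (\<lambda>_. 1))"
      by (metis norm_of_real)
    also have "\<dots> \<le> sqrt (l2_sqnorm M (\<lambda>x. of_real (cmod (D n x)))) * C"
      unfolding C_def by (rule l2_inner_Cauchy_Schwarz[OF aD one])
    also have "l2_sqnorm M (\<lambda>x. of_real (cmod (D n x))) = l2_sqnorm M (D n)"
      by (simp add: l2_sqnorm_def)
    also have "sqrt (l2_sqnorm M (D n)) \<le> (1/2) ^ n"
    proof (rule real_le_lsqrt)
      show "l2_sqnorm M (D n) \<le> ((1 / 2) ^ n)\<^sup>2"
        using fast[of n] by (simp add: D_def[abs_def] power_mult[symmetric] mult.commute[of n] power_mult power_divide)
    qed simp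
    finally show ?thesis by (simp add: C_def mult.commute mult_right_mono l2_sqnorm_nonneg)
  qed
  then have "(\<integral>\<^sup>+x. ennreal (cmod (D n x)) \<partial>M) \<le> ennreal (C * (1/2) ^ n)" for n
    using nn_integral_eq_integral[of M "\<lambda>x. cmod (D n x)"]
      square_integrable_integrable[OF assms(1) D] by (simp add: ennreal_leI)
  then have "(\<Sum>n. \<integral>\<^sup>+x. ennreal (cmod (D n x)) \<partial>M) \<le> (\<Sum>n. ennreal (C * (1/2) ^ n))"
    by (intro suminf_le) auto
  also have "\<dots> = ennreal (\<Sum>n. C * (1/2) ^ n)"
    by (intro suminf_ennreal2 summable_mult summable_geometric) (auto simp: C_def l2_sqnorm_nonneg)
  also have "\<dots> < \<infinity>" by simp
  finally have "(\<integral>\<^sup>+x. (\<Sum>n. ennreal (cmod (D n x))) \<partial>M) \<noteq> \<infinity>"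
    by (subst nn_integral_suminf) auto
  then have "AE x in M. (\<Sum>n. ennreal (cmod (D n x))) \<noteq> \<infinity>"
    by (intro nn_integral_PInf_AE) auto
  then show ?thesis
  proof eventually_elim
    case (elim x)
    then have "summable (\<lambda>n. cmod (D n x))"
      by (intro summable_suminf_not_top) auto
    then have "summable (\<lambda>n. D n x)" by (rule summable_norm_cancel)
    then have "convergent (\<lambda>n. F 0 x + (\<Sum>i<n. D i x))"
      by (simp add: summable_iff_convergent convergent_add_const_iff)
    moreover have "F 0 x + (\<Sum>i<n. D i x) = F n x" for n
      by (induction n) (auto simp: D_def add.assoc[symmetric])
    ultimately show ?case by simp
  qed
qed

lemma strict_mono_Cauchy_choice:
  fixes d :: "nat \<Rightarrow> nat \<Rightarrow> real"
  assumes "\<And>e. e > 0 \<Longrightarrow> \<exists>N. \<forall>m\<ge>N. \<forall>n\<ge>N. d m n < e"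
  shows "\<exists>r :: nat \<Rightarrow> nat. strict_mono r \<and> (\<forall>n. d (r (Suc n)) (r n) \<le> (1/4) ^ n)"
proof -
  have "\<forall>n. \<exists>N. \<forall>i\<ge>N. \<forall>j\<ge>N. d i j < (1/4) ^ n" using assms by simp
  then obtain N where N: "\<And>n i j. i \<ge> N n \<Longrightarrow> j \<ge> N n \<Longrightarrow> d i j < (1/4) ^ n" by metis
  \<comment> \<open>Partial sums make the indices strictly increasing and keep them above every threshold passed so far.\<close>
  define r where "r n = (\<Sum>i\<le>n. Suc (N i))" for n
  have "r n \<ge> N n" for n by (cases n) (auto simp: r_def)
  moreover have sm: "strict_mono r" by (rule strict_mono_Suc_iff[THEN iffD2]) (auto simp: r_def)
  moreover have "r n \<le> r (Suc n)" for n using sm by (simp add: strict_mono_less_eq)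
  ultimately show ?thesis
    by (intro exI[of _ r]) (meson N le_trans less_imp_le)
qed

text \<open>Riesz--Fischer: a fast Cauchy subsequence converges almost everywhere, and Fatou's lemma
  shows that its pointwise limit is the limit in mean square of the whole sequence.\<close>

lemma l2_complete:
  assumes fm: "finite_measure M" and F: "\<And>n. square_integrable M (F n)"
    and Cauchy: "\<And>e. e > 0 \<Longrightarrow> \<exists>N. \<forall>m\<ge>N. \<forall>n\<ge>N. l2_sqnorm M (\<lambda>x. F m x - F n x) < e"
  shows "\<exists>f. l2_tendsto M F f"
proof -
  from strict_mono_Cauchy_choice[OF Cauchy] obtain r :: "nat \<Rightarrow> nat" where r: "strict_mono r"
    and fast: "\<And>n. l2_sqnorm M (\<lambda>x. F (r (Suc n)) x - F (r n) x) \<le> (1/4) ^ n" by blast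
  have [measurable]: "F n \<in> borel_measurable M" for n using F by (rule square_integrable_measurable)
  define f where "f x = lim (\<lambda>n. F (r n) x)" for x
  have [measurable]: "f \<in> borel_measurable M"
    unfolding f_def by (rule borel_measurable_lim_metric) simp
  have conv: "AE x in M. (\<lambda>n. F (r n) x) \<longlonglongrightarrow> f x"
    using l2_AE_convergent_if_fast_Cauchy[of M "\<lambda>n. F (r n)", OF fm F fast]
    by eventually_elim (simp add: f_def convergent_LIMSEQ_iff)
  have close: "\<exists>N. \<forall>m\<ge>N. (\<integral>\<^sup>+x. ennreal ((cmod (F m x - f x))\<^sup>2) \<partial>M) \<le> ennreal e" if "e > 0" for e
  proof -
    from Cauchy[OF that] obtain N where N: "\<And>m n. m \<ge> N \<Longrightarrow> n \<ge> N \<Longrightarrow> l2_sqnorm M (\<lambda>x. F m x - F n x) < e"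
      by blast
    show ?thesis
    proof (intro exI allI impI)
      fix m assume m: "m \<ge> N"
      have "(\<integral>\<^sup>+x. ennreal ((cmod (F m x - f x))\<^sup>2) \<partial>M)
          = (\<integral>\<^sup>+x. liminf (\<lambda>k. ennreal ((cmod (F m x - F (r k) x))\<^sup>2)) \<partial>M)"
      proof (rule nn_integral_cong_AE, use conv in eventually_elim)
        case (elim x)
        have "(\<lambda>k. ennreal ((cmod (F m x - F (r k) x))\<^sup>2)) \<longlonglongrightarrow> ennreal ((cmod (F m x - f x))\<^sup>2)"
          by (intro tendsto_intros elim tendsto_ennrealI)
        from lim_imp_Liminf[OF _ this] show ?case by simp
      qed
      also have "\<dots> \<le> liminf (\<lambda>k. \<integral>\<^sup>+x. ennreal ((cmod (F m x - F (r k) x))\<^sup>2) \<partial>M)"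
        by (rule nn_integral_liminf) simp
      also have "\<dots> \<le> ennreal e"
      proof (rule Liminf_le)
        show "eventually (\<lambda>k. (\<integral>\<^sup>+x. ennreal ((cmod (F m x - F (r k) x))\<^sup>2) \<partial>M) \<le> ennreal e) sequentially"
          using eventually_ge_at_top[of N]
        proof eventually_elim
          case (elim k)
          then have "r k \<ge> N" using seq_suble[OF r, of k] by linarith
          then show ?case
            using N[OF m] by (subst nn_integral_cmod_sq_le) (auto intro: square_integrable_diff F ennreal_leI less_imp_le)
        qed
      qed simp
      finally show "(\<integral>\<^sup>+x. ennreal ((cmod (F m x - f x))\<^sup>2) \<partial>M) \<le> ennreal e" .
    qed
  qed
  have sq: "square_integrable M (\<lambda>x. F m x - f x)"
    if "(\<integral>\<^sup>+x. ennreal ((cmod (F m x - f x))\<^sup>2) \<partial>M) \<le> ennreal e" for m e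
    unfolding square_integrable_def
  proof
    show "integrable M (\<lambda>x. (cmod (F m x - f x))\<^sup>2)"
      using that by (intro integrableI_bounded) (auto intro: le_less_trans)
  qed simp
  obtain m where "(\<integral>\<^sup>+x. ennreal ((cmod (F m x - f x))\<^sup>2) \<partial>M) \<le> ennreal 1"
    using close[of 1] by auto
  from square_integrable_diff[OF F[of m] sq[OF this]] have f: "square_integrable M f" by simp
  moreover have "(\<lambda>n. l2_sqnorm M (\<lambda>x. F n x - f x)) \<longlonglongrightarrow> 0"
  proof (rule LIMSEQ_I)
    fix e :: real assume "e > 0"
    then obtain N where N: "\<And>m. m \<ge> N \<Longrightarrow> (\<integral>\<^sup>+x. ennreal ((cmod (F m x - f x))\<^sup>2) \<partial>M) \<le> ennreal (e / 2)"
      using close[of "e / 2"] by auto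
    have "l2_sqnorm M (\<lambda>x. F m x - f x) \<le> e / 2" if "m \<ge> N" for m
      using N[OF that] \<open>e > 0\<close> by (simp add: nn_integral_cmod_sq_le square_integrable_diff F f ennreal_le_iff)
    then show "\<exists>no. \<forall>n\<ge>no. norm (l2_sqnorm M (\<lambda>x. F n x - f x) - 0) < e"
      using \<open>e > 0\<close> by (intro exI[of _ N]) (force simp: l2_sqnorm_nonneg)
  qed
  ultimately show ?thesis using F by (auto simp: l2_tendsto_def)
qed

section \<open>Trigonometric polynomials on the torus\<close>

definition torus :: "(complex \<times> complex) set"
  where "torus = sphere 0 1 \<times> sphere 0 1"

definition character :: "int \<times> int \<Rightarrow> complex \<times> complex \<Rightarrow> complex"
  where "character p z = fst z powi fst p * snd z powi snd p"

text \<open>Only the values on the torus count, so that conjugation and inversion of a coordinate agree.\<close>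

definition trig_poly :: "(complex \<times> complex \<Rightarrow> complex) \<Rightarrow> bool"
  where "trig_poly f \<longleftrightarrow> (\<exists>I c. finite I \<and> (\<forall>z\<in>torus. f z = (\<Sum>p\<in>I. c p * character p z)))"

lemma compact_torus: "compact torus"
  by (simp add: torus_def compact_Times)

lemma cmod_character: "z \<in> torus \<Longrightarrow> cmod (character p z) = 1"
  by (auto simp: torus_def character_def norm_mult norm_power_int)

lemma character_add:
  "z \<in> torus \<Longrightarrow> character (p + q) z = character p z * character q z"
proof -
  assume "z \<in> torus"
  then have "fst z \<noteq> 0" "snd z \<noteq> 0" by (auto simp: torus_def)
  then show ?thesis by (simp add: character_def power_int_add)
qed

lemma character_0 [simp]: "character (0, 0) z = 1" by (simp add: character_def)

lemma cnj_character: "z \<in> torus \<Longrightarrow> cnj (character p z) = character (- p) z"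
proof -
  assume z: "z \<in> torus"
  have "character p z * cnj (character p z) = 1"
    using cmod_character[OF z, of p] by (simp add: complex_norm_square[symmetric])
  moreover have "character p z * character (- p) z = 1"
    using character_add[OF z, of p "- p"] by (simp add: zero_prod_def)
  moreover have "character p z \<noteq> 0" using cmod_character[OF z, of p] by auto
  ultimately show ?thesis by (metis mult_left_cancel)
qed

lemma continuous_character: "continuous_on torus (character p)"
  unfolding character_def by (intro continuous_intros) (auto simp: torus_def)

lemma trig_polyI:
  "finite I \<Longrightarrow> (\<And>z. z \<in> torus \<Longrightarrow> f z = (\<Sum>p\<in>I. c p * character p z)) \<Longrightarrow> trig_poly f"
  by (auto simp: trig_poly_def)

lemma trig_poly_cong: "trig_poly f \<Longrightarrow> (\<And>z. z \<in> torus \<Longrightarrow> g z = f z) \<Longrightarrow> trig_poly g"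
  by (auto simp: trig_poly_def)

lemma trig_poly_character: "trig_poly (\<lambda>z. c * character p z)"
  by (rule trig_polyI[of "{p}" _ "\<lambda>_. c"]) auto

lemma trig_poly_const: "trig_poly (\<lambda>_. c)"
  using trig_poly_character[of c "(0, 0)"] by simp

lemma trig_poly_add:
  assumes "trig_poly f" "trig_poly g"
  shows "trig_poly (\<lambda>z. f z + g z)"
proof -
  obtain I c J d where f: "finite I" "\<And>z. z \<in> torus \<Longrightarrow> f z = (\<Sum>p\<in>I. c p * character p z)"
    and g: "finite J" "\<And>z. z \<in> torus \<Longrightarrow> g z = (\<Sum>p\<in>J. d p * character p z)"
    using assms by (auto simp: trig_poly_def)
  show ?thesis
  proof (rule trig_polyI[of "I \<union> J" _ "\<lambda>p. (if p \<in> I then c p else 0) + (if p \<in> J then d p else 0)"])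
    fix z assume z: "z \<in> torus"
    have 1: "(\<Sum>p\<in>I. c p * character p z) = (\<Sum>p\<in>I \<union> J. (if p \<in> I then c p else 0) * character p z)"
      using f(1) g(1) by (intro sum.mono_neutral_cong_left) auto
    have 2: "(\<Sum>p\<in>J. d p * character p z) = (\<Sum>p\<in>I \<union> J. (if p \<in> J then d p else 0) * character p z)"
      using f(1) g(1) by (intro sum.mono_neutral_cong_left) auto
    show "f z + g z = (\<Sum>p\<in>I \<union> J. ((if p \<in> I then c p else 0) + (if p \<in> J then d p else 0)) * character p z)"
      unfolding f(2)[OF z] g(2)[OF z] 1 2 by (simp add: distrib_right sum.distrib)
  qed (use f g in auto)
qed

lemma trig_poly_sum:
  "(\<And>i. i \<in> I \<Longrightarrow> trig_poly (f i)) \<Longrightarrow> trig_poly (\<lambda>z. \<Sum>i\<in>I. f i z)"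
  by (induction I rule: infinite_finite_induct) (auto intro: trig_poly_add trig_poly_const)

lemma trig_poly_mult:
  assumes "trig_poly f" "trig_poly g"
  shows "trig_poly (\<lambda>z. f z * g z)"
proof -
  obtain I c J d where f: "finite I" "\<And>z. z \<in> torus \<Longrightarrow> f z = (\<Sum>p\<in>I. c p * character p z)"
    and g: "finite J" "\<And>z. z \<in> torus \<Longrightarrow> g z = (\<Sum>p\<in>J. d p * character p z)"
    using assms by (auto simp: trig_poly_def)
  have "trig_poly (\<lambda>z. \<Sum>p\<in>I. \<Sum>q\<in>J. (c p * d q) * character (p + q) z)"
    by (intro trig_poly_sum trig_poly_character)
  then show ?thesis
    by (rule trig_poly_cong) (simp add: f(2) g(2) sum_product character_add mult_ac)
qed

text \<open>Real and imaginary parts of the coordinates are combinations of a coordinate and its conjugate,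
  which on the torus is the character of the opposite frequency.\<close>

lemma trig_poly_coordinate_functions:
  fixes f :: "complex \<times> complex \<Rightarrow> real"
  assumes "real_polynomial_function f"
  shows "trig_poly (\<lambda>z. of_real (f z))"
  using assms
proof induction
  case (linear h)
  interpret bounded_linear h by fact
  have coords: "trig_poly (\<lambda>z. of_real (Re (fst z)))" "trig_poly (\<lambda>z. of_real (Im (fst z)))"
    "trig_poly (\<lambda>z. of_real (Re (snd z)))" "trig_poly (\<lambda>z. of_real (Im (snd z)))"
  proof -
    have fst: "trig_poly fst" and snd: "trig_poly snd"
      using trig_poly_character[of 1 "(1, 0)"] trig_poly_character[of 1 "(0, 1)"]
      by (simp_all add: character_def)
    have "trig_poly (\<lambda>z. cnj (character (1, 0) z))" "trig_poly (\<lambda>z. cnj (character (0, 1) z))"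
      by (rule trig_poly_cong[OF trig_poly_character[of 1]]; simp add: cnj_character)+
    then have cnj: "trig_poly (\<lambda>z. cnj (fst z))" "trig_poly (\<lambda>z. cnj (snd z))"
      by (simp_all add: character_def)
    have ReIm: "of_real (Re w) = 1/2 * w + 1/2 * cnj w" "of_real (Im w) = - \<i>/2 * w + \<i>/2 * cnj w" for w
      by (simp_all add: complex_eq_iff)
    show "trig_poly (\<lambda>z. of_real (Re (fst z)))" "trig_poly (\<lambda>z. of_real (Im (fst z)))"
    "trig_poly (\<lambda>z. of_real (Re (snd z)))" "trig_poly (\<lambda>z. of_real (Im (snd z)))"
      unfolding ReIm by (intro trig_poly_add trig_poly_mult trig_poly_const fst snd cnj)+
  qed
  have "h z = Re (fst z) * h (1, 0) + Im (fst z) * h (\<i>, 0) + Re (snd z) * h (0, 1) + Im (snd z) * h (0, \<i>)" for z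
  proof -
    have "z = Re (fst z) *\<^sub>R (1, 0) + Im (fst z) *\<^sub>R (\<i>, 0) + Re (snd z) *\<^sub>R (0, 1) + Im (snd z) *\<^sub>R (0, \<i>)"
      by (auto simp: prod_eq_iff complex_eq_iff)
    then show ?thesis by (metis add scaleR real_scaleR_def)
  qed
  then have "(\<lambda>z. complex_of_real (h z)) = (\<lambda>z. of_real (Re (fst z)) * of_real (h (1, 0)) +
      of_real (Im (fst z)) * of_real (h (\<i>, 0)) + of_real (Re (snd z)) * of_real (h (0, 1)) +
      of_real (Im (snd z)) * of_real (h (0, \<i>)))"
    by (metis (no_types, lifting) of_real_add of_real_mult)
  then show ?case
    by (simp only:) (intro trig_poly_add trig_poly_mult trig_poly_const coords)
next
  case (const c)
  then show ?case by (rule trig_poly_const)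
next
  case (add f g)
  then show ?case using trig_poly_add by simp
next
  case (mult f g)
  then show ?case using trig_poly_mult by simp
qed

lemma trig_poly_dense_continuous:
  fixes f :: "complex \<times> complex \<Rightarrow> real"
  assumes "continuous_on torus f" "e > 0"
  obtains g where "trig_poly g" "\<And>z. z \<in> torus \<Longrightarrow> cmod (of_real (f z) - g z) < e"
proof -
  obtain g where "real_polynomial_function g" "\<And>z. z \<in> torus \<Longrightarrow> \<bar>f z - g z\<bar> < e"
    using Stone_Weierstrass_real_polynomial_function[OF compact_torus assms] by metis
  then show ?thesis
    using trig_poly_coordinate_functions by (intro that[of "\<lambda>z. of_real (g z)"])
      (auto simp: of_real_diff[symmetric] simp del: of_real_diff)
qed

section \<open>Density of trigonometric polynomials and uniqueness of measures\<close>

text \<open>The hypothesis on the sets says that the map separates points in the measurable sense; it covers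
  both the torus itself and the plane embedded by the Cayley transform.\<close>

locale torus_map = finite_measure M for M :: "'a measure" +
  fixes c :: "'a \<Rightarrow> complex \<times> complex"
  assumes torus_map_measurable [measurable]: "c \<in> borel_measurable M"
    and in_torus: "x \<in> space M \<Longrightarrow> c x \<in> torus"
    and sets_generated: "A \<in> sets M \<Longrightarrow> \<exists>B\<in>sets borel. A = c -` B \<inter> space M"
begin

definition approximable :: "('a \<Rightarrow> complex) \<Rightarrow> bool"
  where "approximable f \<longleftrightarrow> square_integrable M f \<and>
    (\<forall>e>0. \<exists>I a. finite I \<and> l2_sqnorm M (\<lambda>x. f x - (\<Sum>p\<in>I. a p * character p (c x))) < e)"

lemma measurable_character [measurable]: "(\<lambda>x. character p (c x)) \<in> borel_measurable M"
proof -
  have "(\<lambda>z. indicator torus z *\<^sub>R character p z) \<in> borel_measurable borel"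
    using continuous_character compact_torus
    by (intro borel_measurable_continuous_on_indicator) (auto intro: borel_compact)
  from measurable_compose[OF torus_map_measurable this] show ?thesis
    by (rule measurable_cong[THEN iffD1, rotated]) (simp add: in_torus)
qed

lemma square_integrable_character: "square_integrable M (\<lambda>x. character p (c x))"
  by (rule square_integrable_bounded[where C = 1]) (auto simp: cmod_character in_torus finite_measure_axioms)

lemma square_integrable_characters: "square_integrable M (\<lambda>x. \<Sum>p\<in>I. a p * character p (c x))"
  by (intro square_integrable_sum square_integrable_cmult square_integrable_character)

lemma approximableD:
  assumes "approximable f" "e > 0"
  obtains I a where "finite I" "l2_sqnorm M (\<lambda>x. f x - (\<Sum>p\<in>I. a p * character p (c x))) < e"
  using assms by (auto simp: approximable_def)

lemma approximable_square_integrable: "approximable f \<Longrightarrow> square_integrable M f"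
  by (simp add: approximable_def)

lemma approximable_l2_limit:
  assumes "square_integrable M f" "\<And>e. e > 0 \<Longrightarrow> \<exists>g. approximable g \<and> l2_sqnorm M (\<lambda>x. f x - g x) < e"
  shows "approximable f"
  unfolding approximable_def
proof (intro conjI allI impI assms(1))
  fix e :: real assume "e > 0"
  then obtain g where g: "approximable g" "l2_sqnorm M (\<lambda>x. f x - g x) < e / 4"
    using assms(2)[of "e / 4"] by auto
  obtain I a where I: "finite I" "l2_sqnorm M (\<lambda>x. g x - (\<Sum>p\<in>I. a p * character p (c x))) < e / 4"
    using approximableD[OF g(1), of "e / 4"] \<open>e > 0\<close> by auto
  have "l2_sqnorm M (\<lambda>x. f x - (\<Sum>p\<in>I. a p * character p (c x))) \<le>
      2 * l2_sqnorm M (\<lambda>x. f x - g x) + 2 * l2_sqnorm M (\<lambda>x. g x - (\<Sum>p\<in>I. a p * character p (c x)))"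
    by (rule l2_sqnorm_triangle[OF assms(1) approximable_square_integrable[OF g(1)] square_integrable_characters])
  also have "\<dots> < e" using g I by simp
  finally show "\<exists>I a. finite I \<and> l2_sqnorm M (\<lambda>x. f x - (\<Sum>p\<in>I. a p * character p (c x))) < e"
    using I by blast
qed

lemma approximable_tendsto:
  assumes "\<And>n. approximable (F n)" "l2_tendsto M F f"
  shows "approximable f"
proof (rule approximable_l2_limit)
  show "square_integrable M f" using assms(2) by (rule l2_tendstoD)
  fix e :: real assume "e > 0"
  then have "eventually (\<lambda>n. l2_sqnorm M (\<lambda>x. F n x - f x) < e) sequentially"
    using order_tendstoD(2)[OF l2_tendstoD(3)[OF assms(2)]] by simp
  then obtain n where "l2_sqnorm M (\<lambda>x. F n x - f x) < e"
    using eventually_happens'[OF sequentially_bot] by blast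
  then show "\<exists>g. approximable g \<and> l2_sqnorm M (\<lambda>x. f x - g x) < e"
    using assms(1) by (auto simp: l2_sqnorm_diff_commute[of M f])
qed

lemma approximable_trig_poly:
  assumes "trig_poly g"
  shows "approximable (\<lambda>x. g (c x))"
proof -
  obtain I a where I: "finite I" "\<And>z. z \<in> torus \<Longrightarrow> g z = (\<Sum>p\<in>I. a p * character p z)"
    using assms by (auto simp: trig_poly_def)
  have eq: "g (c x) = (\<Sum>p\<in>I. a p * character p (c x))" if "x \<in> space M" for x
    by (rule I(2)[OF in_torus[OF that]])
  have "l2_sqnorm M (\<lambda>x. g (c x) - (\<Sum>p\<in>I. a p * character p (c x))) = l2_sqnorm M (\<lambda>_. 0)"
    unfolding l2_sqnorm_def by (rule Bochner_Integration.integral_cong) (simp_all add: eq)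
  moreover have "square_integrable M (\<lambda>x. g (c x))"
    using square_integrable_characters[of a I] by (subst square_integrable_cong[OF eq]) auto
  ultimately show ?thesis
    using I(1) unfolding approximable_def
    by (intro conjI allI impI exI[of _ I] exI[of _ a]) (auto simp: l2_sqnorm_def)
qed

lemma approximable_add:
  assumes "approximable f" "approximable g"
  shows "approximable (\<lambda>x. f x + g x)"
  unfolding approximable_def
proof (intro conjI allI impI)
  show "square_integrable M (\<lambda>x. f x + g x)"
    using assms by (intro square_integrable_add approximable_square_integrable)
  fix e :: real assume "e > 0"
  then have e4: "e / 4 > 0" by simp
  obtain I a where I: "finite I" "l2_sqnorm M (\<lambda>x. f x - (\<Sum>p\<in>I. a p * character p (c x))) < e / 4"
    using approximableD[OF assms(1) e4] .
  obtain J b where J: "finite J" "l2_sqnorm M (\<lambda>x. g x - (\<Sum>p\<in>J. b p * character p (c x))) < e / 4"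
    using approximableD[OF assms(2) e4] .
  define d where "d p = (if p \<in> I then a p else 0) + (if p \<in> J then b p else 0)" for p
  have "(\<Sum>p\<in>I \<union> J. d p * character p (c x)) =
      (\<Sum>p\<in>I. a p * character p (c x)) + (\<Sum>p\<in>J. b p * character p (c x))" for x
  proof -
    have 1: "(\<Sum>p\<in>I. a p * character p (c x)) = (\<Sum>p\<in>I \<union> J. (if p \<in> I then a p else 0) * character p (c x))"
      using I(1) J(1) by (intro sum.mono_neutral_cong_left) auto
    have 2: "(\<Sum>p\<in>J. b p * character p (c x)) = (\<Sum>p\<in>I \<union> J. (if p \<in> J then b p else 0) * character p (c x))"
      using I(1) J(1) by (intro sum.mono_neutral_cong_left) auto
    show ?thesis unfolding 1 2 d_def by (simp add: distrib_right sum.distrib)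
  qed
  then have "l2_sqnorm M (\<lambda>x. (f x + g x) - (\<Sum>p\<in>I \<union> J. d p * character p (c x))) =
      l2_sqnorm M (\<lambda>x. (f x - (\<Sum>p\<in>I. a p * character p (c x))) + (g x - (\<Sum>p\<in>J. b p * character p (c x))))"
    by (simp add: algebra_simps)
  also have "\<dots> \<le> 2 * l2_sqnorm M (\<lambda>x. f x - (\<Sum>p\<in>I. a p * character p (c x)))
      + 2 * l2_sqnorm M (\<lambda>x. g x - (\<Sum>p\<in>J. b p * character p (c x)))"
    using assms by (intro l2_sqnorm_add_le square_integrable_diff square_integrable_characters approximable_square_integrable)
  also have "\<dots> < e" using I J by simp
  finally show "\<exists>I a. finite I \<and> l2_sqnorm M (\<lambda>x. (f x + g x) - (\<Sum>p\<in>I. a p * character p (c x))) < e"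
    using I(1) J(1) by blast
qed

lemma approximable_cmult:
  assumes "approximable f"
  shows "approximable (\<lambda>x. k * f x)"
proof (cases "k = 0")
  case True
  then show ?thesis using approximable_trig_poly[OF trig_poly_const[of 0]] by simp
next
  case False
  show ?thesis
    unfolding approximable_def
  proof (intro conjI allI impI)
    show "square_integrable M (\<lambda>x. k * f x)"
      using assms by (intro square_integrable_cmult approximable_square_integrable)
    fix e :: real assume "e > 0"
    obtain I a where I: "finite I" "l2_sqnorm M (\<lambda>x. f x - (\<Sum>p\<in>I. a p * character p (c x))) < e / (cmod k)\<^sup>2"
      using approximableD[OF assms, of "e / (cmod k)\<^sup>2"] \<open>e > 0\<close> False by auto
    have "l2_sqnorm M (\<lambda>x. k * f x - (\<Sum>p\<in>I. (k * a p) * character p (c x))) =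
        l2_sqnorm M (\<lambda>x. k * (f x - (\<Sum>p\<in>I. a p * character p (c x))))"
      by (simp add: right_diff_distrib sum_distrib_left mult.assoc)
    also have "\<dots> < e" unfolding l2_sqnorm_cmult using I False by (simp add: field_simps)
    finally show "\<exists>I a. finite I \<and> l2_sqnorm M (\<lambda>x. k * f x - (\<Sum>p\<in>I. a p * character p (c x))) < e"
      using I(1) by (intro exI[of _ I] exI[of _ "\<lambda>p. k * a p"] conjI)
  qed
qed

lemma approximable_sum:
  "(\<And>i. i \<in> I \<Longrightarrow> approximable (f i)) \<Longrightarrow> approximable (\<lambda>x. \<Sum>i\<in>I. f i x)"
  using approximable_trig_poly[OF trig_poly_const[of 0]]
  by (induction I rule: infinite_finite_induct) (auto intro: approximable_add)

text \<open>Uniform approximation on the torus, by the Stone--Weierstrass theorem, is approximation in mean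
  square because the measure is finite.\<close>

lemma approximable_continuous:
  fixes g :: "complex \<times> complex \<Rightarrow> real"
  assumes "continuous_on UNIV g"
  shows "approximable (\<lambda>x. of_real (g (c x)))"
proof (rule approximable_l2_limit)
  have gt: "continuous_on torus g" using assms continuous_on_subset by blast
  have [measurable]: "g \<in> borel_measurable borel" using assms by (rule borel_measurable_continuous_onI)
  obtain B where B: "\<And>z. z \<in> torus \<Longrightarrow> \<bar>g z\<bar> \<le> B"
    using compact_imp_bounded[OF compact_continuous_image[OF gt compact_torus]]
    by (auto simp: bounded_iff)
  show sg: "square_integrable M (\<lambda>x. of_real (g (c x)))"
    by (rule square_integrable_bounded[where C = B]) (auto simp: B in_torus finite_measure_axioms)
  fix e :: real assume "e > 0"
  define m where "m = measure M (space M)"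
  \<comment> \<open>The uniform error that keeps the squared error below \<open>e\<close>; adding 1 covers the null measure.\<close>
  define d where "d = sqrt (e / (m + 1))"
  have "m \<ge> 0" by (simp add: m_def)
  then have d: "d > 0" "d\<^sup>2 * m < e"
    using \<open>e > 0\<close> by (auto simp: d_def field_simps)
  obtain h where h: "trig_poly h" "\<And>z. z \<in> torus \<Longrightarrow> cmod (of_real (g z) - h z) < d"
    using trig_poly_dense_continuous[OF gt d(1)] by blast
  have ap: "approximable (\<lambda>x. h (c x))" using h(1) by (rule approximable_trig_poly)
  have "l2_sqnorm M (\<lambda>x. of_real (g (c x)) - h (c x)) \<le> (LINT x|M. d\<^sup>2)"
    unfolding l2_sqnorm_def
  proof (rule integral_mono)
    show "integrable M (\<lambda>x. (cmod (of_real (g (c x)) - h (c x)))\<^sup>2)"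
      by (intro square_integrableD square_integrable_diff sg approximable_square_integrable ap)
    show "(cmod (of_real (g (c x)) - h (c x)))\<^sup>2 \<le> d\<^sup>2" if "x \<in> space M" for x
      using h(2)[OF in_torus[OF that]] by (intro power_mono) auto
  qed simp
  also have "\<dots> < e" using d by (simp add: m_def mult.commute)
  finally show "\<exists>g'. approximable g' \<and> l2_sqnorm M (\<lambda>x. of_real (g (c x)) - g' x) < e"
    using ap by blast
qed

text \<open>The indicator of a closed set is the decreasing limit of continuous functions of the distance.\<close>

lemma approximable_closed:
  assumes "closed C"
  shows "approximable (\<lambda>x. indicator (c -` C) x)"
proof (cases "C = {}")
  case True
  then show ?thesis using approximable_trig_poly[OF trig_poly_const[of 0]] by simp
next
  case False
  define g where "g n z = max 0 (1 - real n * infdist z C)" for n z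
  have cg: "continuous_on UNIV (g n)" for n
    unfolding g_def by (intro continuous_intros)
  then have [measurable]: "g n \<in> borel_measurable borel" for n by (rule borel_measurable_continuous_onI)
  have [measurable]: "C \<in> sets borel" using assms by simp
  have lim: "(\<lambda>n. g n z) \<longlonglongrightarrow> indicator C z" for z
  proof (cases "z \<in> C")
    case True then show ?thesis by (simp add: g_def)
  next
    case z: False
    then have i: "infdist z C > 0"
      using False assms in_closed_iff_infdist_zero infdist_nonneg[of z C] by fastforce
    obtain N where N: "1 < real N * infdist z C" using reals_Archimedean3[OF i] by blast
    have "eventually (\<lambda>n. g n z = 0) sequentially"
      using eventually_ge_at_top[of N]
    proof eventually_elim
      case (elim n)
      have "real N * infdist z C \<le> real n * infdist z C" using elim i by simp
      then show ?case using N by (simp add: g_def)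
    qed
    then show ?thesis using z by (simp add: tendsto_eventually)
  qed
  have "l2_tendsto M (\<lambda>n x. of_real (g n (c x))) (\<lambda>x. of_real (indicator C (c x)))"
  proof (rule l2_tendsto_dominated[where g = "\<lambda>_. 1" and C = 1])
    show "square_integrable M (\<lambda>_. 1)" by (simp add: square_integrable_def)
    show "cmod (of_real (g n (c x))) \<le> 1 * cmod 1" for n x
      by (simp add: g_def max_def infdist_nonneg)
    show "(\<lambda>n. complex_of_real (g n (c x))) \<longlonglongrightarrow> of_real (indicator C (c x))" for x
      by (intro tendsto_of_real lim)
  qed auto
  from approximable_tendsto[OF _ this] approximable_continuous[OF cg]
  have "approximable (\<lambda>x. of_real (indicator C (c x)))" by blast
  then show ?thesis by (simp add: indicator_def vimage_def of_bool_def if_distrib cong: if_cong)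
qed

text \<open>The closed sets are a generator stable under intersections, and approximability survives complements
  and disjoint unions.\<close>

lemma approximable_borel:
  assumes "B \<in> sets borel"
  shows "approximable (\<lambda>x. indicator (c -` B) x)"
proof -
  have "Int_stable (Collect closed :: (complex \<times> complex) set set)" by (auto simp: Int_stable_def)
  moreover have "Collect closed \<subseteq> Pow (UNIV :: (complex \<times> complex) set)" by simp
  moreover have "B \<in> sigma_sets UNIV (Collect closed)"
    using assms by (simp add: borel_eq_closed)
  ultimately show ?thesis
  proof (induction rule: sigma_sets_induct_disjoint)
    case (basic A) then show ?case using approximable_closed by simp
  next
    case empty then show ?case using approximable_trig_poly[OF trig_poly_const[of 0]] by simp
  next
    case (compl A)
    have "approximable (\<lambda>x. 1 + (- 1) * indicator (c -` A) x)"
      by (intro approximable_add approximable_cmult compl approximable_trig_poly[OF trig_poly_const])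
    moreover have "(\<lambda>x. 1 + (- 1) * indicator (c -` A) x) = (\<lambda>x. indicator (c -` (UNIV - A)) x :: complex)"
      by (auto simp: indicator_def)
    ultimately show ?case by simp
  next
    case (union A)
    have [measurable]: "A n \<in> sets borel" for n using union(2) by (auto simp: borel_eq_closed)
    have dj: "disjoint_family (\<lambda>i. c -` A i)" using union(1) by (fastforce simp: disjoint_family_on_def)
    have part: "(\<Sum>i<n. indicator (c -` A i) x) = (indicator (\<Union>i<n. c -` A i) x :: complex)" for n x
      by (subst indicator_UN_disjoint) (use dj in \<open>auto simp: disjoint_family_on_def\<close>)
    have "l2_tendsto M (\<lambda>n x. \<Sum>i<n. indicator (c -` A i) x) (\<lambda>x. indicator (c -` (\<Union>i. A i)) x)"
    proof (rule l2_tendsto_dominated[where g = "\<lambda>_. 1" and C = 1])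
      show "(\<lambda>x. \<Sum>i<n. indicator (c -` A i) x :: complex) \<in> borel_measurable M" for n
        by (intro borel_measurable_sum borel_measurable_indicator') simp_all
      show "(\<lambda>x. indicator (c -` (\<Union>i. A i)) x :: complex) \<in> borel_measurable M"
        by (intro borel_measurable_indicator') simp_all
      show "square_integrable M (\<lambda>_. 1)" by (simp add: square_integrable_def)
      show "cmod (\<Sum>i<n. indicator (c -` A i) x) \<le> 1 * cmod 1" for n x
        unfolding part by (simp add: indicator_def)
      show "(\<lambda>n. \<Sum>i<n. indicator (c -` A i) x) \<longlonglongrightarrow> (indicator (c -` (\<Union>i. A i)) x :: complex)" for x
        unfolding part vimage_UN by (rule LIMSEQ_indicator_UN)
    qed
    from approximable_tendsto[OF approximable_sum[OF union(3)] this] show ?case .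
  qed
qed

lemma approximable_simple_function:
  fixes s :: "'a \<Rightarrow> complex"
  assumes "simple_function M s"
  shows "approximable s"
proof -
  have fin: "finite (s ` space M)" using assms by (rule simple_functionD)
  have "\<exists>B\<in>sets borel. s -` {y} \<inter> space M = c -` B \<inter> space M" for y
    using assms by (intro sets_generated simple_functionD)
  then obtain B where B: "\<And>y. B y \<in> sets borel" "\<And>y. s -` {y} \<inter> space M = c -` B y \<inter> space M"
    by metis
  let ?t = "\<lambda>x. \<Sum>y\<in>s ` space M. y * indicator (c -` B y) x"
  have ap: "approximable ?t"
    by (intro approximable_sum approximable_cmult approximable_borel B)
  have eq: "s x = ?t x" if x: "x \<in> space M" for x
  proof -
    have "indicator (c -` B y) x = (if y = s x then 1 else 0 :: complex)" for y
      using B(2)[of y] x by (auto simp: indicator_def)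
    then have "?t x = (\<Sum>y\<in>s ` space M. if y = s x then y else 0)"
      by (intro sum.cong) auto
    also have "\<dots> = s x" using fin x by simp
    finally show ?thesis by simp
  qed
  have "square_integrable M s \<longleftrightarrow> square_integrable M ?t"
    by (rule square_integrable_cong) (rule eq)
  then have s: "square_integrable M s" using approximable_square_integrable[OF ap] by blast
  have "l2_sqnorm M (\<lambda>x. s x - ?t x) = l2_sqnorm M (\<lambda>_. 0)"
    unfolding l2_sqnorm_def by (rule Bochner_Integration.integral_cong) (simp_all add: eq[symmetric])
  then have 0: "l2_sqnorm M (\<lambda>x. s x - ?t x) = 0" by (simp add: l2_sqnorm_def)
  show ?thesis
  proof (rule approximable_l2_limit[OF s])
    show "\<exists>g. approximable g \<and> l2_sqnorm M (\<lambda>x. s x - g x) < e" if "e > 0" for e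
      using ap 0 that by (intro exI[of _ ?t]) simp
  qed
qed

theorem square_integrable_approximable:
  assumes f: "square_integrable M f"
  shows "approximable f"
proof -
  have [measurable]: "f \<in> borel_measurable M" using f by (rule square_integrable_measurable)
  obtain s where s: "\<And>i. simple_function M (s i)" "\<And>x. x \<in> space M \<Longrightarrow> (\<lambda>i. s i x) \<longlonglongrightarrow> f x"
     "\<And>i x. x \<in> space M \<Longrightarrow> dist (s i x) 0 \<le> 2 * dist (f x) 0"
    using borel_measurable_implies_sequence_metric[of f M 0] by simp metis
  have "l2_tendsto M s f"
    by (rule l2_tendsto_dominated[OF _ _ f, where C = 2])
       (use s in \<open>auto intro: borel_measurable_simple_function\<close>)
  then show ?thesis using approximable_simple_function[OF s(1)] by (rule approximable_tendsto[rotated])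
qed

end

lemma l2_sqnorm_mono_measure:
  assumes sets: "sets M = sets N" and le: "\<And>A. A \<in> sets M \<Longrightarrow> emeasure M A \<le> emeasure N A"
    and f: "square_integrable N f"
  shows "square_integrable M f" "l2_sqnorm M f \<le> l2_sqnorm N f"
proof -
  have space: "space M = space N" by (rule sets_eq_imp_space_eq[OF sets])
  have "emeasure M A \<le> emeasure N A" for A
    using le[of A] by (cases "A \<in> sets M") (auto simp: emeasure_notin_sets sets)
  then have MN: "M \<le> N" by (simp add: le_measure[OF sets] le_fun_def)
  have m: "f \<in> borel_measurable M"
    using square_integrable_measurable[OF f] by (simp add: measurable_cong_sets[OF sets refl])
  have nn: "(\<integral>\<^sup>+x. ennreal ((cmod (f x))\<^sup>2) \<partial>M) \<le> ennreal (l2_sqnorm N f)"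
    using nn_integral_mono_measure[OF sets MN] nn_integral_cmod_sq_le[OF f] by metis
  show M: "square_integrable M f"
    unfolding square_integrable_def using m nn
    by (auto intro!: integrableI_bounded intro: le_less_trans)
  show "l2_sqnorm M f \<le> l2_sqnorm N f"
    using nn by (simp add: nn_integral_cmod_sq_le[OF M] ennreal_le_iff l2_sqnorm_nonneg)
qed

text \<open>The sum of the two measures.\<close>

lemma ex_finite_measure_dominating:
  assumes "finite_measure M" "finite_measure M'" and sets: "sets M' = sets M"
  shows "\<exists>N. finite_measure N \<and> sets N = sets M \<and>
    (\<forall>A\<in>sets M. emeasure M A \<le> emeasure N A \<and> emeasure M' A \<le> emeasure N A)"
proof -
  interpret M: finite_measure M by fact
  interpret M': finite_measure M' by fact
  define N where "N = measure_of (space M) (sets M) (\<lambda>A. emeasure M A + emeasure M' A)"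
  have sN: "sets N = sets M" "space N = space M" by (simp_all add: N_def)
  have N: "emeasure N A = emeasure M A + emeasure M' A" if "A \<in> sets M" for A
  proof (rule emeasure_measure_of[OF N_def])
    show "countably_additive (sets N) (\<lambda>A. emeasure M A + emeasure M' A)"
      unfolding countably_additive_def
    proof (intro allI impI)
      fix A :: "nat \<Rightarrow> 'a set"
      assume A: "range A \<subseteq> sets N" "disjoint_family A"
      show "(\<Sum>i. emeasure M (A i) + emeasure M' (A i)) = emeasure M (\<Union> (range A)) + emeasure M' (\<Union> (range A))"
        using A by (subst suminf_add[symmetric]) (auto simp: suminf_emeasure sN sets)
    qed
  qed (use that in \<open>auto simp: positive_def sN dest: sets.sets_into_space\<close>)
  have "finite_measure N"
    by (rule finite_measureI)
      (use N[of "space M"] M'.emeasure_finite sets_eq_imp_space_eq[OF sets] in \<open>auto simp: sN\<close>)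
  then show ?thesis using N by (intro exI[of _ N]) (auto simp: sN)
qed

lemma (in finite_measure) has_bochner_integral_complex_indicator:
  assumes "A \<in> sets M"
  shows "has_bochner_integral M (indicator A) (complex_of_real (measure M A))"
proof -
  have "has_bochner_integral M (\<lambda>x. complex_of_real (indicator A x)) (of_real (measure M A))"
    using assms by (intro has_bochner_integral_of_real has_bochner_integral_real_indicator)
      (auto simp: emeasure_eq_measure)
  then show ?thesis by (simp add: of_real_indicator)
qed

text \<open>Both integrals of a trigonometric polynomial close to an indicator in the mean square of a
  measure dominating \<open>M\<close> and \<open>M'\<close> are close to the respective measures of the set.\<close>

theorem torus_measure_eqI:
  assumes M: "torus_map M c" and M': "torus_map M' c" and sets: "sets M' = sets M"
    and eq: "\<And>p. (LINT x|M. character p (c x)) = (LINT x|M'. character p (c x))"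
  shows "M = M'"
proof (rule measure_eqI)
  interpret M: torus_map M c by fact
  interpret M': torus_map M' c by fact
  show "sets M = sets M'" by (simp add: sets)
  fix A assume A: "A \<in> sets M"
  obtain N where N: "finite_measure N" "sets N = sets M"
    and dom: "\<And>A. A \<in> sets M \<Longrightarrow> emeasure M A \<le> emeasure N A"
      "\<And>A. A \<in> sets M \<Longrightarrow> emeasure M' A \<le> emeasure N A"
    using ex_finite_measure_dominating[OF M.finite_measure_axioms M'.finite_measure_axioms sets] by auto
  have space: "space N = space M" "space M' = space M"
    using N(2) sets by (auto dest: sets_eq_imp_space_eq)
  interpret N: torus_map N c
  proof (intro torus_map.intro N(1) torus_map_axioms.intro)
    show "c \<in> borel_measurable N"
      using M.torus_map_measurable measurable_cong_sets[OF N(2) refl] by blast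
  qed (use M.in_torus M.sets_generated in \<open>auto simp: space N(2)\<close>)
  define K where "K = sqrt (l2_sqnorm M (\<lambda>_. 1)) + sqrt (l2_sqnorm M' (\<lambda>_. 1))"
  have K0: "K \<ge> 0" by (simp add: K_def l2_sqnorm_nonneg)
  have bound: "\<bar>measure M A - measure M' A\<bar> \<le> e * K" if e: "e > 0" for e
  proof -
    have iA: "square_integrable N (indicator A)"
      using A by (intro square_integrable_bounded[OF N(1), where C = 1] borel_measurable_indicator)
        (auto simp: N(2) indicator_def)
    obtain I a where I: "finite I" "l2_sqnorm N (\<lambda>x. indicator A x - (\<Sum>p\<in>I. a p * character p (c x))) < e\<^sup>2"
      using N.approximableD[OF N.square_integrable_approximable[OF iA], of "e\<^sup>2"] e by auto
    let ?P = "\<lambda>x. \<Sum>p\<in>I. a p * character p (c x)"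
    have close: "cmod (of_real (measure L A) - (LINT x|L. ?P x)) \<le> e * sqrt (l2_sqnorm L (\<lambda>_. 1))"
      if L: "torus_map L c" "sets L = sets M" and domL: "\<And>A. A \<in> sets M \<Longrightarrow> emeasure L A \<le> emeasure N A" for L
    proof -
      interpret L: torus_map L c by fact
      have sq: "square_integrable N (\<lambda>x. indicator A x - ?P x)"
        by (intro square_integrable_diff iA N.square_integrable_characters)
      have sqL: "square_integrable L (\<lambda>x. indicator A x - ?P x)"
        and le: "l2_sqnorm L (\<lambda>x. indicator A x - ?P x) \<le> l2_sqnorm N (\<lambda>x. indicator A x - ?P x)"
        by (rule l2_sqnorm_mono_measure[OF _ _ sq]; simp add: L(2) N(2) domL)+
      have one: "square_integrable L (\<lambda>_. 1)" by (simp add: square_integrable_def)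
      have "has_bochner_integral L (indicator A) (complex_of_real (measure L A))"
        using A by (intro L.has_bochner_integral_complex_indicator) (simp add: L(2))
      moreover have "integrable L ?P"
        using square_integrable_integrable[OF L.finite_measure_axioms L.square_integrable_characters] .
      ultimately have "of_real (measure L A) - (LINT x|L. ?P x) = l2_inner L (\<lambda>x. indicator A x - ?P x) (\<lambda>_. 1)"
        by (simp add: l2_inner_def has_bochner_integral_iff)
      also have "cmod \<dots> \<le> sqrt (l2_sqnorm L (\<lambda>x. indicator A x - ?P x)) * sqrt (l2_sqnorm L (\<lambda>_. 1))"
        by (rule l2_inner_Cauchy_Schwarz[OF sqL one])
      also have "\<dots> \<le> e * sqrt (l2_sqnorm L (\<lambda>_. 1))"
        using le I(2) e by (intro mult_right_mono real_le_lsqrt) (auto simp: l2_sqnorm_nonneg)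
      finally show ?thesis .
    qed
    have "(LINT x|M. ?P x) = (LINT x|M'. ?P x)"
      by (subst (1 2) Bochner_Integration.integral_sum)
         (auto simp: eq intro!: square_integrable_integrable M.finite_measure_axioms M'.finite_measure_axioms
           square_integrable_cmult M.square_integrable_character M'.square_integrable_character)
    then have diff: "complex_of_real (measure M A - measure M' A) =
        (of_real (measure M A) - (LINT x|M. ?P x)) - (of_real (measure M' A) - (LINT x|M'. ?P x))"
      by simp
    have "\<bar>measure M A - measure M' A\<bar> = cmod (of_real (measure M A - measure M' A))"
      by (rule norm_of_real[symmetric])
    also have "\<dots> \<le> cmod (of_real (measure M A) - (LINT x|M. ?P x))
        + cmod (of_real (measure M' A) - (LINT x|M'. ?P x))"
      unfolding diff by (rule norm_triangle_ineq4)
    also have "\<dots> \<le> e * K"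
      using close[OF M refl dom(1)] close[OF M' sets dom(2)] by (simp add: K_def algebra_simps)
    finally show ?thesis .
  qed
  have "\<bar>measure M A - measure M' A\<bar> \<le> 0"
  proof (rule field_le_epsilon)
    fix e :: real assume "e > 0"
    then have "e / (K + 1) * K \<le> e" using K0 by (simp add: field_simps)
    then show "\<bar>measure M A - measure M' A\<bar> \<le> 0 + e"
      using bound[of "e / (K + 1)"] \<open>e > 0\<close> K0 by auto
  qed
  then show "emeasure M A = emeasure M' A"
    by (simp add: M.emeasure_eq_measure M'.emeasure_eq_measure)
qed

section \<open>Schoenberg's space-filling curve\<close>

text \<open>Continuous of period 2, equal to 0 on the first and to 1 on the last third of the unit interval.\<close>

definition bump :: "real \<Rightarrow> real"
  where "bump t = max 0 (min 1 (1/2 - cos (pi * t)))"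

text \<open>The coordinates of the curve are the cases 0 and 1 of \<open>j\<close>: they read the ternary digits at even and
  at odd places, and use them as binary digits.\<close>

definition schoenberg :: "nat \<Rightarrow> real \<Rightarrow> real"
  where "schoenberg j t = (\<Sum>n. (1/2) ^ Suc n * bump (3 ^ (2 * n + j) * t))"

lemma bump_bounds: "0 \<le> bump t" "bump t \<le> 1" by (auto simp: bump_def)

lemma bump_add_even: "bump (t + 2 * of_int k) = bump t"
proof -
  have "cos (pi * (t + 2 * of_int k)) = cos (pi * t + of_int k * (2 * pi))" by (simp add: algebra_simps)
  also have "\<dots> = cos (pi * t)" using cos_int_2pin[of k] sin_int_2pin[of k] by (simp add: cos_add mult_ac)
  finally show ?thesis by (simp add: bump_def)
qed

lemma bump_eq_0:
  assumes "0 \<le> t" "t \<le> 1/3"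
  shows "bump t = 0"
proof -
  have "cos (pi / 3) \<le> cos (pi * t)" using assms by (intro cos_monotone_0_pi_le) auto
  then show ?thesis by (simp add: bump_def cos_60)
qed

lemma bump_eq_1:
  assumes "2/3 \<le> t" "t \<le> 1"
  shows "bump t = 1"
proof -
  have "cos (pi * t) \<le> cos (2 * pi / 3)" using assms by (intro cos_monotone_0_pi_le) auto
  then show ?thesis by (simp add: bump_def cos_120)
qed

text \<open>A uniformly convergent series of continuous functions.\<close>

lemma continuous_on_schoenberg: "continuous_on UNIV (schoenberg j)"
proof -
  have "uniform_limit UNIV (\<lambda>N t. \<Sum>n<N. (1/2) ^ Suc n * bump (3 ^ (2 * n + j) * t)) (schoenberg j) sequentially"
    unfolding schoenberg_def
  proof (rule Weierstrass_m_test)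
    show "summable (\<lambda>n. (1/2) ^ Suc n :: real)" using summable_Suc_iff summable_geometric[of "1/2::real"] by simp
    show "norm ((1/2) ^ Suc n * bump (3 ^ (2 * n + j) * t)) \<le> (1/2) ^ Suc n" for n t
      using bump_bounds[of "3 ^ (2 * n + j) * t"] by (simp add: abs_mult field_simps)
  qed
  then show ?thesis
    by (rule uniform_limit_theorem[rotated])
       (auto simp: bump_def[abs_def] intro!: always_eventually continuous_intros)
qed

text \<open>The tails of a ternary expansion with digits 0 and 2 reveal the digits one by one.\<close>

lemma bump_ternary:
  fixes d :: "nat \<Rightarrow> nat"
  assumes d: "\<And>n. d n \<in> {0, 1}"
  shows "\<exists>t. 0 \<le> t \<and> t \<le> 1 \<and> (\<forall>n. bump (3 ^ n * t) = d n)"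
proof -
  \<comment> \<open>The tail \<open>r n\<close> differs from \<open>3 ^ n\<close> times the whole number by an even integer, a period of \<open>bump\<close>,
    and its leading digit decides in which third of the unit interval it lies.\<close>
  define r where "r n = (\<Sum>m. 2 * real (d (n + m)) * (1/3) ^ Suc m)" for n
  have g: "(\<lambda>m. 2 * (1/3) ^ Suc m :: real) sums 1"
    using sums_mult[OF geometric_sums[of "1/3 :: real"], of "2/3"] by simp
  have le: "2 * real (d (n + m)) * (1/3) ^ Suc m \<le> 2 * (1/3) ^ Suc m" for n m
    using d[of "n + m"] by auto
  have sm: "summable (\<lambda>m. 2 * real (d (n + m)) * (1/3) ^ Suc m)" for n
    by (rule summable_comparison_test'[OF sums_summable[OF g], of 0]) (use le in auto)
  have r01: "0 \<le> r n" "r n \<le> 1" for n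
  proof -
    show "0 \<le> r n" unfolding r_def by (intro suminf_nonneg sm) simp
    show "r n \<le> 1" using suminf_le[OF le sm sums_summable[OF g]] sums_unique[OF g] by (simp add: r_def)
  qed
  have step: "3 * r n = 2 * d n + r (Suc n)" for n
  proof -
    have "r n = 2 * real (d n) / 3 + (\<Sum>m. 2 * real (d (n + Suc m)) * (1/3) ^ Suc (Suc m))"
      using suminf_split_head[OF sm[of n]] by (simp add: r_def)
    also have "(\<Sum>m. 2 * real (d (n + Suc m)) * (1/3) ^ Suc (Suc m)) = r (Suc n) / 3"
      using suminf_divide[OF sm[of "Suc n"], of 3] by (simp add: r_def)
    finally show ?thesis by simp
  qed
  have "\<exists>k :: int. 3 ^ n * r 0 = r n + 2 * of_int k" for n
  proof (induction n)
    case (Suc n)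
    then obtain k :: int where "3 ^ n * r 0 = r n + 2 * of_int k" by auto
    then have "3 ^ Suc n * r 0 = r (Suc n) + 2 * of_int (int (d n) + 3 * k)"
      using step[of n] by simp
    then show ?case by blast
  qed (auto intro: exI[of _ 0])
  then have "bump (3 ^ n * r 0) = bump (r n)" for n by (metis bump_add_even)
  moreover have "bump (r n) = d n" for n
    using d[of n] step[of n] r01[of "Suc n"] by (auto intro!: bump_eq_0 bump_eq_1)
  ultimately show ?thesis using r01[of 0] by (intro exI[of _ "r 0"]) auto
qed

lemma binary_digits:
  fixes x :: real
  assumes "0 \<le> x" "x < 1"
  obtains d :: "nat \<Rightarrow> nat" where "\<And>n. d n \<in> {0, 1}" "(\<lambda>n. (1/2) ^ Suc n * real (d n)) sums x"
proof -
  \<comment> \<open>The orbit of the doubling map; the digits are the integer parts cut off on the way.\<close>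
  define y where "y = rec_nat x (\<lambda>_ t. frac (2 * t))"
  have y: "y 0 = x" "y (Suc n) = frac (2 * y n)" for n by (simp_all add: y_def)
  have y01: "0 \<le> y n" "y n < 1" for n
    using assms by (cases n; simp add: y frac_lt_1)+
  define d where "d n = nat \<lfloor>2 * y n\<rfloor>" for n
  have fl: "\<lfloor>2 * y n\<rfloor> \<in> {0, 1}" for n
  proof -
    have "0 \<le> \<lfloor>2 * y n\<rfloor>" "\<lfloor>2 * y n\<rfloor> < 2"
      using y01[of n] floor_less_iff[of "2 * y n" 2] by auto
    then have "\<lfloor>2 * y n\<rfloor> = 0 \<or> \<lfloor>2 * y n\<rfloor> = 1" by presburger
    then show ?thesis by simp
  qed
  have "nat z \<in> {0, 1} \<and> real (nat z) = of_int z" if "z \<in> {0, 1}" for z :: int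
    using that by auto
  from this[OF fl] have d01: "d n \<in> {0, 1}" and df: "real (d n) = of_int \<lfloor>2 * y n\<rfloor>" for n
    unfolding d_def by blast+
  have dy: "real (d n) = 2 * y n - y (Suc n)" for n
    unfolding df y frac_def by simp
  have part: "(\<Sum>n<N. (1/2) ^ Suc n * real (d n)) = x - (1/2) ^ N * y N" for N
  proof (induction N)
    case (Suc N)
    have "(1/2) ^ Suc N * real (d N) = (1/2) ^ N * y N - (1/2) ^ Suc N * y (Suc N)"
      unfolding dy by (simp add: right_diff_distrib)
    then show ?case using Suc.IH by (simp only: sum.lessThan_Suc)
  qed (simp add: y(1))
  have "(\<lambda>N. (1/2) ^ N * y N) \<longlonglongrightarrow> 0"
  proof (rule Lim_null_comparison[OF always_eventually])
    show "\<forall>N. norm ((1/2) ^ N * y N) \<le> (1/2) ^ N"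
      using y01 by (auto simp: abs_mult intro!: mult_left_le less_imp_le)
    show "(\<lambda>N. (1/2) ^ N :: real) \<longlonglongrightarrow> 0" by (rule LIMSEQ_realpow_zero) auto
  qed
  then have "(\<lambda>N. x - (1/2) ^ N * y N) \<longlonglongrightarrow> x - 0" by (intro tendsto_intros)
  then have "(\<lambda>n. (1/2) ^ Suc n * real (d n)) sums x" unfolding sums_def part by simp
  with d01 show ?thesis by (rule that)
qed

theorem schoenberg_surj:
  assumes "0 \<le> x" "x < 1" "0 \<le> y" "y < 1"
  obtains t where "0 \<le> t" "t \<le> 1" "schoenberg 0 t = x" "schoenberg 1 t = y"
proof -
  obtain a where a: "\<And>n. a n \<in> {0, 1::nat}" "(\<lambda>n. (1/2) ^ Suc n * real (a n)) sums x"
    using binary_digits[OF assms(1,2)] by blast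
  obtain b where b: "\<And>n. b n \<in> {0, 1::nat}" "(\<lambda>n. (1/2) ^ Suc n * real (b n)) sums y"
    using binary_digits[OF assms(3,4)] by blast
  \<comment> \<open>Interleave the binary digits of the two coordinates.\<close>
  define e where "e m = (if even m then a (m div 2) else b (m div 2))" for m
  have "e m \<in> {0, 1}" for m using a(1) b(1) by (simp add: e_def)
  then obtain t where t: "0 \<le> t" "t \<le> 1" "\<forall>n. bump (3 ^ n * t) = e n"
    using bump_ternary by blast
  have "schoenberg 0 t = x" "schoenberg 1 t = y"
    unfolding schoenberg_def t(3)[rule_format] sums_unique[OF a(2)] sums_unique[OF b(2)]
    by (simp_all add: e_def)
  with t show ?thesis by (intro that)
qed

section \<open>Herglotz's theorem on the torus\<close>

text \<open>A geometric sum of roots of unity, whose ratio differs from 1 because \<open>j\<close> is too small to be a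
  nonzero multiple of \<open>M\<close>.\<close>

lemma sum_cis_powi:
  assumes "M > 0" "\<bar>j\<bar> < int M"
  shows "(\<Sum>a<M. cis (2 * pi * real a / real M) powi j) = (if j = 0 then of_nat M else 0)"
proof (cases "j = 0")
  case False
  define w where "w = cis (2 * pi * j / M)"
  have "cis (2 * pi * real a / real M) powi j = w ^ a" for a :: nat
  proof -
    have "cis (2 * pi * a / M) powi j = cis (real_of_int j * (2 * pi * a / M))" by (rule cis_power_int)
    also have "real_of_int j * (2 * pi * a / M) = real a * (2 * pi * j / M)" by simp
    also have "cis \<dots> = w ^ a" unfolding w_def by (rule Complex.DeMoivre[symmetric])
    finally show ?thesis .
  qed
  moreover have "w \<noteq> 1"
  proof
    assume "w = 1"
    then have "cos (2 * pi * j / M) = 1" by (simp add: w_def complex_eq_iff)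
    then obtain n :: int where "2 * pi * j / M = of_int n * 2 * pi" using cos_one_2pi_int by blast
    then have "real_of_int j = of_int (n * int M)" using assms(1) by (simp add: field_simps)
    then have "j = n * int M" by linarith
    moreover from this False have "n \<noteq> 0" by auto
    ultimately have "int M \<le> \<bar>j\<bar>" using assms(1) by (simp add: abs_mult mult_le_cancel_right1)
    with assms(2) show False by simp
  qed
  moreover have "w ^ M = 1"
  proof -
    have "w ^ M = cis (2 * pi * j)" using assms(1) by (simp add: w_def Complex.DeMoivre)
    also have "\<dots> = 1" using cis_multiple_2pi[of "of_int j"] by simp
    finally show ?thesis .
  qed
  ultimately show ?thesis using False by (simp add: sum_gp_strict)
qed simp

definition grid_point :: "nat \<Rightarrow> nat \<times> nat \<Rightarrow> complex \<times> complex"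
  where "grid_point M = (\<lambda>(a, b). (cis (2 * pi * a / M), cis (2 * pi * b / M)))"

lemma grid_point_in_torus: "grid_point M x \<in> torus"
  by (cases x) (simp add: grid_point_def torus_def)

lemma sum_grid_character:
  assumes "M > 0" "\<bar>fst k\<bar> < int M" "\<bar>snd k\<bar> < int M"
  shows "(\<Sum>x\<in>{..<M} \<times> {..<M}. character k (grid_point M x)) = (if k = 0 then of_nat (M\<^sup>2) else 0)"
proof -
  have "(\<Sum>x\<in>{..<M} \<times> {..<M}. character k (grid_point M x)) =
      (\<Sum>a<M. cis (2 * pi * real a / M) powi fst k) * (\<Sum>b<M. cis (2 * pi * real b / M) powi snd k)"
    unfolding sum_product sum.cartesian_product
    by (intro sum.cong) (auto simp: grid_point_def character_def)
  also have "\<dots> = (if k = 0 then of_nat (M\<^sup>2) else 0)"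
    unfolding sum_cis_powi[OF assms(1,2)] sum_cis_powi[OF assms(1,3)]
    by (simp add: prod_eq_iff power2_eq_square)
  finally show ?thesis .
qed

text \<open>The number of occurrences of a frequency in a Fejer mean.\<close>

lemma card_pairs_with_difference:
  assumes "\<bar>j\<bar> \<le> int N"
  shows "card {(p, q). p \<in> {0..<int N} \<and> q \<in> {0..<int N} \<and> p - q = j} = nat (int N - \<bar>j\<bar>)"
proof -
  have "{(p, q). p \<in> {0..<int N} \<and> q \<in> {0..<int N} \<and> p - q = j} =
      (\<lambda>q. (q + j, q)) ` {max 0 (- j)..<min (int N) (int N - j)}"
    by (auto simp: image_iff)
  moreover have "inj_on (\<lambda>q. (q + j, q)) {max 0 (- j)..<min (int N) (int N - j)}" by (auto simp: inj_on_def)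
  ultimately have "card {(p, q). p \<in> {0..<int N} \<and> q \<in> {0..<int N} \<and> p - q = j} =
      card {max 0 (- j)..<min (int N) (int N - j)}" by (simp add: card_image)
  also have "\<dots> = nat (int N - \<bar>j\<bar>)" using assms by (auto simp: min_def max_def abs_if)
  finally show ?thesis .
qed

text \<open>The discrete Fejer means: averaging a positive definite sequence over a box yields a
  nonnegative trigonometric polynomial; sampled on a grid of roots of unity fine enough to be
  orthogonal for all occurring frequencies, it gives finitely many weights with nearly the
  prescribed moments.\<close>

lemma fejer_weights:
  fixes s :: "int \<times> int \<Rightarrow> complex"
  assumes pd: "\<And>I \<alpha>. finite I \<Longrightarrow> (\<Sum>p\<in>I. \<Sum>q\<in>I. \<alpha> p * cnj (\<alpha> q) * s (p - q)) \<in> \<real>\<^sub>\<ge>\<^sub>0"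
    and N: "N > 0"
  shows "\<exists>w :: nat \<times> nat \<Rightarrow> real. (\<forall>x. w x \<ge> 0) \<and>
    (\<forall>k. \<bar>fst k\<bar> \<le> int N \<longrightarrow> \<bar>snd k\<bar> \<le> int N \<longrightarrow>
      (\<Sum>x\<in>{..<2*N} \<times> {..<2*N}. of_real (w x) * character k (grid_point (2*N) x))
        = s k * of_real ((1 - real_of_int \<bar>fst k\<bar> / real N) * (1 - real_of_int \<bar>snd k\<bar> / real N)))"
proof -
  \<comment> \<open>The frequencies below come from \<open>\<bar>k\<bar> \<le> N\<close> and a difference of two points of the box, so they stay
    below \<open>2 * N\<close> and vanish on the grid unless they are 0.\<close>
  define M where "M = 2 * N"
  have M: "M > 0" using N by (simp add: M_def)
  define J where "J = {0..<int N} \<times> {0..<int N}"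
  have fJ: "finite J" by (simp add: J_def)
  let ?G = "{..<M} \<times> {..<M}"
  define f where "f z = (\<Sum>p\<in>J. \<Sum>q\<in>J. cnj (character p z) * character q z * s (p - q))" for z
  have f: "f z \<in> \<real>\<^sub>\<ge>\<^sub>0" for z
    using pd[OF fJ, of "\<lambda>p. cnj (character p z)"] by (simp add: f_def)
  then have ff: "f z = of_real (Re (f z))" and f0: "Re (f z) \<ge> 0" for z
    using f[of z] by (auto simp: complex_nonneg_Reals_iff complex_eq_iff)
  define w where "w x = Re (f (grid_point M x)) / (N\<^sup>2 * M\<^sup>2)" for x
  have w: "of_real (w x) = f (grid_point M x) / of_nat (N\<^sup>2 * M\<^sup>2)" for x
    by (subst ff) (simp add: w_def)
  have mom: "(\<Sum>x\<in>?G. of_real (w x) * character k (grid_point M x))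
        = s k * of_real ((1 - real_of_int \<bar>fst k\<bar> / real N) * (1 - real_of_int \<bar>snd k\<bar> / real N))"
    if k: "\<bar>fst k\<bar> \<le> int N" "\<bar>snd k\<bar> \<le> int N" for k
  proof -
    have "(\<Sum>x\<in>?G. f (grid_point M x) * character k (grid_point M x)) =
        (\<Sum>x\<in>?G. \<Sum>p\<in>J. \<Sum>q\<in>J. s (p - q) * character (k + q - p) (grid_point M x))"
    proof (rule sum.cong[OF refl])
      fix x
      have "cnj (character p (grid_point M x)) * character q (grid_point M x) * s (p - q) *
          character k (grid_point M x) = s (p - q) * character (k + q - p) (grid_point M x)" for p q
        using character_add[OF grid_point_in_torus[of M x], of "k + q" "- p"]
          character_add[OF grid_point_in_torus[of M x], of k q]
        by (simp add: cnj_character[OF grid_point_in_torus])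
      then show "f (grid_point M x) * character k (grid_point M x) =
          (\<Sum>p\<in>J. \<Sum>q\<in>J. s (p - q) * character (k + q - p) (grid_point M x))"
        by (simp only: f_def sum_distrib_right)
    qed
    also have "\<dots> = (\<Sum>p\<in>J. \<Sum>q\<in>J. \<Sum>x\<in>?G. s (p - q) * character (k + q - p) (grid_point M x))"
      by (subst sum.swap, intro sum.cong refl, rule sum.swap)
    also have "\<dots> = (\<Sum>p\<in>J. \<Sum>q\<in>J. if p - q = k then s k * of_nat (M\<^sup>2) else 0)"
    proof (intro sum.cong refl)
      fix p q assume "p \<in> J" "q \<in> J"
      then have "\<bar>fst (k + q - p)\<bar> < int M" "\<bar>snd (k + q - p)\<bar> < int M"
        using k by (auto simp: J_def M_def abs_if split: if_splits)
      moreover have "k + q - p = 0 \<longleftrightarrow> p - q = k" by (auto simp: prod_eq_iff)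
      ultimately show "(\<Sum>x\<in>?G. s (p - q) * character (k + q - p) (grid_point M x)) =
          (if p - q = k then s k * of_nat (M\<^sup>2) else 0)"
        using sum_grid_character[OF M, of "k + q - p"] by (simp add: sum_distrib_left[symmetric])
    qed
    also have "\<dots> = s k * of_nat (M\<^sup>2) * of_nat (card {(p, q). p \<in> J \<and> q \<in> J \<and> p - q = k})"
    proof -
      have set: "{(p, q). p \<in> J \<and> q \<in> J \<and> p - q = k} = {x \<in> J \<times> J. fst x - snd x = k}" by auto
      have "(\<Sum>p\<in>J. \<Sum>q\<in>J. if p - q = k then s k * of_nat (M\<^sup>2) else 0) =
          (\<Sum>x\<in>J \<times> J. if fst x - snd x = k then s k * of_nat (M\<^sup>2) else 0)"
        by (simp only: sum.cartesian_product case_prod_unfold)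
      also have "\<dots> = (\<Sum>x\<in>{x \<in> J \<times> J. fst x - snd x = k}. s k * of_nat (M\<^sup>2))"
        by (rule sum.inter_filter[symmetric]) (simp add: fJ)
      finally show ?thesis unfolding set by simp
    qed
    also have "card {(p, q). p \<in> J \<and> q \<in> J \<and> p - q = k} = nat (int N - \<bar>fst k\<bar>) * nat (int N - \<bar>snd k\<bar>)"
    proof -
      let ?A = "\<lambda>j. {(p, q). p \<in> {0..<int N} \<and> q \<in> {0..<int N} \<and> p - q = j}"
      \<comment> \<open>The count factors over the two coordinates.\<close>
      let ?h = "\<lambda>((p1, q1), (p2, q2)). ((p1, p2), (q1, q2))"
      have "{(p, q). p \<in> J \<and> q \<in> J \<and> p - q = k} = ?h ` (?A (fst k) \<times> ?A (snd k))"
        by (cases k) (auto simp: J_def image_iff)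
      moreover have "inj_on ?h (?A (fst k) \<times> ?A (snd k))" by (auto simp: inj_on_def)
      ultimately have "card {(p, q). p \<in> J \<and> q \<in> J \<and> p - q = k} = card (?A (fst k) \<times> ?A (snd k))"
        by (simp only: card_image)
      then show ?thesis using k by (simp only: card_cartesian_product card_pairs_with_difference)
    qed
    finally have fsum: "(\<Sum>x\<in>?G. f (grid_point M x) * character k (grid_point M x)) =
        s k * of_nat (M\<^sup>2) * of_nat (nat (int N - \<bar>fst k\<bar>) * nat (int N - \<bar>snd k\<bar>))" .
    have fac: "(1 - real_of_int \<bar>fst k\<bar> / real N) * (1 - real_of_int \<bar>snd k\<bar> / real N) =
        real (nat (int N - \<bar>fst k\<bar>) * nat (int N - \<bar>snd k\<bar>)) / real (N\<^sup>2)"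
      using k N by (simp add: field_simps power2_eq_square)
    have "(\<Sum>x\<in>?G. of_real (w x) * character k (grid_point M x)) =
        (\<Sum>x\<in>?G. f (grid_point M x) * character k (grid_point M x)) / of_nat (N\<^sup>2 * M\<^sup>2)"
      by (simp add: w sum_divide_distrib)
    also have "\<dots> = s k * of_real (real (nat (int N - \<bar>fst k\<bar>) * nat (int N - \<bar>snd k\<bar>)) / real (N\<^sup>2))"
      unfolding fsum using M N by simp
    finally show ?thesis unfolding fac .
  qed
  show ?thesis
  proof (intro exI[of _ w] conjI allI impI)
    show "w x \<ge> 0" for x by (simp add: w_def f0)
  qed (rule mom[unfolded M_def])
qed

definition torus_curve :: "real \<Rightarrow> complex \<times> complex"
  where "torus_curve t = (cis (2 * pi * schoenberg 0 t), cis (2 * pi * schoenberg 1 t))"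

lemma torus_curve_in_torus: "torus_curve t \<in> torus"
  by (simp add: torus_curve_def torus_def)

lemma continuous_torus_curve: "continuous_on UNIV torus_curve"
  unfolding torus_curve_def cis_conv_exp
  by (intro continuous_intros continuous_on_schoenberg)

lemma grid_point_on_torus_curve:
  assumes "x \<in> {..<M} \<times> {..<M}"
  shows "\<exists>t. 0 \<le> t \<and> t \<le> 1 \<and> torus_curve t = grid_point M x"
proof -
  obtain a b where x: "x = (a, b)" "a < M" "b < M" using assms by auto
  obtain t where "0 \<le> t" "t \<le> 1" "schoenberg 0 t = real a / M" "schoenberg 1 t = real b / M"
    using schoenberg_surj[of "real a / M" "real b / M"] x by auto
  then show ?thesis by (intro exI[of _ t]) (simp add: torus_curve_def grid_point_def x)
qed

lemma isCont_character_torus_curve: "isCont (\<lambda>t. character k (torus_curve t)) t"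
proof -
  have "continuous_on UNIV (\<lambda>t. character k (torus_curve t))"
    by (rule continuous_on_compose2[OF continuous_character continuous_torus_curve])
       (auto simp: torus_curve_in_torus)
  then show ?thesis by (simp add: continuous_on_eq_continuous_at)
qed

text \<open>Finitely supported measures on the torus lift along the curve to measures on a bounded
  interval.  Tightness there is trivial, so that the compactness theorem for distributions on the
  line supplies a limit measure, which the curve carries back to the torus.\<close>

lemma torus_prob_limit:
  fixes w :: "nat \<Rightarrow> nat \<times> nat \<Rightarrow> real" and M :: "nat \<Rightarrow> nat" and s :: "int \<times> int \<Rightarrow> complex"
  assumes w: "\<And>n x. w n x \<ge> 0" and one: "\<And>n. (\<Sum>x\<in>{..<M n} \<times> {..<M n}. w n x) = 1"
    and lim: "\<And>k. (\<lambda>n. \<Sum>x\<in>{..<M n} \<times> {..<M n}. of_real (w n x) * character k (grid_point (M n) x)) \<longlonglongrightarrow> s k"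
  shows "\<exists>L :: real measure. prob_space L \<and> sets L = sets borel \<and> (\<forall>k. (LINT t|L. character k (torus_curve t)) = s k)"
proof -
  let ?G = "\<lambda>n. {..<M n} \<times> {..<M n}"
  have "\<forall>n. \<forall>x\<in>?G n. \<exists>t. 0 \<le> t \<and> t \<le> 1 \<and> torus_curve t = grid_point (M n) x"
    using grid_point_on_torus_curve by blast
  then obtain \<tau> where \<tau>: "\<And>n x. x \<in> ?G n \<Longrightarrow> 0 \<le> \<tau> n x \<and> \<tau> n x \<le> 1 \<and> torus_curve (\<tau> n x) = grid_point (M n) x"
    by metis
  define P where "P n = point_measure (?G n) (\<lambda>x. ennreal (w n x))" for n
  define L where "L n = distr (P n) borel (\<tau> n)" for n
  have m: "\<tau> n \<in> measurable (P n) borel" for n by (simp add: P_def)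
  have P1: "prob_space (P n)" for n
  proof (rule prob_spaceI)
    have "(\<Sum>x\<in>?G n. ennreal (w n x)) = ennreal (\<Sum>x\<in>?G n. w n x)" by (simp add: sum_ennreal w)
    then show "emeasure (P n) (space (P n)) = 1"
      by (simp add: P_def space_point_measure emeasure_point_measure_finite one)
  qed
  have L1: "prob_space (L n)" for n
    unfolding L_def by (rule prob_space.prob_space_distr[OF P1 m])
  have Ld: "real_distribution (L n)" for n
    by (intro real_distribution.intro L1 real_distribution_axioms.intro) (simp add: L_def)
  have "tight L"
    unfolding tight_def
  proof (intro conjI allI impI Ld)
    fix e :: real assume "e > 0"
    have "measure (L n) {-1<..1} = 1" for n
    proof -
      have "\<tau> n -` {-1<..1} \<inter> space (P n) = space (P n)"
      proof -
        have "-1 < \<tau> n x \<and> \<tau> n x \<le> 1" if "x \<in> space (P n)" for x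
          using \<tau>[of x n] that by (auto simp: P_def space_point_measure)
        then show ?thesis by auto
      qed
      then have "measure (L n) {-1<..1} = measure (P n) (space (P n))"
        unfolding L_def by (subst measure_distr[OF m]) simp_all
      then show ?thesis using prob_space.prob_space[OF P1] by simp
    qed
    then show "\<exists>a b. a < b \<and> (\<forall>n. 1 - e < measure (L n) {a<..b})"
      using \<open>e > 0\<close> by (intro exI[of _ "-1"] exI[of _ 1]) simp
  qed
  from tight_imp_convergent_subsubsequence[OF this, of id]
  obtain r :: "nat \<Rightarrow> nat" and L0 where r: "strict_mono r" and L0: "real_distribution L0"
    and conv: "weak_conv_m (L \<circ> id \<circ> r) L0"
    by (auto simp: strict_mono_def)
  have "(LINT t|L0. character k (torus_curve t)) = s k" for k
  proof (rule LIMSEQ_unique)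
    have LG: "(LINT t|L n. character k (torus_curve t)) =
        (\<Sum>x\<in>?G n. of_real (w n x) * character k (grid_point (M n) x))" for n
    proof -
      have "(LINT t|L n. character k (torus_curve t)) = (LINT x|P n. character k (torus_curve (\<tau> n x)))"
        unfolding L_def
        by (rule integral_distr[OF m]) (intro borel_measurable_continuous_onI continuous_at_imp_continuous_on
            ballI isCont_character_torus_curve)
      also have "\<dots> = (\<Sum>x\<in>?G n. w n x *\<^sub>R character k (torus_curve (\<tau> n x)))"
        unfolding P_def by (rule lebesgue_integral_point_measure_finite) (simp_all add: w)
      also have "\<dots> = (\<Sum>x\<in>?G n. of_real (w n x) * character k (grid_point (M n) x))"
        using \<tau> by (intro sum.cong) (auto simp: scaleR_conv_of_real)
      finally show ?thesis .
    qed
    have "(\<lambda>n. LINT t|(L \<circ> id \<circ> r) n. character k (torus_curve t)) \<longlonglongrightarrow> (LINT t|L0. character k (torus_curve t))"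
    proof (rule weak_conv_imp_integral_bdd_continuous_conv[OF _ L0 conv])
      show "real_distribution ((L \<circ> id \<circ> r) n)" for n by (simp add: Ld)
      show "norm (character k (torus_curve t)) \<le> 1" for t
        by (simp add: cmod_character torus_curve_in_torus)
    qed (rule isCont_character_torus_curve)
    then show "(\<lambda>n. LINT t|L (r n). character k (torus_curve t)) \<longlonglongrightarrow> (LINT t|L0. character k (torus_curve t))"
      by simp
    show "(\<lambda>n. LINT t|L (r n). character k (torus_curve t)) \<longlonglongrightarrow> s k"
      using LIMSEQ_subseq_LIMSEQ[OF lim[of k] r] by (simp add: LG o_def)
  qed
  then show ?thesis
    using L0 by (intro exI[of _ L0]) (auto simp: real_distribution_def real_distribution_axioms_def)
qed

text \<open>The Fejer weights have a common total mass, the value of the sequence at 0.  If it is positive,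
  normalize and pass to the limit; if it is 0, all weights and hence the whole sequence vanish.\<close>

theorem Herglotz_torus:
  fixes s :: "int \<times> int \<Rightarrow> complex"
  assumes pd: "\<And>I \<alpha>. finite I \<Longrightarrow> (\<Sum>p\<in>I. \<Sum>q\<in>I. \<alpha> p * cnj (\<alpha> q) * s (p - q)) \<in> \<real>\<^sub>\<ge>\<^sub>0"
  shows "\<exists>\<rho>. finite_measure \<rho> \<and> sets \<rho> = sets (restrict_space borel torus) \<and>
    (\<forall>k. (LINT z|\<rho>. character k z) = s k)"
proof -
  let ?T = "restrict_space borel torus :: (complex \<times> complex) measure"
  define good where "good n w \<longleftrightarrow> (\<forall>x. w x \<ge> (0::real)) \<and>
    (\<forall>k. \<bar>fst k\<bar> \<le> int (Suc n) \<longrightarrow> \<bar>snd k\<bar> \<le> int (Suc n) \<longrightarrow>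
      (\<Sum>x\<in>{..<2*Suc n} \<times> {..<2*Suc n}. of_real (w x) * character k (grid_point (2*Suc n) x))
        = s k * of_real ((1 - real_of_int \<bar>fst k\<bar> / real (Suc n)) * (1 - real_of_int \<bar>snd k\<bar> / real (Suc n))))"
    for n and w :: "nat \<times> nat \<Rightarrow> real"
  have "\<exists>w. good n w" for n
    unfolding good_def by (rule fejer_weights[OF pd]) simp_all
  then obtain w where good: "\<And>n. good n (w n)" by metis
  have w: "w n x \<ge> 0" for n x using good[of n] unfolding good_def by blast
  have mom: "(\<Sum>x\<in>{..<2*Suc n} \<times> {..<2*Suc n}. of_real (w n x) * character k (grid_point (2*Suc n) x))
        = s k * of_real ((1 - real_of_int \<bar>fst k\<bar> / real (Suc n)) * (1 - real_of_int \<bar>snd k\<bar> / real (Suc n)))"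
    if "\<bar>fst k\<bar> \<le> int (Suc n)" "\<bar>snd k\<bar> \<le> int (Suc n)" for n k
    using good[of n] that unfolding good_def by blast
  have "s 0 \<in> \<real>\<^sub>\<ge>\<^sub>0" using pd[of "{0}" "\<lambda>_. 1"] by simp
  then obtain m where m: "s 0 = of_real m" "m \<ge> 0" by (auto simp: nonneg_Reals_def)
  have mass: "(\<Sum>x\<in>{..<2*Suc n} \<times> {..<2*Suc n}. w n x) = m" for n
  proof -
    have "complex_of_real (\<Sum>x\<in>{..<2*Suc n} \<times> {..<2*Suc n}. w n x) = of_real m"
      using mom[of 0 n] by (simp add: m character_def)
    then show ?thesis using of_real_eq_iff by blast
  qed
  have lim: "(\<lambda>n. \<Sum>x\<in>{..<2*Suc n} \<times> {..<2*Suc n}. of_real (w n x) * character k (grid_point (2*Suc n) x)) \<longlonglongrightarrow> s k" for k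
  proof (rule Lim_transform_eventually)
    have "(\<lambda>n. s k * of_real ((1 - real_of_int \<bar>fst k\<bar> / real (Suc n)) * (1 - real_of_int \<bar>snd k\<bar> / real (Suc n))))
        \<longlonglongrightarrow> s k * of_real ((1 - 0) * (1 - 0))"
      by (intro tendsto_intros LIMSEQ_Suc[OF lim_const_over_n])
    then show "(\<lambda>n. s k * of_real ((1 - real_of_int \<bar>fst k\<bar> / real (Suc n)) * (1 - real_of_int \<bar>snd k\<bar> / real (Suc n)))) \<longlonglongrightarrow> s k" by simp
    show "eventually (\<lambda>n. s k * of_real ((1 - real_of_int \<bar>fst k\<bar> / real (Suc n)) * (1 - real_of_int \<bar>snd k\<bar> / real (Suc n))) =
      (\<Sum>x\<in>{..<2*Suc n} \<times> {..<2*Suc n}. of_real (w n x) * character k (grid_point (2*Suc n) x))) sequentially"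
      using eventually_ge_at_top[of "nat \<bar>fst k\<bar> + nat \<bar>snd k\<bar>"]
    proof eventually_elim
      case (elim n)
      then have "\<bar>fst k\<bar> \<le> int (Suc n)" "\<bar>snd k\<bar> \<le> int (Suc n)" by auto
      from mom[OF this] show ?case by simp
    qed
  qed
  show ?thesis
  proof (cases "m = 0")
    case True
    have "w n x = 0" if "x \<in> {..<2*Suc n} \<times> {..<2*Suc n}" for n x
      using mass[of n] w that unfolding True by (subst (asm) sum_nonneg_eq_0_iff) auto
    then have "(\<lambda>n. 0) \<longlonglongrightarrow> s k" for k using lim[of k] by simp
    then have "s k = 0" for k by (simp add: LIMSEQ_const_iff)
    then show ?thesis
      by (intro exI[of _ "null_measure ?T"]) (auto intro!: finite_measureI)
  next
    case False
    with m have m0: "m > 0" by simp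
    have "\<exists>L :: real measure. prob_space L \<and> sets L = sets borel \<and> (\<forall>k. (LINT t|L. character k (torus_curve t)) = s k / of_real m)"
    proof (rule torus_prob_limit[where w = "\<lambda>n x. w n x / m" and M = "\<lambda>n. 2 * Suc n"])
      show "w n x / m \<ge> 0" for n x using w m0 by simp
      show "(\<Sum>x\<in>{..<2*Suc n} \<times> {..<2*Suc n}. w n x / m) = 1" for n
        using mass[of n] m0 by (simp only: sum_divide_distrib[symmetric]) simp
      show "(\<lambda>n. \<Sum>x\<in>{..<2*Suc n} \<times> {..<2*Suc n}. of_real (w n x / m) * character k (grid_point (2*Suc n) x)) \<longlonglongrightarrow> s k / of_real m" for k
        using tendsto_divide[OF lim[of k] tendsto_const[of "of_real m"]] m0
        by (simp add: sum_divide_distrib del: mult_Suc_right)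
    qed
    then obtain L :: "real measure" where L: "prob_space L" "sets L = sets borel"
      and Lk: "\<And>k. (LINT t|L. character k (torus_curve t)) = s k / of_real m" by auto
    interpret L: prob_space L by fact
    have mc: "torus_curve \<in> measurable L ?T"
      using continuous_torus_curve torus_curve_in_torus
      by (intro measurable_restrict_space2) (auto simp: measurable_cong_sets[OF L(2) refl] intro: borel_measurable_continuous_onI)
    have mk: "character k \<in> borel_measurable ?T" for k
      by (rule borel_measurable_continuous_on_restrict[OF continuous_character])
    define \<rho> where "\<rho> = density (distr L ?T torus_curve) (\<lambda>_. ennreal m)"
    have "finite_measure \<rho>"
      by (rule finite_measureI)
         (use L.finite_measure_distr[OF mc] in \<open>simp add: \<rho>_def emeasure_density nn_integral_cmult finite_measure.emeasure_eq_measure ennreal_mult_eq_top_iff\<close>)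
    moreover have "sets \<rho> = sets ?T" by (simp add: \<rho>_def)
    moreover have "(LINT z|\<rho>. character k z) = s k" for k
    proof -
      have "(LINT z|\<rho>. character k z) = (LINT z|distr L ?T torus_curve. m *\<^sub>R character k z)"
        unfolding \<rho>_def by (rule integral_density) (use m mk in auto)
      also have "\<dots> = (LINT t|L. m *\<^sub>R character k (torus_curve t))"
        by (rule integral_distr[OF mc]) (use mk in simp)
      also have "\<dots> = s k" using m0 by (simp add: Lk scaleR_conv_of_real)
      finally show ?thesis .
    qed
    ultimately show ?thesis by blast
  qed
qed

section \<open>The moment functions\<close>

definition moment_fun :: "idx \<Rightarrow> real \<times> real \<Rightarrow> complex"
  where "moment_fun = (\<lambda>(m, k, l, n, r, t) (x1, x2).
    of_real x1 ^ m * (of_real x1 + \<i>) powi k * (of_real x1 - \<i>) powi l *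
    of_real x2 ^ n * (of_real x2 + \<i>) powi r * (of_real x2 - \<i>) powi t)"

text \<open>The index of the product of the first moment function with the conjugate of the second:
  conjugation exchanges the powers of \<open>x + i\<close> and \<open>x - i\<close>, so these exponents are added crosswise.\<close>

definition gram_index :: "idx \<Rightarrow> idx \<Rightarrow> idx"
  where "gram_index = (\<lambda>(m, k, l, n, r, t) (m', k', l', n', r', t').
    (m + m', k + l', l + k', n + n', r + t', t + r'))"

lemma of_real_plus_i_nonzero [simp]: "complex_of_real x + \<i> \<noteq> 0" "complex_of_real x - \<i> \<noteq> 0" "complex_of_real x \<noteq> \<i>"
  by (simp_all add: complex_eq_iff)

lemma i_plus_of_real_nonzero [simp]: "\<i> + complex_of_real x \<noteq> 0"
  by (simp add: complex_eq_iff)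

lemma solves_moment_problem_iff:
  "solves_moment_problem u \<mu> \<longleftrightarrow> sets \<mu> = sets borel \<and> (\<forall>i. has_bochner_integral \<mu> (moment_fun i) (u i))"
  unfolding solves_moment_problem_def moment_fun_def by (auto simp: split_paired_all)

lemma continuous_moment_fun: "continuous_on UNIV (moment_fun i)"
  unfolding moment_fun_def by (cases i) (auto simp: case_prod_unfold intro!: continuous_intros)

lemma borel_measurable_moment_fun [measurable]: "moment_fun i \<in> borel_measurable borel"
  by (rule borel_measurable_continuous_onI[OF continuous_moment_fun])

lemma moment_fun_gram: "moment_fun (gram_index i j) x = moment_fun i x * cnj (moment_fun j x)"
  by (cases i; cases j; cases x)
     (simp add: moment_fun_def gram_index_def power_add power_int_add mult_ac)

lemma positivity_condition_gram:
  "positivity_condition u \<longleftrightarrow> (\<forall>\<alpha>. finite {i. \<alpha> i \<noteq> 0} \<longrightarrow>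
    (\<Sum>i\<in>{i. \<alpha> i \<noteq> 0}. \<Sum>j\<in>{i. \<alpha> i \<noteq> 0}. \<alpha> i * cnj (\<alpha> j) * u (gram_index i j)) \<in> \<real>\<^sub>\<ge>\<^sub>0)"
  by (simp add: positivity_condition_def gram_index_def case_prod_unfold)

text \<open>Coefficients may vanish on the index set: terms with zero coefficients do not contribute.\<close>

lemma positivity_conditionD:
  assumes u: "positivity_condition u" and I: "finite I"
  shows "(\<Sum>i\<in>I. \<Sum>j\<in>I. \<alpha> i * cnj (\<alpha> j) * u (gram_index i j)) \<in> \<real>\<^sub>\<ge>\<^sub>0"
proof -
  define \<beta> where "\<beta> i = (if i \<in> I then \<alpha> i else 0)" for i
  have sub: "{i. \<beta> i \<noteq> 0} \<subseteq> I" by (auto simp: \<beta>_def)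
  then have fin: "finite {i. \<beta> i \<noteq> 0}" using I finite_subset by blast
  have "(\<Sum>i\<in>I. \<Sum>j\<in>I. \<alpha> i * cnj (\<alpha> j) * u (gram_index i j)) =
      (\<Sum>i\<in>I. \<Sum>j\<in>I. \<beta> i * cnj (\<beta> j) * u (gram_index i j))"
    by (simp add: \<beta>_def)
  also have "\<dots> = (\<Sum>i\<in>I. \<Sum>j\<in>{i. \<beta> i \<noteq> 0}. \<beta> i * cnj (\<beta> j) * u (gram_index i j))"
    by (intro sum.cong refl sum.mono_neutral_right I sub) auto
  also have "\<dots> = (\<Sum>i\<in>{i. \<beta> i \<noteq> 0}. \<Sum>j\<in>{i. \<beta> i \<noteq> 0}. \<beta> i * cnj (\<beta> j) * u (gram_index i j))"
    by (intro sum.mono_neutral_right I sub) auto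
  finally have eq: "(\<Sum>i\<in>I. \<Sum>j\<in>I. \<alpha> i * cnj (\<alpha> j) * u (gram_index i j)) =
      (\<Sum>i\<in>{i. \<beta> i \<noteq> 0}. \<Sum>j\<in>{i. \<beta> i \<noteq> 0}. \<beta> i * cnj (\<beta> j) * u (gram_index i j))" .
  show ?thesis unfolding eq by (rule u[unfolded positivity_condition_gram, rule_format, OF fin])
qed

text \<open>The shifts by the second index are absorbed in the first one.\<close>

lemma consistency_condition_iff:
  "consistency_condition u \<longleftrightarrow> (\<forall>m k l n r t.
      u (m + 1, k, l, n, r, t) + \<i> * u (m, k, l, n, r, t) = u (m, k + 1, l, n, r, t) \<and>
      u (m + 1, k, l, n, r, t) - \<i> * u (m, k, l, n, r, t) = u (m, k, l + 1, n, r, t) \<and>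
      u (m, k, l, n + 1, r, t) + \<i> * u (m, k, l, n, r, t) = u (m, k, l, n, r + 1, t) \<and>
      u (m, k, l, n + 1, r, t) - \<i> * u (m, k, l, n, r, t) = u (m, k, l, n, r, t + 1))" (is "?L \<longleftrightarrow> ?R")
proof
  assume L: ?L
  show ?R
    using L[unfolded consistency_condition_def, rule_format, where a = 0 and b = 0 and c = 0 and d = 0 and e = 0 and f = 0]
    by simp
next
  assume R: ?R
  show ?L
    unfolding consistency_condition_def
  proof (intro allI)
    fix m a n d :: nat and k l r t b c e f :: int
    show "u (m + 1 + a, k + c, l + b, n + d, r + f, t + e) + \<i> * u (m + a, k + c, l + b, n + d, r + f, t + e)
        = u (m + a, k + 1 + c, l + b, n + d, r + f, t + e) \<and>
      u (m + 1 + a, k + c, l + b, n + d, r + f, t + e) - \<i> * u (m + a, k + c, l + b, n + d, r + f, t + e)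
        = u (m + a, k + c, l + 1 + b, n + d, r + f, t + e) \<and>
      u (m + a, k + c, l + b, n + 1 + d, r + f, t + e) + \<i> * u (m + a, k + c, l + b, n + d, r + f, t + e)
        = u (m + a, k + c, l + b, n + d, r + 1 + f, t + e) \<and>
      u (m + a, k + c, l + b, n + 1 + d, r + f, t + e) - \<i> * u (m + a, k + c, l + b, n + d, r + f, t + e)
        = u (m + a, k + c, l + b, n + d, r + f, t + 1 + e)"
    proof -
      have e: "m + 1 + a = m + a + 1" "k + 1 + c = k + c + 1" "l + 1 + b = l + b + 1"
        "n + 1 + d = n + d + 1" "r + 1 + f = r + f + 1" "t + 1 + e = t + e + 1" by simp_all
      show ?thesis unfolding e using R by blast
    qed
  qed
qed

lemma moment_fun_steps:
  "moment_fun (m + 1, k, l, n, r, t) x = of_real (fst x) * moment_fun (m, k, l, n, r, t) x"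
  "moment_fun (m, k + 1, l, n, r, t) x = (of_real (fst x) + \<i>) * moment_fun (m, k, l, n, r, t) x"
  "moment_fun (m, k, l + 1, n, r, t) x = (of_real (fst x) - \<i>) * moment_fun (m, k, l, n, r, t) x"
  "moment_fun (m, k, l, n + 1, r, t) x = of_real (snd x) * moment_fun (m, k, l, n, r, t) x"
  "moment_fun (m, k, l, n, r + 1, t) x = (of_real (snd x) + \<i>) * moment_fun (m, k, l, n, r, t) x"
  "moment_fun (m, k, l, n, r, t + 1) x = (of_real (snd x) - \<i>) * moment_fun (m, k, l, n, r, t) x"
  by (cases x, simp add: moment_fun_def power_int_add_1 mult_ac)+

lemma moment_relation:
  assumes "\<And>i. has_bochner_integral \<mu> (moment_fun i) (u i)"
    and "\<And>x. moment_fun i x + c * moment_fun j x = moment_fun k x"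
  shows "u i + c * u j = u k"
proof -
  have "has_bochner_integral \<mu> (\<lambda>x. moment_fun i x + c * moment_fun j x) (u i + c * u j)"
    by (intro has_bochner_integral_add has_bochner_integral_mult_right assms(1))
  moreover have "(\<lambda>x. moment_fun i x + c * moment_fun j x) = moment_fun k"
    by (intro ext assms(2))
  ultimately show ?thesis using has_bochner_integral_eq[OF _ assms(1)[of k]] by simp
qed

lemma solution_consistent:
  assumes "\<And>i. has_bochner_integral \<mu> (moment_fun i) (u i)"
  shows "consistency_condition u"
  unfolding consistency_condition_iff
proof (intro allI conjI)
  fix m n :: nat and k l r t :: int
  let ?i = "(m, k, l, n, r, t)"
  note rel = moment_relation[where u = u, OF assms]
  show "u (m + 1, k, l, n, r, t) + \<i> * u ?i = u (m, k + 1, l, n, r, t)"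
    by (rule rel) (simp only: moment_fun_steps distrib_right)
  show "u (m, k, l, n + 1, r, t) + \<i> * u ?i = u (m, k, l, n, r + 1, t)"
    by (rule rel) (simp only: moment_fun_steps distrib_right)
  have "u (m + 1, k, l, n, r, t) + (- \<i>) * u ?i = u (m, k, l + 1, n, r, t)"
    by (rule rel) (simp only: moment_fun_steps left_diff_distrib mult_minus_left add_uminus_conv_diff)
  then show "u (m + 1, k, l, n, r, t) - \<i> * u ?i = u (m, k, l + 1, n, r, t)" by simp
  have "u (m, k, l, n + 1, r, t) + (- \<i>) * u ?i = u (m, k, l, n, r, t + 1)"
    by (rule rel) (simp only: moment_fun_steps left_diff_distrib mult_minus_left add_uminus_conv_diff)
  then show "u (m, k, l, n + 1, r, t) - \<i> * u ?i = u (m, k, l, n, r, t + 1)" by simp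
qed

lemma solution_square_integrable:
  assumes "sets \<mu> = sets borel" and mom: "\<And>i. has_bochner_integral \<mu> (moment_fun i) (u i)"
  shows "square_integrable \<mu> (moment_fun i)"
proof -
  have "integrable \<mu> (\<lambda>x. cmod (moment_fun (gram_index i i) x))"
    using mom[of "gram_index i i"] by (intro integrable_norm) (simp add: has_bochner_integral_iff)
  then show ?thesis
    by (simp add: square_integrable_def measurable_cong_sets[OF assms(1) refl] moment_fun_gram norm_mult power2_eq_square)
qed

lemma solution_inner:
  assumes "\<And>i. has_bochner_integral \<mu> (moment_fun i) (u i)"
  shows "l2_inner \<mu> (moment_fun i) (moment_fun j) = u (gram_index i j)"
  using assms[of "gram_index i j"] by (simp add: l2_inner_def moment_fun_gram[symmetric] has_bochner_integral_iff)

text \<open>The quadratic form is the mean square of a combination of moment functions.\<close>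

lemma solution_positive:
  assumes "sets \<mu> = sets borel" and mom: "\<And>i. has_bochner_integral \<mu> (moment_fun i) (u i)"
  shows "positivity_condition u"
  unfolding positivity_condition_gram
proof (intro allI impI)
  fix \<alpha> :: "idx \<Rightarrow> complex"
  let ?I = "{i. \<alpha> i \<noteq> 0}"
  let ?f = "\<lambda>x. \<Sum>i\<in>?I. \<alpha> i * moment_fun i x"
  note sq = square_integrable_cmult[OF solution_square_integrable[OF assms]]
  have "l2_inner \<mu> ?f ?f = (\<Sum>i\<in>?I. l2_inner \<mu> (\<lambda>x. \<alpha> i * moment_fun i x) ?f)"
    by (intro l2_inner_sum_left square_integrable_sum sq)
  also have "\<dots> = (\<Sum>i\<in>?I. \<Sum>j\<in>?I. l2_inner \<mu> (\<lambda>x. \<alpha> i * moment_fun i x) (\<lambda>x. \<alpha> j * moment_fun j x))"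
    by (intro sum.cong refl l2_inner_sum_right sq)
  also have "\<dots> = (\<Sum>i\<in>?I. \<Sum>j\<in>?I. \<alpha> i * cnj (\<alpha> j) * u (gram_index i j))"
    by (simp only: l2_inner_cmult_left l2_inner_cmult_right solution_inner[OF mom] mult.assoc)
  finally have "(\<Sum>i\<in>?I. \<Sum>j\<in>?I. \<alpha> i * cnj (\<alpha> j) * u (gram_index i j)) = of_real (l2_sqnorm \<mu> ?f)"
    by (simp only: l2_inner_self)
  then show "(\<Sum>i\<in>?I. \<Sum>j\<in>?I. \<alpha> i * cnj (\<alpha> j) * u (gram_index i j)) \<in> \<real>\<^sub>\<ge>\<^sub>0"
    by (simp only: nonneg_Reals_of_real_iff l2_sqnorm_nonneg)
qed

section \<open>Existence of a solution\<close>

text \<open>The Cayley transform of both coordinates.  Its image is the part of the torus on which both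
  coordinates differ from 1, and there \<open>torus_to_plane\<close> inverts it.\<close>

definition plane_to_torus :: "real \<times> real \<Rightarrow> complex \<times> complex"
  where "plane_to_torus x = ((of_real (fst x) - \<i>) / (of_real (fst x) + \<i>),
                             (of_real (snd x) - \<i>) / (of_real (snd x) + \<i>))"

definition torus_to_plane :: "complex \<times> complex \<Rightarrow> real \<times> real"
  where "torus_to_plane z = (Re (\<i> * (1 + fst z) / (1 - fst z)), Re (\<i> * (1 + snd z) / (1 - snd z)))"

lemma cmod_cayley: "cmod ((of_real x - \<i>) / (of_real x + \<i>)) = 1"
proof -
  have "cmod (of_real x - \<i>) = cmod (of_real x + \<i>)" by (simp add: cmod_def)
  then show ?thesis by (simp add: norm_divide)
qed

lemma plane_to_torus_in_torus: "plane_to_torus x \<in> torus"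
  by (simp add: plane_to_torus_def torus_def cmod_cayley del: norm_divide)

lemma borel_measurable_plane_to_torus [measurable]: "plane_to_torus \<in> borel_measurable borel"
  unfolding plane_to_torus_def
  by (intro borel_measurable_continuous_onI continuous_intros) auto

lemma borel_measurable_torus_to_plane [measurable]: "torus_to_plane \<in> borel_measurable borel"
proof -
  have "(\<lambda>z. Re (\<i> * (1 + f z) / (1 - f z))) \<in> borel_measurable borel"
    if [measurable]: "f \<in> borel_measurable borel" for f :: "complex \<times> complex \<Rightarrow> complex"
    by measurable
  note this[of fst] this[of snd]
  moreover have "fst \<in> borel_measurable (borel :: (complex \<times> complex) measure)"
    "snd \<in> borel_measurable (borel :: (complex \<times> complex) measure)"
    by (auto intro!: borel_measurable_continuous_onI continuous_intros)
  ultimately show ?thesis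
    unfolding torus_to_plane_def by (intro borel_measurable_Pair)
qed

lemma cayley_inverse:
  assumes "cmod w = 1" "w \<noteq> 1"
  shows "(of_real (Re (\<i> * (1 + w) / (1 - w))) - \<i>) / (of_real (Re (\<i> * (1 + w) / (1 - w))) + \<i>) = w"
proof -
  have w: "w * cnj w = 1" using assms by (simp add: complex_norm_square[symmetric])
  have ne: "1 - w \<noteq> 0" "1 - cnj w \<noteq> 0" using assms(2) by (auto simp: complex_eq_iff)
  have "cnj (\<i> * (1 + w) / (1 - w)) = \<i> * (1 + w) / (1 - w)"
    using ne w by (simp add: frac_eq_eq algebra_simps)
  then have "of_real (Re (\<i> * (1 + w) / (1 - w))) = \<i> * (1 + w) / (1 - w)"
    by (metis Reals_cnj_iff of_real_Re)
  moreover have "\<i> * (1 + w) / (1 - w) - \<i> = 2 * \<i> * w / (1 - w)" "\<i> * (1 + w) / (1 - w) + \<i> = 2 * \<i> / (1 - w)"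
    using ne by (simp_all add: field_simps)
  ultimately show ?thesis using ne by simp
qed

lemma plane_to_torus_inverse:
  "z \<in> torus \<Longrightarrow> fst z \<noteq> 1 \<Longrightarrow> snd z \<noteq> 1 \<Longrightarrow> plane_to_torus (torus_to_plane z) = z"
  by (cases z) (simp add: plane_to_torus_def torus_to_plane_def torus_def cayley_inverse)

lemma torus_to_plane_inverse: "torus_to_plane (plane_to_torus x) = x"
proof -
  have "\<i> * (1 + (of_real y - \<i>) / (of_real y + \<i>)) / (1 - (of_real y - \<i>) / (of_real y + \<i>)) = of_real y" for y
  proof -
    have "1 + (of_real y - \<i>) / (of_real y + \<i>) = 2 * of_real y / (of_real y + \<i>)"
      "1 - (of_real y - \<i>) / (of_real y + \<i>) = 2 * \<i> / (of_real y + \<i>)"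
      by (simp_all add: field_simps)
    then show ?thesis by simp
  qed
  then show ?thesis by (simp add: plane_to_torus_def torus_to_plane_def)
qed

lemma torus_map_plane:
  assumes "finite_measure M" "sets M = sets borel"
  shows "torus_map M plane_to_torus"
proof (intro torus_map.intro assms(1) torus_map_axioms.intro)
  show "plane_to_torus \<in> borel_measurable M" by (simp add: measurable_cong_sets[OF assms(2) refl])
  show "plane_to_torus x \<in> torus" for x by (rule plane_to_torus_in_torus)
  fix A assume "A \<in> sets M"
  then have "torus_to_plane -` A \<inter> space borel \<in> sets borel"
    by (intro measurable_sets[OF borel_measurable_torus_to_plane]) (simp add: assms(2))
  moreover have "A = plane_to_torus -` (torus_to_plane -` A \<inter> space borel) \<inter> space M"
    using sets_eq_imp_space_eq[OF assms(2)] by (simp add: vimage_def torus_to_plane_inverse)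
  ultimately show "\<exists>B\<in>sets borel. A = plane_to_torus -` B \<inter> space M" by blast
qed

lemma torus_map_id:
  assumes "finite_measure M" "sets M = sets (restrict_space borel torus)"
  shows "torus_map M (\<lambda>z. z)"
proof (intro torus_map.intro assms(1) torus_map_axioms.intro)
  have space: "space M = torus" using sets_eq_imp_space_eq[OF assms(2)] by (simp add: space_restrict_space)
  show "(\<lambda>z. z) \<in> borel_measurable M"
    by (simp add: measurable_cong_sets[OF assms(2) refl] measurable_restrict_space1)
  show "z \<in> torus" if "z \<in> space M" for z using that space by simp
  fix A assume "A \<in> sets M"
  then show "\<exists>B\<in>sets borel. A = (\<lambda>z. z) -` B \<inter> space M"
    by (auto simp: assms(2) sets_restrict_space space)
qed

text \<open>In the coordinates of the plane this is the reciprocal of \<open>\<bar>x1 + i\<bar>\<^sup>2 \<bar>x2 + i\<bar>\<^sup>2\<close>; on the torus it is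
  a trigonometric polynomial that vanishes exactly on the circles outside the image of the plane.\<close>

definition weight :: "complex \<times> complex \<Rightarrow> real"
  where "weight z = (cmod (1 - fst z))\<^sup>2 * (cmod (1 - snd z))\<^sup>2 / 16"

lemma weight_nonneg: "0 \<le> weight z" by (simp add: weight_def)

lemma borel_measurable_weight [measurable]: "weight \<in> borel_measurable borel"
  unfolding weight_def by (intro borel_measurable_continuous_onI continuous_intros) auto

lemma weight_plane: "weight (plane_to_torus x) * ((cmod (of_real (fst x) + \<i>))\<^sup>2 * (cmod (of_real (snd x) + \<i>))\<^sup>2) = 1"
proof -
  have "1 - (of_real y - \<i>) / (of_real y + \<i>) = 2 * \<i> / (of_real y + \<i>)" for y
    by (simp add: field_simps)
  then have "cmod (1 - (of_real y - \<i>) / (of_real y + \<i>)) = 2 / cmod (of_real y + \<i>)" for y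
    by (simp add: norm_divide norm_mult)
  then show ?thesis by (simp add: weight_def plane_to_torus_def power_divide)
qed

text \<open>On the torus \<open>\<bar>1 - a\<bar>\<^sup>2 = 2 - a - cnj a\<close>, so the weight is a product of two second differences.\<close>

lemma weight_character:
  assumes z: "z \<in> torus"
  shows "of_real (16 * weight z) * character p z =
    4 * character p z - 2 * character (p + (1, 0)) z - 2 * character (p - (1, 0)) z
    - 2 * character (p + (0, 1)) z - 2 * character (p - (0, 1)) z
    + character (p + (1, 1)) z + character (p + (1, -1)) z + character (p - (1, -1)) z + character (p - (1, 1)) z"
proof -
  define a b where "a = fst z" and "b = snd z"
  have ab: "a * cnj a = 1" "b * cnj b = 1"
    using z by (auto simp: a_def b_def torus_def complex_norm_square[symmetric])
  have "of_real (16 * weight z) = ((1 - a) * cnj (1 - a)) * ((1 - b) * cnj (1 - b))"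
    unfolding complex_norm_square[symmetric] by (simp add: weight_def a_def b_def)
  also have "\<dots> = (2 - a - cnj a) * (2 - b - cnj b)"
    using ab by (simp add: algebra_simps)
  finally have W: "of_real (16 * weight z) = (2 - a - cnj a) * (2 - b - cnj b)" .
  have inv: "inverse a = cnj a" "inverse b = cnj b" using ab by (simp_all add: inverse_unique)
  have ch: "character (1, 0) z = a" "character (0, 1) z = b" "character (-1, 0) z = cnj a" "character (0, -1) z = cnj b"
    "character (1, 1) z = a * b" "character (1, -1) z = a * cnj b" "character (-1, 1) z = cnj a * b"
    "character (-1, -1) z = cnj a * cnj b"
    by (simp_all add: character_def a_def[symmetric] b_def[symmetric] power_int_minus inv)
  have add: "character (p + q) z = character p z * character q z" for q using character_add[OF z] .
  have sub: "character (p - q) z = character p z * character (- q) z" for q using add[of "- q"] by simp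
  show ?thesis unfolding W add sub by (simp add: ch) (simp add: algebra_simps)
qed

text \<open>The index whose moment function is the character \<open>p\<close> of the Cayley transform multiplied \<open>K\<close> times by
  \<open>\<bar>x1 + i\<bar>\<^sup>2 \<bar>x2 + i\<bar>\<^sup>2\<close>.\<close>

definition balanced_index :: "nat \<Rightarrow> int \<times> int \<Rightarrow> idx"
  where "balanced_index K p = (0, int K - fst p, int K + fst p, 0, int K - snd p, int K + snd p)"

lemma moment_fun_balanced:
  "moment_fun (balanced_index K p) x * of_real (weight (plane_to_torus x) ^ K) = character p (plane_to_torus x)"
proof -
  have split: "(of_real y + \<i>) powi (int K - j) * (of_real y - \<i>) powi (int K + j) =
      of_real (((cmod (of_real y + \<i>))\<^sup>2) ^ K) * ((of_real y - \<i>) / (of_real y + \<i>)) powi j" for y j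
  proof -
    have "of_real ((cmod (of_real y + \<i>))\<^sup>2) = (of_real y + \<i>) * (of_real y - \<i>)"
      unfolding complex_norm_square by simp
    then show ?thesis
      by (simp add: power_int_diff power_int_add power_int_divide_distrib power_mult_distrib)
  qed
  define W where "W = ((cmod (of_real (fst x) + \<i>))\<^sup>2 * (cmod (of_real (snd x) + \<i>))\<^sup>2) ^ K"
  have "moment_fun (balanced_index K p) x =
      ((of_real (fst x) + \<i>) powi (int K - fst p) * (of_real (fst x) - \<i>) powi (int K + fst p)) *
      ((of_real (snd x) + \<i>) powi (int K - snd p) * (of_real (snd x) - \<i>) powi (int K + snd p))"
    by (cases x) (simp add: moment_fun_def balanced_index_def)
  also have "\<dots> = of_real W * character p (plane_to_torus x)"
    unfolding split by (simp add: W_def character_def plane_to_torus_def power_mult_distrib)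
  finally have "moment_fun (balanced_index K p) x * of_real (weight (plane_to_torus x) ^ K) =
      of_real (weight (plane_to_torus x) ^ K * W) * character p (plane_to_torus x)" by simp
  also have "weight (plane_to_torus x) ^ K * W = 1"
    using arg_cong[OF weight_plane[of x], of "\<lambda>w. w ^ K"] by (simp add: W_def power_mult_distrib)
  finally show ?thesis by simp
qed

text \<open>So the sequence with balanced indices of order \<open>K\<close> is positive definite: the entries of its kernel
  are entries of the Gram kernel.\<close>

lemma gram_balanced: "gram_index (0, int K - fst p, fst p, 0, int K - snd p, snd p) (0, int K - fst q, fst q, 0, int K - snd q, snd q)
    = balanced_index K (p - q)"
  by (simp add: gram_index_def balanced_index_def)

lemma consistency_difference:
  assumes "consistency_condition u"
  shows "u (m, k + 1, l, n, r, t) - u (m, k, l + 1, n, r, t) = 2 * \<i> * u (m, k, l, n, r, t)"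
    "u (m, k, l, n, r + 1, t) - u (m, k, l, n, r, t + 1) = 2 * \<i> * u (m, k, l, n, r, t)"
proof -
  note c = assms[unfolded consistency_condition_iff, rule_format, of m k l n r t]
  have two: "(z + \<i> * w) - (z - \<i> * w) = 2 * \<i> * w" for z w by simp
  show "u (m, k + 1, l, n, r, t) - u (m, k, l + 1, n, r, t) = 2 * \<i> * u (m, k, l, n, r, t)"
    using c two[of "u (m + 1, k, l, n, r, t)" "u (m, k, l, n, r, t)"] by simp
  show "u (m, k, l, n, r + 1, t) - u (m, k, l, n, r, t + 1) = 2 * \<i> * u (m, k, l, n, r, t)"
    using c two[of "u (m, k, l, n + 1, r, t)" "u (m, k, l, n, r, t)"] by simp
qed

text \<open>The identity \<open>(x + i) - (x - i) = 2 i\<close>, applied twice.\<close>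

lemma consistency_second_difference:
  assumes u: "consistency_condition u"
  shows "2 * u (m, k + 1, l + 1, n, r, t) - u (m, k, l + 2, n, r, t) - u (m, k + 2, l, n, r, t) = 4 * u (m, k, l, n, r, t)"
    "2 * u (m, k, l, n, r + 1, t + 1) - u (m, k, l, n, r, t + 2) - u (m, k, l, n, r + 2, t) = 4 * u (m, k, l, n, r, t)"
proof -
  have ii: "2 * \<i> * (2 * \<i> * z) = - 4 * z" for z by simp
  have "u (m, k + 2, l, n, r, t) - u (m, k + 1, l + 1, n, r, t) = 2 * \<i> * u (m, k + 1, l, n, r, t)"
    "u (m, k + 1, l + 1, n, r, t) - u (m, k, l + 2, n, r, t) = 2 * \<i> * u (m, k, l + 1, n, r, t)"
    using consistency_difference(1)[OF u, of m "k + 1" l n r t] consistency_difference(1)[OF u, of m k "l + 1" n r t]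
    by (simp_all add: add.assoc)
  then have "(u (m, k + 2, l, n, r, t) - u (m, k + 1, l + 1, n, r, t)) - (u (m, k + 1, l + 1, n, r, t) - u (m, k, l + 2, n, r, t))
      = 2 * \<i> * (u (m, k + 1, l, n, r, t) - u (m, k, l + 1, n, r, t))"
    by (simp only: right_diff_distrib)
  then show "2 * u (m, k + 1, l + 1, n, r, t) - u (m, k, l + 2, n, r, t) - u (m, k + 2, l, n, r, t) = 4 * u (m, k, l, n, r, t)"
    unfolding consistency_difference(1)[OF u] ii by (simp add: algebra_simps)
  have "u (m, k, l, n, r + 2, t) - u (m, k, l, n, r + 1, t + 1) = 2 * \<i> * u (m, k, l, n, r + 1, t)"
    "u (m, k, l, n, r + 1, t + 1) - u (m, k, l, n, r, t + 2) = 2 * \<i> * u (m, k, l, n, r, t + 1)"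
    using consistency_difference(2)[OF u, of m k l n "r + 1" t] consistency_difference(2)[OF u, of m k l n r "t + 1"]
    by (simp_all add: add.assoc)
  then have "(u (m, k, l, n, r + 2, t) - u (m, k, l, n, r + 1, t + 1)) - (u (m, k, l, n, r + 1, t + 1) - u (m, k, l, n, r, t + 2))
      = 2 * \<i> * (u (m, k, l, n, r + 1, t) - u (m, k, l, n, r, t + 1))"
    by (simp only: right_diff_distrib)
  then show "2 * u (m, k, l, n, r + 1, t + 1) - u (m, k, l, n, r, t + 2) - u (m, k, l, n, r + 2, t) = 4 * u (m, k, l, n, r, t)"
    unfolding consistency_difference(2)[OF u] ii by (simp add: algebra_simps)
qed

text \<open>Multiplying by the weight lowers the order: the second differences of \<open>weight_character\<close> match
  those of the consistent sequence.\<close>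

lemma balanced_recursion:
  fixes K :: nat
  assumes u: "consistency_condition u"
  defines "s \<equiv> \<lambda>p. u (balanced_index (Suc K) p)"
  shows "4 * s p - 2 * s (p + (1, 0)) - 2 * s (p - (1, 0)) - 2 * s (p + (0, 1)) - 2 * s (p - (0, 1))
    + s (p + (1, 1)) + s (p + (1, -1)) + s (p - (1, -1)) + s (p - (1, 1)) = 16 * u (balanced_index K p)"
proof -
  obtain a b where p: "p = (a, b)" by (cases p)
  define k l r t where "k = int K - a" and "l = int K + a" and "r = int K - b" and "t = int K + b"
  have e: "s p = u (0, k + 1, l + 1, 0, r + 1, t + 1)"
    "s (p + (1, 0)) = u (0, k, l + 2, 0, r + 1, t + 1)" "s (p - (1, 0)) = u (0, k + 2, l, 0, r + 1, t + 1)"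
    "s (p + (0, 1)) = u (0, k + 1, l + 1, 0, r, t + 2)" "s (p - (0, 1)) = u (0, k + 1, l + 1, 0, r + 2, t)"
    "s (p + (1, 1)) = u (0, k, l + 2, 0, r, t + 2)" "s (p + (1, -1)) = u (0, k, l + 2, 0, r + 2, t)"
    "s (p - (1, -1)) = u (0, k + 2, l, 0, r, t + 2)" "s (p - (1, 1)) = u (0, k + 2, l, 0, r + 2, t)"
    "u (balanced_index K p) = u (0, k, l, 0, r, t)"
    by (simp_all add: s_def balanced_index_def p k_def l_def r_def t_def algebra_simps)
  note d1 = consistency_second_difference(1)[OF u, of 0 k l 0]
  note d2 = consistency_second_difference(2)[OF u, of 0 k l 0 r t]
  have "16 * u (0, k, l, 0, r, t) = 4 * (2 * u (0, k, l, 0, r + 1, t + 1) - u (0, k, l, 0, r, t + 2) - u (0, k, l, 0, r + 2, t))"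
    using d2 by simp
  also have "\<dots> = 2 * (4 * u (0, k, l, 0, r + 1, t + 1)) - 4 * u (0, k, l, 0, r, t + 2) - 4 * u (0, k, l, 0, r + 2, t)"
    by simp
  finally show ?thesis unfolding e d1[symmetric] by (simp add: algebra_simps)
qed

text \<open>From the balanced indices all others are reached by linear relations valid both for the moment
  functions and for the sequence: \<open>2 i = (x + i) - (x - i)\<close> lowers the total degree of the powers of
  \<open>x + i\<close> and \<open>x - i\<close> in one variable, and \<open>x = (x + i) - i\<close> raises the power of \<open>x\<close>.\<close>

lemma moments_extend_from_balanced:
  assumes u: "consistency_condition u"
    and bal: "\<And>K p. has_bochner_integral \<mu> (moment_fun (balanced_index K p)) (u (balanced_index K p))"
  shows "has_bochner_integral \<mu> (moment_fun i) (u i)"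
proof -
  let ?H = "\<lambda>i. has_bochner_integral \<mu> (moment_fun i) (u i)"
  have lin: "?H k" if "?H i" "?H j" "u k = a * u i + b * u j"
    "\<And>x. moment_fun k x = a * moment_fun i x + b * moment_fun j x" for i j k a b
  proof -
    have "has_bochner_integral \<mu> (\<lambda>x. a * moment_fun i x + b * moment_fun j x) (a * u i + b * u j)"
      by (intro has_bochner_integral_add has_bochner_integral_mult_right that)
    then show ?thesis by (simp only: that(3) that(4)[symmetric])
  qed
  have half: "z = 1 / (2 * \<i>) * ((w + \<i>) * z) + (- 1 / (2 * \<i>)) * ((w - \<i>) * z)" for z w
    by (simp add: field_simps)
  have 1: "?H (m, k, l, n, r, t)" if "?H (m, k + 1, l, n, r, t)" "?H (m, k, l + 1, n, r, t)" for m k l n r t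
    by (rule lin[OF that, of _ "1 / (2 * \<i>)" "- 1 / (2 * \<i>)"], unfold moment_fun_steps)
       (use consistency_difference(1)[OF u, of m k l n r t] half in \<open>auto simp: field_simps\<close>)
  have 2: "?H (m, k, l, n, r, t)" if "?H (m, k, l, n, r + 1, t)" "?H (m, k, l, n, r, t + 1)" for m k l n r t
    by (rule lin[OF that, of _ "1 / (2 * \<i>)" "- 1 / (2 * \<i>)"], unfold moment_fun_steps)
       (use consistency_difference(2)[OF u, of m k l n r t] half in \<open>auto simp: field_simps\<close>)
  note c = u[unfolded consistency_condition_iff, rule_format]
  have 3: "?H (m + 1, k, l, n, r, t)" if "?H (m, k + 1, l, n, r, t)" "?H (m, k, l, n, r, t)" for m k l n r t
    by (rule lin[OF that, of _ 1 "- \<i>"], unfold moment_fun_steps)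
       (use c[of m k l n r t] in \<open>auto simp: algebra_simps\<close>)
  have 4: "?H (m, k, l, n + 1, r, t)" if "?H (m, k, l, n, r + 1, t)" "?H (m, k, l, n, r, t)" for m k l n r t
    by (rule lin[OF that, of _ 1 "- \<i>"], unfold moment_fun_steps)
       (use c[of m k l n r t] in \<open>auto simp: algebra_simps\<close>)
  have A: "?H (0, k, l, 0, r, t)" if "k + l = 2 * int K - int d" "r + t = 2 * int K" for k l r t K d
    using that
  proof (induction d arbitrary: k l)
    case 0
    then have "(0, k, l, 0, r, t) = balanced_index K (int K - k, int K - r)"
      by (simp add: balanced_index_def)
    then show ?case using bal by metis
  next
    case (Suc d)
    show ?case by (rule 1; rule Suc.IH) (use Suc.prems in auto)
  qed
  have B: "?H (0, k, l, 0, r, t)" if "k + l = 2 * int K - int d" "r + t = 2 * int K - int e" for k l r t K d e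
    using that
  proof (induction e arbitrary: r t)
    case 0
    then show ?case using A by simp
  next
    case (Suc e)
    show ?case by (rule 2; rule Suc.IH) (use Suc.prems in auto)
  qed
  have C: "?H (0, k, l, 0, r, t)" for k l r t
  proof -
    define K where "K = nat (\<bar>k + l\<bar> + \<bar>r + t\<bar>)"
    show ?thesis
      by (rule B[of k l K "nat (2 * int K - (k + l))" r t "nat (2 * int K - (r + t))"]) (auto simp: K_def, arith+)
  qed
  have D: "?H (m, k, l, 0, r, t)" for m k l r t
  proof (induction m arbitrary: k l)
    case (Suc m)
    show ?case using 3[OF Suc.IH Suc.IH] by simp
  qed (rule C)
  have E: "?H (m, k, l, n, r, t)" for m k l n r t
  proof (induction n arbitrary: r t)
    case (Suc n)
    show ?case using 4[OF Suc.IH Suc.IH] by simp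
  qed (rule D)
  show ?thesis by (cases i) (auto intro: E)
qed

lemma measurable_torus_restrict [measurable]:
  "f \<in> borel_measurable borel \<Longrightarrow> f \<in> borel_measurable (restrict_space borel torus)"
  by (rule measurable_restrict_space1)

lemma weight_le_1: "z \<in> torus \<Longrightarrow> weight z \<le> 1"
proof -
  assume "z \<in> torus"
  then have "cmod (1 - fst z) \<le> 2" "cmod (1 - snd z) \<le> 2"
    using norm_triangle_ineq4[of 1 "fst z"] norm_triangle_ineq4[of 1 "snd z"] by (auto simp: torus_def)
  then have "(cmod (1 - fst z))\<^sup>2 \<le> 2\<^sup>2" "(cmod (1 - snd z))\<^sup>2 \<le> 2\<^sup>2" by (intro power_mono; simp)+
  then have "(cmod (1 - fst z))\<^sup>2 * (cmod (1 - snd z))\<^sup>2 \<le> 2\<^sup>2 * 2\<^sup>2" by (intro mult_mono) auto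
  then show ?thesis by (simp add: weight_def)
qed

lemma borel_measurable_character: "character p \<in> borel_measurable (restrict_space borel torus)"
  by (rule borel_measurable_continuous_on_restrict[OF continuous_character])

text \<open>Measures with the weighted moments exist by Herglotz's theorem.  By uniqueness each of them is
  the next one multiplied by the vanishing weight; so none charges the circles removed by the Cayley
  transform, and the powers of \<open>x1 + i\<close> and \<open>x2 + i\<close> are integrable.\<close>

theorem moment_solution_exists:
  assumes pos: "positivity_condition u" and con: "consistency_condition u"
  shows "\<exists>\<mu>. solves_moment_problem u \<mu>"
proof -
  let ?T = "restrict_space borel torus :: (complex \<times> complex) measure"
  have spT: "space ?T = torus" by (simp add: space_restrict_space)
  have "\<exists>\<rho>. finite_measure \<rho> \<and> sets \<rho> = sets ?T \<and> (\<forall>p. (LINT z|\<rho>. character p z) = u (balanced_index K p))" for K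
  proof (rule Herglotz_torus)
    fix I :: "(int \<times> int) set" and \<alpha> assume I: "finite I"
    \<comment> \<open>The moment functions of these indices have the prescribed Gram matrix.\<close>
    define h :: "int \<times> int \<Rightarrow> idx" where "h p = (0, int K - fst p, fst p, 0, int K - snd p, snd p)" for p
    have inj: "inj_on h I" by (auto simp: inj_on_def h_def prod_eq_iff)
    have "(\<Sum>i\<in>h ` I. \<Sum>j\<in>h ` I. \<alpha> (inv_into I h i) * cnj (\<alpha> (inv_into I h j)) * u (gram_index i j)) \<in> \<real>\<^sub>\<ge>\<^sub>0"
      using I by (intro positivity_conditionD[OF pos]) simp
    then show "(\<Sum>p\<in>I. \<Sum>q\<in>I. \<alpha> p * cnj (\<alpha> q) * u (balanced_index K (p - q))) \<in> \<real>\<^sub>\<ge>\<^sub>0"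
      using gram_balanced[of K] by (simp add: sum.reindex[OF inj] inv_into_f_f[OF inj] h_def[symmetric] cong: sum.cong)
  qed
  then obtain \<rho> where fin: "\<And>K. finite_measure (\<rho> K)" and sets: "\<And>K. sets (\<rho> K) = sets ?T"
    and mom: "\<And>K p. (LINT z|\<rho> K. character p z) = u (balanced_index K p)"
    by metis
  have space: "space (\<rho> K) = torus" for K using sets_eq_imp_space_eq[OF sets] spT by simp
  note meas = measurable_cong_sets[OF sets refl]
  have tm: "torus_map (\<rho> K) (\<lambda>z. z)" for K by (rule torus_map_id[OF fin sets])
  have ch: "has_bochner_integral (\<rho> K) (character p) (u (balanced_index K p))" for K p
    using square_integrable_integrable[OF fin torus_map.square_integrable_character[OF tm]] mom
    by (simp add: has_bochner_integral_iff)
  have step: "\<rho> K = density (\<rho> (Suc K)) (\<lambda>z. ennreal (weight z))" for K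
  proof -
    let ?D = "density (\<rho> (Suc K)) (\<lambda>z. ennreal (weight z))"
    interpret R: finite_measure "\<rho> (Suc K)" by (rule fin)
    have finD: "finite_measure ?D"
    proof (rule finite_measureI)
      have "space (\<rho> (Suc K)) \<in> sets (\<rho> (Suc K))" by (rule sets.top)
      then have "emeasure ?D (space ?D) = (\<integral>\<^sup>+z. ennreal (weight z) * indicator (space (\<rho> (Suc K))) z \<partial>\<rho> (Suc K))"
        by (subst emeasure_density) (simp_all add: meas)
      also have "\<dots> \<le> (\<integral>\<^sup>+z. 1 \<partial>\<rho> (Suc K))"
        by (intro nn_integral_mono) (auto simp: space weight_le_1 indicator_def)
      also have "\<dots> < \<infinity>" by (simp add: R.emeasure_eq_measure)
      finally show "emeasure ?D (space ?D) \<noteq> \<infinity>" by simp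
    qed
    show ?thesis
    proof (rule torus_measure_eqI[OF tm torus_map_id[OF finD]])
      show "sets ?D = sets ?T" by (simp add: sets)
      show "sets ?D = sets (\<rho> K)" by (simp add: sets)
      fix p
      let ?f = "\<lambda>z. 4 * character p z - 2 * character (p + (1, 0)) z - 2 * character (p - (1, 0)) z
        - 2 * character (p + (0, 1)) z - 2 * character (p - (0, 1)) z
        + character (p + (1, 1)) z + character (p + (1, -1)) z + character (p - (1, -1)) z + character (p - (1, 1)) z"
      have "has_bochner_integral (\<rho> (Suc K)) (\<lambda>z. 1 / 16 * ?f z) (1 / 16 * (16 * u (balanced_index K p)))"
        unfolding balanced_recursion[OF con, of K p, symmetric]
        by (intro has_bochner_integral_mult_right has_bochner_integral_add has_bochner_integral_diff ch)
      moreover have "1 / 16 * ?f z = weight z *\<^sub>R character p z" if "z \<in> space (\<rho> (Suc K))" for z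
        unfolding weight_character[OF that[unfolded space], symmetric] by (simp add: scaleR_conv_of_real)
      ultimately have "has_bochner_integral (\<rho> (Suc K)) (\<lambda>z. weight z *\<^sub>R character p z) (u (balanced_index K p))"
        by (subst (asm) has_bochner_integral_cong[OF refl _ refl]) auto
      then have "has_bochner_integral ?D (character p) (u (balanced_index K p))"
        by (intro has_bochner_integral_density) (auto simp: meas borel_measurable_character weight_nonneg)
      then show "(LINT z|\<rho> K. character p z) = (LINT z|?D. character p z)"
        using mom by (simp add: has_bochner_integral_iff)
    qed
  qed
  \<comment> \<open>The powers of the weight compensate the growth of the balanced moment functions.\<close>
  have power: "\<rho> 0 = density (\<rho> K) (\<lambda>z. ennreal (weight z ^ K))" for K
  proof (induction K)
    case 0
    then show ?case by (simp add: density_1)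
  next
    case (Suc K)
    have "\<rho> 0 = density (density (\<rho> (Suc K)) (\<lambda>z. ennreal (weight z))) (\<lambda>z. ennreal (weight z ^ K))"
      using Suc step[of K] by simp
    also have "\<dots> = density (\<rho> (Suc K)) (\<lambda>z. ennreal (weight z ^ Suc K))"
      by (subst density_density_eq) (auto simp: meas ennreal_mult weight_nonneg)
    finally show ?case .
  qed
  have AE: "AE z in \<rho> K. fst z \<noteq> 1 \<and> snd z \<noteq> 1" for K
  proof -
    have m: "(\<lambda>z. ennreal (weight z)) \<in> borel_measurable (\<rho> (Suc K))" by (simp add: meas)
    have "AE z in density (\<rho> (Suc K)) (\<lambda>z. ennreal (weight z)). fst z \<noteq> 1 \<and> snd z \<noteq> 1"
      unfolding AE_density[OF m] by (rule AE_I2) (auto simp: weight_def)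
    then show ?thesis unfolding step[of K, symmetric] .
  qed
  have tp: "torus_to_plane \<in> measurable (\<rho> K) borel" for K by (simp add: meas)
  define \<mu> where "\<mu> = distr (\<rho> 0) borel torus_to_plane"
  have bal: "has_bochner_integral \<mu> (moment_fun (balanced_index K p)) (u (balanced_index K p))" for K p
    unfolding \<mu>_def
  proof (rule has_bochner_integral_distr[OF borel_measurable_moment_fun tp])
    have m: "(\<lambda>z. moment_fun (balanced_index K p) (torus_to_plane z)) \<in> borel_measurable (\<rho> K)"
      by (rule measurable_compose[OF tp borel_measurable_moment_fun])
    have wm: "(\<lambda>z. weight z ^ K) \<in> borel_measurable (\<rho> K)" by (simp add: meas)
    show "has_bochner_integral (\<rho> 0) (\<lambda>z. moment_fun (balanced_index K p) (torus_to_plane z)) (u (balanced_index K p))"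
      unfolding power[of K]
    proof (rule has_bochner_integral_density[OF m wm])
      show "has_bochner_integral (\<rho> K) (\<lambda>z. weight z ^ K *\<^sub>R moment_fun (balanced_index K p) (torus_to_plane z)) (u (balanced_index K p))"
      proof (rule has_bochner_integralI_AE[OF ch])
        show "(\<lambda>z. weight z ^ K *\<^sub>R moment_fun (balanced_index K p) (torus_to_plane z)) \<in> borel_measurable (\<rho> K)"
          using m wm by measurable
        show "AE z in \<rho> K. character p z = weight z ^ K *\<^sub>R moment_fun (balanced_index K p) (torus_to_plane z)"
          using AE[of K] AE_space
        proof eventually_elim
          case (elim z)
          then show ?case
            using moment_fun_balanced[of K p "torus_to_plane z"]
            by (simp add: space plane_to_torus_inverse scaleR_conv_of_real mult.commute)
        qed
      qed
    qed (simp add: weight_nonneg)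
  qed
  have "solves_moment_problem u \<mu>"
    unfolding solves_moment_problem_iff using moments_extend_from_balanced[OF con bal] by (simp add: \<mu>_def)
  then show ?thesis ..
qed

lemma solution_finite_measure:
  assumes "solves_moment_problem u \<mu>"
  shows "finite_measure \<mu>"
proof -
  have "has_bochner_integral \<mu> (moment_fun (0, 0, 0, 0, 0, 0)) (u (0, 0, 0, 0, 0, 0))"
    using assms by (simp add: solves_moment_problem_iff)
  moreover have "moment_fun (0, 0, 0, 0, 0, 0) = (\<lambda>_. 1)" by (auto simp: moment_fun_def)
  ultimately have "integrable \<mu> (\<lambda>_. 1 :: complex)" by (simp add: has_bochner_integral_iff)
  then show ?thesis by (intro finite_measureI) (simp add: integrable_iff_bounded less_top)
qed

lemma character_plane_to_torus:
  "character p (plane_to_torus x) = moment_fun (0, - fst p, fst p, 0, - snd p, snd p) x"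
  by (cases x) (simp add: moment_fun_def character_def plane_to_torus_def power_int_divide_distrib power_int_minus field_simps)

theorem moment_solution_unique:
  assumes "solves_moment_problem u \<mu>" "solves_moment_problem u \<nu>"
  shows "\<mu> = \<nu>"
proof (rule torus_measure_eqI)
  show "torus_map \<mu> plane_to_torus" "torus_map \<nu> plane_to_torus"
    using assms by (auto intro!: torus_map_plane solution_finite_measure simp: solves_moment_problem_iff)
  show "sets \<nu> = sets \<mu>" using assms by (simp add: solves_moment_problem_iff)
  show "(LINT x|\<mu>. character p (plane_to_torus x)) = (LINT x|\<nu>. character p (plane_to_torus x))" for p
    unfolding character_plane_to_torus using assms
    by (simp add: solves_moment_problem_iff has_bochner_integral_iff)
qed

section \<open>Inner product spaces\<close>

context complex_ip_space
begin

lemma points_simps [simp]: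
  "0 \<in> points H"
  "x \<in> points H \<Longrightarrow> y \<in> points H \<Longrightarrow> x + y \<in> points H"
  "x \<in> points H \<Longrightarrow> y \<in> points H \<Longrightarrow> x - y \<in> points H"
  "x \<in> points H \<Longrightarrow> smult H c x \<in> points H"
  "x \<in> points H \<Longrightarrow> - x \<in> points H"
  using subspace_0[OF subspace_points] subspace_add[OF subspace_points] subspace_diff[OF subspace_points]
    subspace_scale[OF subspace_points] subspace_neg[OF subspace_points] by auto

lemma points_sum [simp]: "(\<And>i. i \<in> I \<Longrightarrow> f i \<in> points H) \<Longrightarrow> (\<Sum>i\<in>I. f i) \<in> points H"
  by (rule subspace_sum[OF subspace_points])

lemma cip_diff_left:
  assumes "x \<in> points H" "y \<in> points H" "z \<in> points H"
  shows "cip H (x - y) z = cip H x z - cip H y z"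
  using cip_add_left[of "x - y" y z] assms by simp

lemma cip_diff_right:
  assumes "x \<in> points H" "y \<in> points H" "z \<in> points H"
  shows "cip H z (x - y) = cip H z x - cip H z y"
  using cip_add_right[of "x - y" y z] assms by simp

lemma cip_zero_left [simp]: "x \<in> points H \<Longrightarrow> cip H 0 x = 0"
  using cip_diff_left[of x x x] by simp

lemma cip_zero_right [simp]: "x \<in> points H \<Longrightarrow> cip H x 0 = 0"
  using cip_diff_right[of x x x] by simp

lemma cip_sum_left:
  assumes "\<And>i. i \<in> I \<Longrightarrow> f i \<in> points H" "y \<in> points H"
  shows "cip H (\<Sum>i\<in>I. f i) y = (\<Sum>i\<in>I. cip H (f i) y)"
  using assms by (induction I rule: infinite_finite_induct) (auto simp: cip_add_left)

lemma cip_sum_right: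
  assumes "\<And>i. i \<in> I \<Longrightarrow> f i \<in> points H" "y \<in> points H"
  shows "cip H y (\<Sum>i\<in>I. f i) = (\<Sum>i\<in>I. cip H y (f i))"
  using assms by (induction I rule: infinite_finite_induct) (auto simp: cip_add_right)

lemma cip_self: "x \<in> points H \<Longrightarrow> cip H x x = of_real ((nrm H x)\<^sup>2)"
  using cip_commute[of x x] cip_nonneg[of x] by (simp add: nrm_def complex_eq_iff)

lemma cmod_cip_le:
  assumes "x \<in> points H" "y \<in> points H"
  shows "cmod (cip H x y) \<le> nrm H x * nrm H y"
proof (cases "cip H x y = 0")
  case True
  then show ?thesis using nrm_nonneg assms by simp
next
  case False
  \<comment> \<open>Rotate the first vector so that the inner product becomes real.\<close>
  define w where "w = cnj (sgn (cip H x y))"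
  have w: "cmod w = 1" using False by (simp add: w_def norm_sgn)
  have "cip H (smult H w x) y = of_real (cmod (cip H x y))"
    using assms False by (simp add: cip_smult_left w_def sgn_eq complex_norm_square[symmetric] mult.commute
        power2_eq_square)
  moreover have "nrm H (smult H w x) = nrm H x"
  proof -
    have "cip H (smult H w x) (smult H w x) = (w * cnj w) * cip H x x"
      using assms by (simp add: cip_smult_left cip_smult_right)
    also have "w * cnj w = 1" using w by (simp add: complex_norm_square[symmetric])
    finally show ?thesis by (simp add: nrm_def)
  qed
  ultimately show ?thesis using Re_cip_le_nrm[of "smult H w x" y] assms by simp
qed

lemma limitin_iff_nrm:
  assumes "\<And>n. f n \<in> points H" "l \<in> points H"
  shows "limitin (htop H) f l sequentially \<longleftrightarrow> (\<lambda>n. nrm H (f n - l)) \<longlonglongrightarrow> 0"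
proof -
  have "nrm H (f n - l) = \<bar>nrm H (f n - l)\<bar>" for n using nrm_nonneg assms by simp
  then show ?thesis
    using assms by (auto simp: limitin_metric tendsto_iff hdist_def)
qed

lemma limitin_points: "limitin (htop H) f l sequentially \<Longrightarrow> l \<in> points H"
  by (simp add: limitin_metric)

lemma cip_tendsto:
  assumes f: "\<And>n. f n \<in> points H" "limitin (htop H) f x sequentially"
    and g: "\<And>n. g n \<in> points H" "limitin (htop H) g y sequentially"
  shows "(\<lambda>n. cip H (f n) (g n)) \<longlonglongrightarrow> cip H x y"
proof -
  have x: "x \<in> points H" and y: "y \<in> points H" using f g by (auto dest: limitin_points)
  have fx: "(\<lambda>n. nrm H (f n - x)) \<longlonglongrightarrow> 0" and gy: "(\<lambda>n. nrm H (g n - y)) \<longlonglongrightarrow> 0"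
    using f g x y by (simp_all add: limitin_iff_nrm)
  have "(\<lambda>n. cip H (f n) (g n) - cip H x y) \<longlonglongrightarrow> 0"
  proof (rule Lim_null_comparison[OF always_eventually])
    show "\<forall>n. norm (cip H (f n) (g n) - cip H x y) \<le>
        nrm H (f n - x) * nrm H (g n - y) + nrm H (f n - x) * nrm H y + nrm H x * nrm H (g n - y)"
    proof
      fix n
      have "cip H (f n) (g n) - cip H x y = cip H (f n - x) (g n - y) + cip H (f n - x) y + cip H x (g n - y)"
        using f(1)[of n] g(1)[of n] x y by (simp add: cip_diff_left cip_diff_right)
      then show "norm (cip H (f n) (g n) - cip H x y) \<le>
        nrm H (f n - x) * nrm H (g n - y) + nrm H (f n - x) * nrm H y + nrm H x * nrm H (g n - y)"
        using cmod_cip_le[of "f n - x" "g n - y"] cmod_cip_le[of "f n - x" y] cmod_cip_le[of x "g n - y"]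
          f(1)[of n] g(1)[of n] x y norm_triangle_ineq[of "cip H (f n - x) (g n - y) + cip H (f n - x) y" "cip H x (g n - y)"]
          norm_triangle_ineq[of "cip H (f n - x) (g n - y)" "cip H (f n - x) y"]
        by simp
    qed
    have "(\<lambda>n. nrm H (f n - x) * nrm H (g n - y) + nrm H (f n - x) * nrm H y + nrm H x * nrm H (g n - y))
        \<longlonglongrightarrow> 0 * 0 + 0 * nrm H y + nrm H x * 0"
      by (intro tendsto_intros fx gy)
    then show "(\<lambda>n. nrm H (f n - x) * nrm H (g n - y) + nrm H (f n - x) * nrm H y + nrm H x * nrm H (g n - y)) \<longlonglongrightarrow> 0"
      by simp
  qed
  then show ?thesis by (simp add: LIM_zero_iff)
qed

lemma in_closure_of_iff_nrm:
  assumes "S \<subseteq> points H"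
  shows "h \<in> htop H closure_of S \<longleftrightarrow> h \<in> points H \<and> (\<forall>e>0. \<exists>s\<in>S. nrm H (h - s) < e)"
  using assms unfolding metric_closure_of by (auto simp: in_mball hdist_def) (metis subsetD)+

lemma in_closure_of_seq:
  assumes "S \<subseteq> points H" "h \<in> htop H closure_of S"
  shows "\<exists>s. (\<forall>n. s n \<in> S) \<and> limitin (htop H) s h sequentially"
proof -
  have h: "h \<in> points H" and e: "\<And>e. e > 0 \<Longrightarrow> \<exists>s\<in>S. nrm H (h - s) < e"
    using assms by (auto simp: in_closure_of_iff_nrm)
  have "\<exists>s. s \<in> S \<and> nrm H (h - s) < inverse (real (Suc n))" for n
    using e[of "inverse (real (Suc n))"] by auto
  then obtain s where s: "\<And>n. s n \<in> S" "\<And>n. nrm H (h - s n) < inverse (real (Suc n))" by metis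
  have sp: "s n \<in> points H" for n using s(1) assms(1) by blast
  have "(\<lambda>n. nrm H (s n - h)) \<longlonglongrightarrow> 0"
  proof (rule Lim_null_comparison[OF always_eventually LIMSEQ_inverse_real_of_nat], intro allI)
    fix n
    have "nrm H (s n - h) = nrm H (h - s n)" using nrm_minus[of "h - s n"] sp h by simp
    then show "norm (nrm H (s n - h)) \<le> inverse (real (Suc n))"
      using s(2)[of n] nrm_nonneg[of "h - s n"] sp h by simp
  qed
  then have "limitin (htop H) s h sequentially" using limitin_iff_nrm[of s h, OF sp h] by blast
  then show ?thesis using s(1) by blast
qed

end

section \<open>Isometric images of square integrable functions\<close>

locale l2_isometry = complex_ip_space H for H :: "'h::ab_group_add ip_space" +
  fixes M :: "'a measure" and W :: "('a \<Rightarrow> complex) \<Rightarrow> 'h"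
  assumes finite_M: "finite_measure M"
    and W_points [simp]: "square_integrable M f \<Longrightarrow> W f \<in> points H"
    and W_inner: "square_integrable M f \<Longrightarrow> square_integrable M g \<Longrightarrow> cip H (W f) (W g) = l2_inner M f g"
begin

text \<open>A map preserving inner products is linear, since the norm of every linearity defect expands
  into inner products.\<close>

lemma W_add:
  assumes f: "square_integrable M f" and g: "square_integrable M g"
  shows "W (\<lambda>x. f x + g x) = W f + W g"
proof -
  note fg = square_integrable_add[OF f g]
  let ?d = "W (\<lambda>x. f x + g x) - (W f + W g)"
  have 0: "cip H ?d (W h) = 0" if "square_integrable M h" for h
    using that f g fg by (simp add: cip_diff_left cip_add_left W_inner l2_inner_add_left)
  have "cip H ?d ?d = cip H ?d (W (\<lambda>x. f x + g x)) - (cip H ?d (W f) + cip H ?d (W g))"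
    using f g fg by (subst cip_diff_right) (simp_all add: cip_add_right)
  then have "cip H ?d ?d = 0" using 0 f g fg by simp
  then have "?d = 0" using f g fg by (intro cip_eq_0) simp_all
  then show ?thesis by simp
qed

lemma W_smult:
  assumes f: "square_integrable M f"
  shows "W (\<lambda>x. c * f x) = smult H c (W f)"
proof -
  note cf = square_integrable_cmult[OF f, of c]
  let ?d = "W (\<lambda>x. c * f x) - smult H c (W f)"
  have 0: "cip H ?d (W h) = 0" if "square_integrable M h" for h
    using that f cf by (simp add: cip_diff_left cip_smult_left W_inner l2_inner_cmult_left)
  have "cip H ?d ?d = cip H ?d (W (\<lambda>x. c * f x)) - cnj c * cip H ?d (W f)"
    using f cf by (subst cip_diff_right) (simp_all add: cip_smult_right)
  then have "cip H ?d ?d = 0" using 0 f cf by simp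
  then have "?d = 0" using f cf by (intro cip_eq_0) simp_all
  then show ?thesis by simp
qed

lemma W_diff:
  assumes f: "square_integrable M f" and g: "square_integrable M g"
  shows "W (\<lambda>x. f x - g x) = W f - W g"
  using W_add[OF f square_integrable_cmult[OF g], of "-1"] W_smult[OF g, of "-1"] by simp

lemma W_zero: "W (\<lambda>_. 0) = 0"
  using W_diff[of "\<lambda>_. 0" "\<lambda>_. 0"] by simp

lemma W_sum:
  assumes "\<And>i. i \<in> I \<Longrightarrow> square_integrable M (f i)"
  shows "W (\<lambda>x. \<Sum>i\<in>I. f i x) = (\<Sum>i\<in>I. W (f i))"
  using assms
  by (induction I rule: infinite_finite_induct) (simp_all add: W_zero W_add square_integrable_sum)

lemma nrm_W: "square_integrable M f \<Longrightarrow> nrm H (W f) = sqrt (l2_sqnorm M f)"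
  by (simp add: nrm_def W_inner l2_inner_self)

lemma W_eq_iff:
  assumes f: "square_integrable M f" and g: "square_integrable M g"
  shows "W f = W g \<longleftrightarrow> (AE x in M. f x = g x)"
proof -
  have "W f = W g \<longleftrightarrow> nrm H (W (\<lambda>x. f x - g x)) = 0"
    using f g by (simp add: W_diff nrm_eq_0_iff)
  also have "\<dots> \<longleftrightarrow> (AE x in M. f x - g x = 0)"
    using square_integrable_diff[OF f g] by (simp add: nrm_W l2_sqnorm_eq_0_iff)
  finally show ?thesis by simp
qed

lemma W_tendsto:
  assumes "l2_tendsto M F f"
  shows "limitin (htop H) (\<lambda>n. W (F n)) (W f) sequentially"
proof -
  note F = l2_tendstoD[OF assms]
  have "nrm H (W (F n) - W f) = sqrt (l2_sqnorm M (\<lambda>x. F n x - f x))" for n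
    using F by (simp add: W_diff[symmetric] nrm_W square_integrable_diff)
  then show ?thesis
    using F tendsto_real_sqrt[OF F(3)] by (simp add: limitin_iff_nrm)
qed

end

text \<open>The isometry need not be onto, and \<open>E\<close> is arbitrary off its image; so this also covers the cyclic
  subspace of a vector under any spectral measure.\<close>

locale l2_spectral = l2_isometry H M W
  for H :: "'h::ab_group_add ip_space" and M :: "(real \<times> real) measure" and W +
  fixes E :: "(real \<times> real) set \<Rightarrow> 'h \<Rightarrow> 'h"
  assumes sets_M: "sets M = sets borel"
    and E_W: "\<Delta> \<in> sets borel \<Longrightarrow> square_integrable M f \<Longrightarrow> E \<Delta> (W f) = W (\<lambda>x. indicator \<Delta> x * f x)"
begin

lemmas borel_measurable_M = measurable_cong_sets[OF sets_M refl]

lemma space_M: "space M = UNIV" using sets_eq_imp_space_eq[OF sets_M] by simp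

lemma square_integrable_indicator_M:
  "\<Delta> \<in> sets borel \<Longrightarrow> square_integrable M f \<Longrightarrow> square_integrable M (\<lambda>x. indicator \<Delta> x * f x)"
  by (rule square_integrable_indicator) (simp_all add: sets_M)

lemma scalar_measure_W:
  assumes f: "square_integrable M f"
  shows "scalar_measure H E (W f) = density M (\<lambda>x. ennreal ((cmod (f x))\<^sup>2))"
proof -
  let ?D = "density M (\<lambda>x. ennreal ((cmod (f x))\<^sup>2))"
  have m [measurable]: "f \<in> borel_measurable M" using f by (rule square_integrable_measurable)
  have "ennreal (Re (cip H (E \<Delta> (W f)) (W f))) = emeasure ?D \<Delta>" if "\<Delta> \<in> sets borel" for \<Delta>
  proof -
    have \<Delta>: "\<Delta> \<in> sets M" using that sets_M by simp
    note sq = square_integrable_indicator_M[OF that f]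
    have "cip H (E \<Delta> (W f)) (W f) = (LINT x|M. of_real (indicator \<Delta> x * (cmod (f x))\<^sup>2))"
      unfolding E_W[OF that f] W_inner[OF sq f] l2_inner_def
      by (intro Bochner_Integration.integral_cong refl)
         (simp only: of_real_mult complex_norm_square of_real_indicator mult.assoc)
    then have "Re (cip H (E \<Delta> (W f)) (W f)) = (LINT x|M. indicator \<Delta> x * (cmod (f x))\<^sup>2)"
      by (simp only: integral_complex_of_real Re_complex_of_real)
    moreover have "emeasure ?D \<Delta> = ennreal (LINT x|M. indicator \<Delta> x * (cmod (f x))\<^sup>2)"
    proof -
      have "emeasure ?D \<Delta> = (\<integral>\<^sup>+x. ennreal (indicator \<Delta> x * (cmod (f x))\<^sup>2) \<partial>M)"
        using \<Delta> by (subst emeasure_density) (auto intro!: nn_integral_cong simp: indicator_def)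
      also have "\<dots> = ennreal (LINT x|M. indicator \<Delta> x * (cmod (f x))\<^sup>2)"
        using integrable_real_mult_indicator[OF \<Delta> square_integrableD[OF f]]
        by (intro nn_integral_eq_integral) (auto simp: mult.commute)
      finally show ?thesis .
    qed
    ultimately show ?thesis by simp
  qed
  then have "scalar_measure H E (W f) = measure_of UNIV (sets borel) (emeasure ?D)"
    unfolding scalar_measure_def
    by (intro measure_of_eq) (simp_all add: sets.sigma_sets_eq[of borel, simplified])
  also have "\<dots> = ?D"
    using measure_of_of_measure[of ?D] by (simp add: space_M sets_M)
  finally show ?thesis .
qed

lemma simple_spectral_integral_W:
  assumes s: "simple_function borel s" and f: "square_integrable M f"
  shows "simple_spectral_integral H E s (W f) = W (\<lambda>x. of_real (s x) * f x)"
proof -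
  have fin: "finite (range s)" using simple_functionD(1)[OF s] by simp
  have meas: "s -` {c} \<in> sets borel" for c using simple_functionD(2)[OF s, of "{c}"] by simp
  note sq = square_integrable_indicator_M[OF meas f]
  have "simple_spectral_integral H E s (W f) = (\<Sum>c\<in>range s. W (\<lambda>x. of_real c * (indicator (s -` {c}) x * f x)))"
    unfolding simple_spectral_integral_def by (simp add: E_W[OF meas f] W_smult[OF sq])
  also have "\<dots> = W (\<lambda>x. \<Sum>c\<in>range s. of_real c * (indicator (s -` {c}) x * f x))"
    by (rule W_sum[symmetric]) (intro square_integrable_cmult sq)
  also have "(\<lambda>x. \<Sum>c\<in>range s. of_real c * (indicator (s -` {c}) x * f x)) = (\<lambda>x. of_real (s x) * f x)"
  proof
    fix x
    have "(\<Sum>c\<in>range s. of_real c * (indicator (s -` {c}) x * f x)) = (\<Sum>c\<in>range s. if c = s x then of_real c * f x else 0)"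
      by (intro sum.cong refl) (auto simp: indicator_def)
    also have "\<dots> = of_real (s x) * f x" using fin by simp
    finally show "(\<Sum>c\<in>range s. of_real c * (indicator (s -` {c}) x * f x)) = of_real (s x) * f x" .
  qed
  finally show ?thesis .
qed

text \<open>The integral of a simple function acts as multiplication, and multiplications by dominated
  approximations converge in mean square.\<close>

lemma simple_spectral_integral_tendsto:
  assumes s: "\<And>n. simple_function borel (s n)" "\<And>p. (\<lambda>n. s n p) \<longlonglongrightarrow> \<phi> p" "\<And>n p. \<bar>s n p\<bar> \<le> \<bar>\<phi> p\<bar>"
    and \<phi>: "\<phi> \<in> borel_measurable borel"
    and f: "square_integrable M f" and \<phi>f: "square_integrable M (\<lambda>x. of_real (\<phi> x) * f x)"
  shows "limitin (htop H) (\<lambda>n. simple_spectral_integral H E (s n) (W f)) (W (\<lambda>x. of_real (\<phi> x) * f x)) sequentially"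
proof -
  have [measurable]: "f \<in> borel_measurable M" using f by (rule square_integrable_measurable)
  have [measurable]: "s n \<in> borel_measurable M" for n
    using borel_measurable_simple_function[OF s(1)] by (simp add: borel_measurable_M)
  have "l2_tendsto M (\<lambda>n x. of_real (s n x) * f x) (\<lambda>x. of_real (\<phi> x) * f x)"
  proof (rule l2_tendsto_dominated[OF _ square_integrable_measurable[OF \<phi>f] \<phi>f, where C = 1])
    show "(\<lambda>x. of_real (s n x) * f x) \<in> borel_measurable M" for n by measurable
    show "cmod (of_real (s n x) * f x) \<le> 1 * cmod (of_real (\<phi> x) * f x)" for n x
      using s(3)[of n x] by (simp add: norm_mult mult_right_mono)
    show "(\<lambda>n. of_real (s n x) * f x) \<longlonglongrightarrow> of_real (\<phi> x) * f x" for x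
      by (intro tendsto_intros s(2))
  qed
  from W_tendsto[OF this] show ?thesis by (simp add: simple_spectral_integral_W[OF s(1) f])
qed

lemma integrable_scalar_measure_W_iff:
  assumes f: "square_integrable M f" and \<phi>: "\<phi> \<in> borel_measurable borel"
  shows "integrable (scalar_measure H E (W f)) (\<lambda>p. (\<phi> p)\<^sup>2) \<longleftrightarrow> square_integrable M (\<lambda>x. of_real (\<phi> x) * f x)"
proof -
  have [measurable]: "f \<in> borel_measurable M" "\<phi> \<in> borel_measurable M"
    using square_integrable_measurable[OF f] \<phi> by (simp_all add: borel_measurable_M)
  have "(\<lambda>x. of_real (\<phi> x) * f x) \<in> borel_measurable M" by measurable
  moreover have "(cmod (of_real (\<phi> x) * f x))\<^sup>2 = (cmod (f x))\<^sup>2 * (\<phi> x)\<^sup>2" for x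
    by (simp add: norm_mult power_mult_distrib mult.commute)
  ultimately show ?thesis
    unfolding scalar_measure_W[OF f] square_integrable_def
    by (subst integrable_density) (auto simp: mult.commute)
qed

lemma spectral_integral_W:
  assumes f: "square_integrable M f" and \<phi>: "\<phi> \<in> borel_measurable borel"
    and \<phi>f: "square_integrable M (\<lambda>x. of_real (\<phi> x) * f x)"
  shows "(W f, W (\<lambda>x. of_real (\<phi> x) * f x)) \<in> spectral_integral H E \<phi>"
  unfolding spectral_integral_def
  using assms simple_spectral_integral_tendsto[OF _ _ _ \<phi> f \<phi>f] integrable_scalar_measure_W_iff[OF f \<phi>] by auto

end

text \<open>Round the absolute value down to a dyadic number, cut it off, and restore the sign.  Rounding down is
  what keeps the approximations below the function in absolute value.\<close>

lemma ex_simple_functions_dominated: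
  fixes \<phi> :: "'a \<Rightarrow> real"
  assumes "\<phi> \<in> borel_measurable M"
  shows "\<exists>s. (\<forall>n. simple_function M (s n)) \<and> (\<forall>x. (\<lambda>n. s n x) \<longlonglongrightarrow> \<phi> x) \<and> (\<forall>n x. \<bar>s n x\<bar> \<le> \<bar>\<phi> x\<bar>)"
proof -
  define a :: "nat \<Rightarrow> real \<Rightarrow> real" where "a n x = of_int \<lfloor>2 ^ n * x\<rfloor> / 2 ^ n" for n x
  define b where "b n x = sgn x * min (real n) (a n \<bar>x\<bar>)" for n x
  have a: "0 \<le> a n \<bar>x\<bar>" "a n \<bar>x\<bar> \<le> \<bar>x\<bar>" "\<bar>x\<bar> - (1/2) ^ n \<le> a n \<bar>x\<bar>" for n x
  proof -
    show "0 \<le> a n \<bar>x\<bar>" by (simp add: a_def)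
    show "a n \<bar>x\<bar> \<le> \<bar>x\<bar>" using of_int_floor_le[of "2 ^ n * \<bar>x\<bar>"] by (simp add: a_def field_simps)
    have "2 ^ n * \<bar>x\<bar> - 1 \<le> of_int \<lfloor>2 ^ n * \<bar>x\<bar>\<rfloor>" by linarith
    then have "(2 ^ n * \<bar>x\<bar> - 1) / 2 ^ n \<le> a n \<bar>x\<bar>" unfolding a_def by (rule divide_right_mono) simp
    then show "\<bar>x\<bar> - (1/2) ^ n \<le> a n \<bar>x\<bar>" by (simp add: diff_divide_distrib power_divide)
  qed
  have b: "\<bar>b n x\<bar> \<le> \<bar>x\<bar>" for n x
    using a(1,2)[of n x] by (auto simp: b_def abs_mult sgn_if)
  have lim: "(\<lambda>n. b n x) \<longlonglongrightarrow> x" for x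
  proof -
    have "(\<lambda>n. a n \<bar>x\<bar>) \<longlonglongrightarrow> \<bar>x\<bar>"
    proof (rule tendsto_sandwich[OF always_eventually always_eventually])
      show "\<forall>n. \<bar>x\<bar> - (1/2) ^ n \<le> a n \<bar>x\<bar>" "\<forall>n. a n \<bar>x\<bar> \<le> \<bar>x\<bar>" using a by auto
      have "(\<lambda>n. \<bar>x\<bar> - (1/2) ^ n) \<longlonglongrightarrow> \<bar>x\<bar> - 0" by (intro tendsto_intros LIMSEQ_realpow_zero) auto
      then show "(\<lambda>n. \<bar>x\<bar> - (1/2) ^ n) \<longlonglongrightarrow> \<bar>x\<bar>" by simp
    qed simp
    moreover have "eventually (\<lambda>n. a n \<bar>x\<bar> = min (real n) (a n \<bar>x\<bar>)) sequentially"
      using eventually_ge_at_top[of "nat \<lceil>\<bar>x\<bar>\<rceil>"]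
    proof eventually_elim
      case (elim n)
      then have "\<bar>x\<bar> \<le> real n" by linarith
      then show ?case using a(2)[of n x] by simp
    qed
    ultimately have "(\<lambda>n. min (real n) (a n \<bar>x\<bar>)) \<longlonglongrightarrow> \<bar>x\<bar>" by (rule Lim_transform_eventually)
    then have "(\<lambda>n. sgn x * min (real n) (a n \<bar>x\<bar>)) \<longlonglongrightarrow> sgn x * \<bar>x\<bar>" by (intro tendsto_intros)
    then show ?thesis by (simp add: b_def sgn_mult_abs)
  qed
  have bm: "b n \<in> borel_measurable borel" for n unfolding b_def a_def by measurable
  have fin: "finite (range (b n))" for n
  proof -
    have "b n x \<in> (\<lambda>(s, k). s * min (real n) (of_int k / 2 ^ n)) ` ({-1, 0, 1} \<times> {0..2 ^ n * int n})
        \<union> {real n, - real n, 0}" for x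
    proof (cases "a n \<bar>x\<bar> \<le> real n")
      case True
      then have "real_of_int \<lfloor>2 ^ n * \<bar>x\<bar>\<rfloor> \<le> of_int (2 ^ n * int n)"
        by (simp add: a_def divide_le_eq mult.commute)
      then have "\<lfloor>2 ^ n * \<bar>x\<bar>\<rfloor> \<le> 2 ^ n * int n" by (simp only: of_int_le_iff)
      then have "(sgn x, \<lfloor>2 ^ n * \<bar>x\<bar>\<rfloor>) \<in> {-1, 0, 1} \<times> {0..2 ^ n * int n}" by (simp add: sgn_if)
      then show ?thesis by (intro UnI1 image_eqI[of _ _ "(sgn x, \<lfloor>2 ^ n * \<bar>x\<bar>\<rfloor>)"]) (simp_all add: b_def a_def)
    next
      case False
      then show ?thesis by (simp add: b_def sgn_if min_def)
    qed
    then have "range (b n) \<subseteq> (\<lambda>(s, k). s * min (real n) (of_int k / 2 ^ n)) ` ({-1, 0, 1} \<times> {0..2 ^ n * int n})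
        \<union> {real n, - real n, 0}" by blast
    then show ?thesis by (rule finite_subset) simp
  qed
  have "simple_function M (\<lambda>x. b n (\<phi> x))" for n
  proof (rule simple_function_borel_measurable)
    show "(\<lambda>x. b n (\<phi> x)) \<in> borel_measurable M" by (rule measurable_compose[OF assms bm])
    show "finite ((\<lambda>x. b n (\<phi> x)) ` space M)" by (rule finite_subset[OF _ fin]) auto
  qed
  then show ?thesis using b lim by (intro exI[of _ "\<lambda>n x. b n (\<phi> x)"]) auto
qed

context complex_ip_space
begin

lemma in_closure_ofI:
  assumes "\<And>n. s n \<in> S" "S \<subseteq> points H" "limitin (htop H) s h sequentially"
  shows "h \<in> htop H closure_of S"
  unfolding in_closure_of_iff_nrm[OF assms(2)]
proof (intro conjI allI impI)
  have sp: "s n \<in> points H" for n using assms(1,2) by blast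
  show h: "h \<in> points H" using assms(3) by (rule limitin_points)
  fix e :: real assume "e > 0"
  have "(\<lambda>n. nrm H (s n - h)) \<longlonglongrightarrow> 0" using assms(3) limitin_iff_nrm[of s h, OF sp h] by blast
  then have "eventually (\<lambda>n. nrm H (s n - h) < e) sequentially" using \<open>e > 0\<close> by (rule order_tendstoD)
  then obtain n where "nrm H (s n - h) < e" using eventually_happens'[OF sequentially_bot] by blast
  moreover have "nrm H (s n - h) = nrm H (h - s n)" using nrm_minus[of "h - s n"] sp h by simp
  ultimately show "\<exists>s\<in>S. nrm H (h - s) < e" using assms(1) by auto
qed

text \<open>The equations that define the adjoint pass to limits.\<close>

lemma adjoint_op_closed:
  assumes "T \<subseteq> points H \<times> points H" "\<And>n. s n \<in> adjoint_op H T"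
    "limitin (htop H) (\<lambda>n. fst (s n)) y sequentially" "limitin (htop H) (\<lambda>n. snd (s n)) z sequentially"
  shows "(y, z) \<in> adjoint_op H T"
proof -
  have s: "fst (s n) \<in> points H" "snd (s n) \<in> points H"
    "(h, g) \<in> T \<Longrightarrow> cip H g (fst (s n)) = cip H h (snd (s n))" for n h g
    using assms(2)[of n] by (auto simp: adjoint_op_def case_prod_beta)
  have yz: "y \<in> points H" "z \<in> points H" using assms(3,4) by (auto dest: limitin_points)
  have "cip H g y = cip H h z" if hg: "(h, g) \<in> T" for h g
  proof (rule LIMSEQ_unique)
    have pts: "h \<in> points H" "g \<in> points H" using assms(1) hg by auto
    have "limitin (htop H) (\<lambda>_. g) g sequentially" "limitin (htop H) (\<lambda>_. h) h sequentially"
      using pts by (simp_all add: limitin_const_iff)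
    then have "(\<lambda>n. cip H g (fst (s n))) \<longlonglongrightarrow> cip H g y" "(\<lambda>n. cip H h (snd (s n))) \<longlonglongrightarrow> cip H h z"
      using assms(3,4) pts s by (auto intro!: cip_tendsto)
    then show "(\<lambda>n. cip H g (fst (s n))) \<longlonglongrightarrow> cip H g y" "(\<lambda>n. cip H g (fst (s n))) \<longlonglongrightarrow> cip H h z"
      by (simp_all add: s(3)[OF hg])
  qed
  then show ?thesis using yz by (auto simp: adjoint_op_def)
qed

end

section \<open>Multiplication operators\<close>

text \<open>Isometries onto the whole space, that is, unitary equivalences.\<close>

locale l2_model = l2_isometry H M W
  for H :: "'h::ab_group_add ip_space" and M :: "(real \<times> real) measure" and W +
  assumes sets_M_borel: "sets M = sets borel"
    and W_surj: "h \<in> points H \<Longrightarrow> \<exists>f. square_integrable M f \<and> W f = h"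
begin

text \<open>The preimage is determined up to a null set, so the choice does not affect the value.\<close>

definition multE :: "(real \<times> real) set \<Rightarrow> 'h \<Rightarrow> 'h"
  where "multE \<Delta> h = W (\<lambda>x. indicator \<Delta> x * (SOME f. square_integrable M f \<and> W f = h) x)"

lemma multE_W:
  assumes \<Delta>: "\<Delta> \<in> sets borel" and f: "square_integrable M f"
  shows "multE \<Delta> (W f) = W (\<lambda>x. indicator \<Delta> x * f x)"
proof -
  define g where "g = (SOME g. square_integrable M g \<and> W g = W f)"
  have "square_integrable M g \<and> W g = W f" unfolding g_def by (rule someI[of _ f]) (simp add: f)
  then have g: "square_integrable M g" and "AE x in M. g x = f x" using W_eq_iff[of g f] f by auto
  then have "AE x in M. indicator \<Delta> x * g x = indicator \<Delta> x * f x" by auto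
  then show ?thesis
    using \<Delta> f g unfolding multE_def g_def[symmetric]
    by (subst W_eq_iff) (auto intro!: square_integrable_indicator simp: sets_M_borel)
qed

sublocale l2_spectral H M W multE
  by unfold_locales (simp_all add: sets_M_borel multE_W)

lemma square_integrable_measurable_mult:
  assumes "square_integrable M f" "\<phi> \<in> borel_measurable borel"
  shows "(\<lambda>x. of_real (\<phi> x) * f x) \<in> borel_measurable M"
proof -
  have [measurable]: "f \<in> borel_measurable M" "\<phi> \<in> borel_measurable M"
    using square_integrable_measurable[OF assms(1)] assms(2) by (simp_all add: borel_measurable_M)
  show ?thesis by measurable
qed

definition mult_op :: "(real \<times> real \<Rightarrow> real) \<Rightarrow> 'h graph"
  where "mult_op \<phi> = {(W f, W (\<lambda>x. of_real (\<phi> x) * f x)) | f.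
    square_integrable M f \<and> square_integrable M (\<lambda>x. of_real (\<phi> x) * f x)}"

lemma mult_opI:
  "square_integrable M f \<Longrightarrow> square_integrable M (\<lambda>x. of_real (\<phi> x) * f x) \<Longrightarrow>
    (W f, W (\<lambda>x. of_real (\<phi> x) * f x)) \<in> mult_op \<phi>"
  by (auto simp: mult_op_def)

lemma mult_opE:
  assumes "p \<in> mult_op \<phi>"
  obtains f where "square_integrable M f" "square_integrable M (\<lambda>x. of_real (\<phi> x) * f x)"
    "p = (W f, W (\<lambda>x. of_real (\<phi> x) * f x))"
  using assms by (auto simp: mult_op_def)

lemma mult_op_subset: "mult_op \<phi> \<subseteq> points H \<times> points H"
  by (auto simp: mult_op_def)

lemma linear_operator_mult_op:
  assumes \<phi>: "\<phi> \<in> borel_measurable borel"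
  shows "linear_operator H (mult_op \<phi>)"
  unfolding linear_operator_def
proof (intro conjI mult_op_subset)
  show "single_valued (mult_op \<phi>)"
  proof (rule single_valuedI)
    fix h g g' assume "(h, g) \<in> mult_op \<phi>" "(h, g') \<in> mult_op \<phi>"
    then obtain f f' where f: "square_integrable M f" "square_integrable M (\<lambda>x. of_real (\<phi> x) * f x)"
        "h = W f" "g = W (\<lambda>x. of_real (\<phi> x) * f x)"
      and f': "square_integrable M f'" "square_integrable M (\<lambda>x. of_real (\<phi> x) * f' x)"
        "h = W f'" "g' = W (\<lambda>x. of_real (\<phi> x) * f' x)"
      by (auto elim!: mult_opE)
    then have "AE x in M. f x = f' x" by (metis W_eq_iff)
    then show "g = g'" unfolding f(4) f'(4) using f(2) f'(2) by (subst W_eq_iff) auto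
  qed
  show "(0, 0) \<in> mult_op \<phi>"
    using mult_opI[of "\<lambda>_. 0" \<phi>] by (simp add: W_zero)
  show "\<forall>(h, g)\<in>mult_op \<phi>. \<forall>(h', g')\<in>mult_op \<phi>. (h + h', g + g') \<in> mult_op \<phi>"
  proof (safe elim!: mult_opE)
    fix f f' assume f: "square_integrable M f" "square_integrable M (\<lambda>x. of_real (\<phi> x) * f x)"
      and f': "square_integrable M f'" "square_integrable M (\<lambda>x. of_real (\<phi> x) * f' x)"
    have "(W (\<lambda>x. f x + f' x), W (\<lambda>x. of_real (\<phi> x) * (f x + f' x))) \<in> mult_op \<phi>"
      using square_integrable_add[OF f(2) f'(2)]
      by (intro mult_opI square_integrable_add f f') (simp add: distrib_left)
    then show "(W f + W f', W (\<lambda>x. of_real (\<phi> x) * f x) + W (\<lambda>x. of_real (\<phi> x) * f' x)) \<in> mult_op \<phi>"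
      using f f' by (simp add: W_add distrib_left)
  qed
  show "\<forall>c. \<forall>(h, g)\<in>mult_op \<phi>. (smult H c h, smult H c g) \<in> mult_op \<phi>"
  proof (safe elim!: mult_opE)
    fix c f assume f: "square_integrable M f" "square_integrable M (\<lambda>x. of_real (\<phi> x) * f x)"
    have "(W (\<lambda>x. c * f x), W (\<lambda>x. of_real (\<phi> x) * (c * f x))) \<in> mult_op \<phi>"
      using square_integrable_cmult[OF f(2), of c]
      by (intro mult_opI square_integrable_cmult f) (simp add: mult.left_commute)
    moreover have "(\<lambda>x. of_real (\<phi> x) * (c * f x)) = (\<lambda>x. c * (of_real (\<phi> x) * f x))" by (simp add: mult.left_commute)
    ultimately show "(smult H c (W f), smult H c (W (\<lambda>x. of_real (\<phi> x) * f x))) \<in> mult_op \<phi>"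
      using f by (simp add: W_smult)
  qed
qed

lemma measurable_truncation: "\<phi> \<in> borel_measurable borel \<Longrightarrow> {x. \<bar>\<phi> x\<bar> \<le> real n} \<in> sets borel"
  by measurable

lemma square_integrable_truncation:
  assumes \<phi>: "\<phi> \<in> borel_measurable borel" and f: "square_integrable M f"
  shows "square_integrable M (\<lambda>x. indicator {x. \<bar>\<phi> x\<bar> \<le> real n} x * f x)"
    "square_integrable M (\<lambda>x. of_real (\<phi> x) * (indicator {x. \<bar>\<phi> x\<bar> \<le> real n} x * f x))"
proof -
  show sq: "square_integrable M (\<lambda>x. indicator {x. \<bar>\<phi> x\<bar> \<le> real n} x * f x)"
    by (rule square_integrable_indicator_M[OF measurable_truncation[OF \<phi>] f])
  show "square_integrable M (\<lambda>x. of_real (\<phi> x) * (indicator {x. \<bar>\<phi> x\<bar> \<le> real n} x * f x))"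
  proof (rule square_integrable_bound[OF f, where C = "real n"])
    show "(\<lambda>x. of_real (\<phi> x) * (indicator {x. \<bar>\<phi> x\<bar> \<le> real n} x * f x)) \<in> borel_measurable M"
      by (rule square_integrable_measurable_mult[OF sq \<phi>])
    show "cmod (of_real (\<phi> x) * (indicator {x. \<bar>\<phi> x\<bar> \<le> real n} x * f x)) \<le> real n * cmod (f x)" for x
      by (auto simp: norm_mult indicator_def intro: mult_right_mono)
  qed
qed

text \<open>Truncating \<open>f\<close> to the sets where \<open>\<phi>\<close> is bounded moves it into the domain.\<close>

lemma Domain_mult_op_dense:
  assumes \<phi>: "\<phi> \<in> borel_measurable borel"
  shows "htop H closure_of (Domain (mult_op \<phi>)) = points H"
proof
  show "htop H closure_of (Domain (mult_op \<phi>)) \<subseteq> points H"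
    by (metis closure_of_subset_topspace topspace_mtopology)
  show "points H \<subseteq> htop H closure_of (Domain (mult_op \<phi>))"
  proof
    fix h assume "h \<in> points H"
    then obtain f where f: "square_integrable M f" "W f = h" using W_surj by blast
    note tr = square_integrable_truncation[OF \<phi> f(1)]
    show "h \<in> htop H closure_of (Domain (mult_op \<phi>))"
    proof (rule in_closure_ofI)
      show "W (\<lambda>x. indicator {x. \<bar>\<phi> x\<bar> \<le> real n} x * f x) \<in> Domain (mult_op \<phi>)" for n
        by (rule DomainI[OF mult_opI[OF tr]])
      show "Domain (mult_op \<phi>) \<subseteq> points H" using mult_op_subset by auto
      have "l2_tendsto M (\<lambda>n x. indicator {x. \<bar>\<phi> x\<bar> \<le> real n} x * f x) f"
      proof (rule l2_tendsto_dominated[OF square_integrable_measurable[OF tr(1)] square_integrable_measurable[OF f(1)] f(1), where C = 1])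
        show "cmod (indicator {x. \<bar>\<phi> x\<bar> \<le> real n} x * f x) \<le> 1 * cmod (f x)" for n x
          by (simp add: norm_mult indicator_def)
        show "(\<lambda>n. indicator {x. \<bar>\<phi> x\<bar> \<le> real n} x * f x) \<longlonglongrightarrow> f x" for x
        proof (rule tendsto_eventually)
          show "eventually (\<lambda>n. indicator {x. \<bar>\<phi> x\<bar> \<le> real n} x * f x = f x) sequentially"
            using eventually_ge_at_top[of "nat \<lceil>\<bar>\<phi> x\<bar>\<rceil>"]
            by eventually_elim (simp add: indicator_def nat_le_iff ceiling_le_iff)
        qed
      qed
      from W_tendsto[OF this] show "limitin (htop H) (\<lambda>n. W (\<lambda>x. indicator {x. \<bar>\<phi> x\<bar> \<le> real n} x * f x)) h sequentially"
        using f(2) by simp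
    qed
  qed
qed

text \<open>To see that the domain of the adjoint is no larger, test against the truncated defect
  \<open>\<phi> g - k\<close>, which lies in the domain.\<close>

lemma adjoint_mult_op:
  assumes \<phi>: "\<phi> \<in> borel_measurable borel"
  shows "adjoint_op H (mult_op \<phi>) = mult_op \<phi>"
proof
  show "mult_op \<phi> \<subseteq> adjoint_op H (mult_op \<phi>)"
  proof
    fix p assume "p \<in> mult_op \<phi>"
    then obtain g where g: "square_integrable M g" "square_integrable M (\<lambda>x. of_real (\<phi> x) * g x)"
      and p: "p = (W g, W (\<lambda>x. of_real (\<phi> x) * g x))" by (rule mult_opE)
    have "cip H (W (\<lambda>x. of_real (\<phi> x) * f x)) (W g) = cip H (W f) (W (\<lambda>x. of_real (\<phi> x) * g x))"
      if "square_integrable M f" "square_integrable M (\<lambda>x. of_real (\<phi> x) * f x)" for f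
      using that g by (simp add: W_inner l2_inner_def mult_ac)
    then show "p \<in> adjoint_op H (mult_op \<phi>)"
      using g by (auto simp: p adjoint_op_def elim!: mult_opE)
  qed
  show "adjoint_op H (mult_op \<phi>) \<subseteq> mult_op \<phi>"
  proof
    fix p assume p: "p \<in> adjoint_op H (mult_op \<phi>)"
    obtain g k where g: "square_integrable M g" and k: "square_integrable M k" and pgk: "p = (W g, W k)"
      using p W_surj by (auto simp: adjoint_op_def) metis
    have adj: "l2_inner M (\<lambda>x. of_real (\<phi> x) * f x) g = l2_inner M f k"
      if f: "square_integrable M f" "square_integrable M (\<lambda>x. of_real (\<phi> x) * f x)" for f
      using p mult_opI[OF f] g k f by (auto simp: pgk adjoint_op_def W_inner[symmetric])
    have "AE x in M. \<bar>\<phi> x\<bar> \<le> real n \<longrightarrow> of_real (\<phi> x) * g x = k x" for n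
    proof -
      let ?A = "{x. \<bar>\<phi> x\<bar> \<le> real n}"
      let ?f = "\<lambda>x. of_real (\<phi> x) * (indicator ?A x * g x) - indicator ?A x * k x"
      have f: "square_integrable M ?f"
        by (intro square_integrable_diff square_integrable_truncation \<phi> g k)
      have "(\<lambda>x. of_real (\<phi> x) * (indicator ?A x * ?f x)) = (\<lambda>x. of_real (\<phi> x) * ?f x)"
        by (auto simp: indicator_def)
      then have \<phi>f: "square_integrable M (\<lambda>x. of_real (\<phi> x) * ?f x)"
        using square_integrable_truncation(2)[OF \<phi> f, of n] by simp
      have "l2_inner M ?f ?f = (LINT x|M. (of_real (\<phi> x) * ?f x) * cnj (g x) - ?f x * cnj (k x))"
        unfolding l2_inner_def
        by (intro Bochner_Integration.integral_cong refl) (auto simp: indicator_def algebra_simps)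
      also have "\<dots> = l2_inner M (\<lambda>x. of_real (\<phi> x) * ?f x) g - l2_inner M ?f k"
        unfolding l2_inner_def
        by (rule Bochner_Integration.integral_diff[OF square_integrable_mult_cnj[OF \<phi>f g] square_integrable_mult_cnj[OF f k]])
      also have "\<dots> = 0" using adj[OF f \<phi>f] by simp
      finally have "l2_sqnorm M ?f = 0" by (simp only: l2_inner_self of_real_eq_0_iff)
      then have "AE x in M. ?f x = 0" using l2_sqnorm_eq_0_iff[OF f] by blast
      then show ?thesis by eventually_elim (auto simp: indicator_def split: if_splits)
    qed
    then have "AE x in M. \<forall>n. \<bar>\<phi> x\<bar> \<le> real n \<longrightarrow> of_real (\<phi> x) * g x = k x"
      unfolding AE_all_countable by blast
    then have eq: "AE x in M. k x = of_real (\<phi> x) * g x"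
      by eventually_elim (metis real_arch_simple)
    have \<phi>g: "square_integrable M (\<lambda>x. of_real (\<phi> x) * g x)"
      by (rule square_integrable_cong_AE[OF k square_integrable_measurable_mult[OF g \<phi>] eq])
    have "W k = W (\<lambda>x. of_real (\<phi> x) * g x)" using eq W_eq_iff[OF k \<phi>g] by blast
    then show "p \<in> mult_op \<phi>" using mult_opI[OF g \<phi>g] by (simp add: pgk)
  qed
qed

lemma self_adjoint_mult_op:
  "\<phi> \<in> borel_measurable borel \<Longrightarrow> self_adjoint H (mult_op \<phi>)"
  by (simp add: self_adjoint_def linear_operator_mult_op Domain_mult_op_dense adjoint_mult_op)

text \<open>The Cayley transform of a multiplication operator is multiplication by a bounded function, and
  such multiplications commute.\<close>

definition bounded_mult :: "(real \<times> real \<Rightarrow> complex) \<Rightarrow> 'h graph"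
  where "bounded_mult c = {(W g, W (\<lambda>x. c x * g x)) | g. square_integrable M g}"

lemma cayley_mult_op:
  assumes \<phi>: "\<phi> \<in> borel_measurable borel"
  shows "cayley H (mult_op \<phi>) = bounded_mult (\<lambda>x. (of_real (\<phi> x) - \<i>) / (of_real (\<phi> x) + \<i>))"
proof (intro equalityI subsetI)
  fix p assume "p \<in> cayley H (mult_op \<phi>)"
  then obtain f where f: "square_integrable M f" and \<phi>f: "square_integrable M (\<lambda>x. of_real (\<phi> x) * f x)"
    and p: "p = (W (\<lambda>x. of_real (\<phi> x) * f x) + smult H \<i> (W f), W (\<lambda>x. of_real (\<phi> x) * f x) - smult H \<i> (W f))"
    by (auto simp: cayley_def elim!: mult_opE)
  note if' = square_integrable_cmult[OF f, of \<i>]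
  let ?g = "\<lambda>x. of_real (\<phi> x) * f x + \<i> * f x"
  have g: "square_integrable M ?g" by (intro square_integrable_add \<phi>f if')
  have "(\<lambda>x. (of_real (\<phi> x) - \<i>) / (of_real (\<phi> x) + \<i>) * ?g x) = (\<lambda>x. of_real (\<phi> x) * f x - \<i> * f x)"
    by (auto simp: distrib_right[symmetric] left_diff_distrib[symmetric])
  then have "p = (W ?g, W (\<lambda>x. (of_real (\<phi> x) - \<i>) / (of_real (\<phi> x) + \<i>) * ?g x))"
    using f \<phi>f if' by (simp add: p W_add W_diff W_smult)
  then show "p \<in> bounded_mult (\<lambda>x. (of_real (\<phi> x) - \<i>) / (of_real (\<phi> x) + \<i>))"
    using g unfolding bounded_mult_def by blast
next
  fix p assume "p \<in> bounded_mult (\<lambda>x. (of_real (\<phi> x) - \<i>) / (of_real (\<phi> x) + \<i>))"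
  then obtain g where g: "square_integrable M g"
    and p: "p = (W g, W (\<lambda>x. (of_real (\<phi> x) - \<i>) / (of_real (\<phi> x) + \<i>) * g x))"
    by (auto simp: bounded_mult_def)
  let ?f = "\<lambda>x. g x / (of_real (\<phi> x) + \<i>)"
  have [measurable]: "g \<in> borel_measurable M" "\<phi> \<in> borel_measurable M"
    using square_integrable_measurable[OF g] \<phi> by (simp_all add: borel_measurable_M)
  have ge: "1 \<le> cmod (of_real (\<phi> x) + \<i>)" "\<bar>\<phi> x\<bar> \<le> cmod (of_real (\<phi> x) + \<i>)" for x
    using abs_Im_le_cmod[of "of_real (\<phi> x) + \<i>"] abs_Re_le_cmod[of "of_real (\<phi> x) + \<i>"] by auto
  have f: "square_integrable M ?f"
  proof (rule square_integrable_bound[OF g, where C = 1])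
    show "?f \<in> borel_measurable M" by measurable
    show "cmod (?f x) \<le> 1 * cmod (g x)" for x
      using ge(1)[of x] by (simp add: norm_divide divide_le_eq mult_le_cancel_left1)
  qed
  have \<phi>f: "square_integrable M (\<lambda>x. of_real (\<phi> x) * ?f x)"
  proof (rule square_integrable_bound[OF g, where C = 1])
    show "(\<lambda>x. of_real (\<phi> x) * ?f x) \<in> borel_measurable M" by measurable
    show "cmod (of_real (\<phi> x) * ?f x) \<le> 1 * cmod (g x)" for x
    proof -
      have "0 < cmod (of_real (\<phi> x) + \<i>)" using ge(1)[of x] by linarith
      then show ?thesis using mult_right_mono[OF ge(2)[of x], of "cmod (g x)"]
        by (simp add: norm_mult norm_divide divide_le_eq mult.commute)
    qed
  qed
  note if' = square_integrable_cmult[OF f, of \<i>]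
  have e1: "(\<lambda>x. of_real (\<phi> x) * ?f x + \<i> * ?f x) = g"
  proof
    fix x
    have "of_real (\<phi> x) * ?f x + \<i> * ?f x = (of_real (\<phi> x) + \<i>) * ?f x" by (rule distrib_right[symmetric])
    then show "of_real (\<phi> x) * ?f x + \<i> * ?f x = g x" by simp
  qed
  have e2: "(\<lambda>x. of_real (\<phi> x) * ?f x - \<i> * ?f x) = (\<lambda>x. (of_real (\<phi> x) - \<i>) / (of_real (\<phi> x) + \<i>) * g x)"
  proof
    fix x
    have "of_real (\<phi> x) * ?f x - \<i> * ?f x = (of_real (\<phi> x) - \<i>) * ?f x" by (rule left_diff_distrib[symmetric])
    then show "of_real (\<phi> x) * ?f x - \<i> * ?f x = (of_real (\<phi> x) - \<i>) / (of_real (\<phi> x) + \<i>) * g x" by simp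
  qed
  have "p = (W (\<lambda>x. of_real (\<phi> x) * ?f x) + smult H \<i> (W ?f), W (\<lambda>x. of_real (\<phi> x) * ?f x) - smult H \<i> (W ?f))"
    using W_add[OF \<phi>f if'] W_diff[OF \<phi>f if'] unfolding p e1 e2 W_smult[OF f] by simp
  then show "p \<in> cayley H (mult_op \<phi>)"
    using mult_opI[OF f \<phi>f] unfolding cayley_def by blast
qed

lemma bounded_mult_comp:
  assumes "\<And>g. square_integrable M g \<Longrightarrow> square_integrable M (\<lambda>x. c x * g x)"
    "\<And>g. square_integrable M g \<Longrightarrow> square_integrable M (\<lambda>x. d x * g x)"
  shows "bounded_mult c O bounded_mult d = bounded_mult (\<lambda>x. c x * d x)"
proof (intro equalityI subsetI)
  fix p assume "p \<in> bounded_mult c O bounded_mult d"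
  then obtain g g' where g: "square_integrable M g" "square_integrable M g'"
    and eq: "W (\<lambda>x. c x * g x) = W g'" and p: "p = (W g, W (\<lambda>x. d x * g' x))"
    by (auto simp: bounded_mult_def)
  have "AE x in M. c x * g x = g' x" using eq W_eq_iff[OF assms(1)[OF g(1)] g(2)] by blast
  then have "AE x in M. d x * g' x = d x * (c x * g x)" by auto
  then have "W (\<lambda>x. d x * g' x) = W (\<lambda>x. d x * (c x * g x))"
    using assms g by (subst W_eq_iff) auto
  then have "p = (W g, W (\<lambda>x. c x * d x * g x))" by (simp add: p mult_ac)
  then show "p \<in> bounded_mult (\<lambda>x. c x * d x)" using g(1) unfolding bounded_mult_def by blast
next
  fix p assume "p \<in> bounded_mult (\<lambda>x. c x * d x)"
  then obtain g where g: "square_integrable M g" and p: "p = (W g, W (\<lambda>x. c x * d x * g x))"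
    by (auto simp: bounded_mult_def)
  have "(W g, W (\<lambda>x. c x * g x)) \<in> bounded_mult c" using g unfolding bounded_mult_def by blast
  moreover have "(W (\<lambda>x. c x * g x), W (\<lambda>x. d x * (c x * g x))) \<in> bounded_mult d"
    using assms(1)[OF g] unfolding bounded_mult_def by blast
  ultimately show "p \<in> bounded_mult c O bounded_mult d"
    unfolding p by (auto simp: mult_ac intro: relcompI)
qed

lemma commuting_mult_op:
  assumes \<phi>: "\<phi> \<in> borel_measurable borel" and \<psi>: "\<psi> \<in> borel_measurable borel"
  shows "commuting H (mult_op \<phi>) (mult_op \<psi>)"
proof -
  let ?c = "\<lambda>\<phi> x. (of_real (\<phi> x) - \<i>) / (of_real (\<phi> x) + \<i>)"
  have sq: "square_integrable M (\<lambda>x. ?c \<theta> x * g x)"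
    if "\<theta> \<in> borel_measurable borel" "square_integrable M g" for \<theta> g
  proof (rule square_integrable_bounded_mult[OF that(2), where C = 1])
    have [measurable]: "\<theta> \<in> borel_measurable M" using that(1) by (simp add: borel_measurable_M)
    show "?c \<theta> \<in> borel_measurable M" by measurable
  qed (simp add: cmod_cayley del: norm_divide)
  have "bounded_mult (?c \<phi>) O bounded_mult (?c \<psi>) = bounded_mult (\<lambda>x. ?c \<phi> x * ?c \<psi> x)"
    by (rule bounded_mult_comp[OF sq[OF \<phi>] sq[OF \<psi>]])
  moreover have "bounded_mult (?c \<psi>) O bounded_mult (?c \<phi>) = bounded_mult (\<lambda>x. ?c \<psi> x * ?c \<phi> x)"
    by (rule bounded_mult_comp[OF sq[OF \<psi>] sq[OF \<phi>]])
  moreover have "(\<lambda>x. ?c \<phi> x * ?c \<psi> x) = (\<lambda>x. ?c \<psi> x * ?c \<phi> x)" by (simp only: mult.commute)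
  ultimately show ?thesis
    unfolding commuting_def cayley_mult_op[OF \<phi>] cayley_mult_op[OF \<psi>] by simp
qed

lemma orth_projection_multE:
  assumes \<Delta>: "\<Delta> \<in> sets borel"
  shows "orth_projection H (multE \<Delta>)"
proof -
  note sq = square_integrable_indicator_M[OF \<Delta>]
  have rep: "\<exists>f. square_integrable M f \<and> h = W f" if "h \<in> points H" for h using W_surj[OF that] by auto
  show ?thesis
    unfolding orth_projection_def
  proof (intro conjI ballI allI)
    fix h assume "h \<in> points H"
    then obtain f where f: "square_integrable M f" "h = W f" using rep by blast
    show "multE \<Delta> h \<in> points H" using f by (simp add: multE_W[OF \<Delta>] sq)
    show "multE \<Delta> (smult H c h) = smult H c (multE \<Delta> h)" for c
    proof -
      have "multE \<Delta> (smult H c h) = W (\<lambda>x. indicator \<Delta> x * (c * f x))"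
        using f by (simp add: W_smult[symmetric] multE_W[OF \<Delta>] square_integrable_cmult)
      also have "(\<lambda>x. indicator \<Delta> x * (c * f x)) = (\<lambda>x. c * (indicator \<Delta> x * f x))" by (simp add: mult.left_commute)
      finally show ?thesis using f by (simp add: W_smult sq multE_W[OF \<Delta>])
    qed
    show "multE \<Delta> (multE \<Delta> h) = multE \<Delta> h"
    proof -
      have "(\<lambda>x. indicator \<Delta> x * (indicator \<Delta> x * f x)) = (\<lambda>x. indicator \<Delta> x * f x)" by (auto simp: indicator_def)
      then show ?thesis using multE_W[OF \<Delta> sq[OF f(1)]] unfolding f(2) multE_W[OF \<Delta> f(1)] by simp
    qed
    fix g assume "g \<in> points H"
    then obtain k where k: "square_integrable M k" "g = W k" using rep by blast
    show "multE \<Delta> (h + g) = multE \<Delta> h + multE \<Delta> g"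
      using f k by (simp add: W_add[symmetric] multE_W[OF \<Delta>] square_integrable_add sq distrib_left)
    show "cip H (multE \<Delta> h) g = cip H h (multE \<Delta> g)"
      unfolding f(2) k(2) multE_W[OF \<Delta> f(1)] multE_W[OF \<Delta> k(1)] W_inner[OF sq[OF f(1)] k(1)]
        W_inner[OF f(1) sq[OF k(1)]] l2_inner_def
      by (intro Bochner_Integration.integral_cong refl) (simp add: indicator_def)
  qed
qed

lemma spectral_measure_multE: "spectral_measure H multE"
  unfolding spectral_measure_def
proof (intro conjI ballI allI impI orth_projection_multE)
  fix h assume "h \<in> points H"
  then obtain f where f: "square_integrable M f" "h = W f" using W_surj by metis
  show "multE UNIV h = h" using f by (simp add: multE_W)
  show "multE (\<Delta> \<inter> \<Delta>') h = multE \<Delta> (multE \<Delta>' h)" if "\<Delta> \<in> sets borel" "\<Delta>' \<in> sets borel" for \<Delta> \<Delta>'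
    using f that by (simp add: multE_W square_integrable_indicator_M indicator_inter_arith mult.assoc sets.Int)
next
  fix D :: "nat \<Rightarrow> (real \<times> real) set" and h
  assume D: "range D \<subseteq> sets borel" "disjoint_family D" and "h \<in> points H"
  then obtain f where f: "square_integrable M f" "h = W f" using W_surj by metis
  have Db: "D j \<in> sets borel" for j using D by auto
  note sq = square_integrable_indicator_M[OF Db f(1)]
  have part: "(\<Sum>j<n. indicator (D j) x * f x) = indicator (\<Union>j<n. D j) x * f x" for n x
    unfolding sum_distrib_right[symmetric]
    by (subst indicator_UN_disjoint) (use D in \<open>auto simp: disjoint_family_on_def\<close>)
  have U: "(\<Union>j. D j) \<in> sets borel" using Db by auto
  have "l2_tendsto M (\<lambda>n x. \<Sum>j<n. indicator (D j) x * f x) (\<lambda>x. indicator (\<Union>j. D j) x * f x)"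
  proof (rule l2_tendsto_dominated[OF _ _ f(1), where C = 1])
    show "(\<lambda>x. \<Sum>j<n. indicator (D j) x * f x) \<in> borel_measurable M" for n
      by (intro square_integrable_measurable square_integrable_sum sq)
    show "(\<lambda>x. indicator (\<Union>j. D j) x * f x) \<in> borel_measurable M"
      by (intro square_integrable_measurable square_integrable_indicator_M[OF U f(1)])
    show "cmod (\<Sum>j<n. indicator (D j) x * f x) \<le> 1 * cmod (f x)" for n x
      unfolding part by (simp add: indicator_def)
    show "(\<lambda>n. \<Sum>j<n. indicator (D j) x * f x) \<longlonglongrightarrow> indicator (\<Union>j. D j) x * f x" for x
      unfolding part by (intro tendsto_intros LIMSEQ_indicator_UN)
  qed
  moreover have "(\<Sum>j<n. multE (D j) h) = W (\<lambda>x. \<Sum>j<n. indicator (D j) x * f x)" for n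
    unfolding f(2) multE_W[OF Db f(1)] by (rule W_sum[OF sq, symmetric])
  ultimately show "limitin (htop H) (\<lambda>n. \<Sum>j<n. multE (D j) h) (multE (\<Union>j. D j) h) sequentially"
    using W_tendsto unfolding f(2) multE_W[OF U f(1)] by presburger
qed

text \<open>A pair in the spectral integral satisfies the integrability condition, which is membership in the
  domain; its second component is the limit along one particular approximating sequence.\<close>

lemma spectral_integral_multE:
  assumes \<phi>: "\<phi> \<in> borel_measurable borel"
  shows "spectral_integral H multE \<phi> = mult_op \<phi>"
proof
  show "mult_op \<phi> \<subseteq> spectral_integral H multE \<phi>"
    using spectral_integral_W[OF _ \<phi>] by (auto elim!: mult_opE)
  show "spectral_integral H multE \<phi> \<subseteq> mult_op \<phi>"
  proof
    fix p assume "p \<in> spectral_integral H multE \<phi>"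
    then obtain h g where p: "p = (h, g)" "h \<in> points H"
      and int: "integrable (scalar_measure H multE h) (\<lambda>p. (\<phi> p)\<^sup>2)"
      and lim: "\<And>s :: nat \<Rightarrow> real \<times> real \<Rightarrow> real. (\<forall>n. simple_function borel (s n)) \<Longrightarrow>
        (\<forall>p. (\<lambda>n. s n p) \<longlonglongrightarrow> \<phi> p) \<Longrightarrow> (\<forall>n p. \<bar>s n p\<bar> \<le> \<bar>\<phi> p\<bar>) \<Longrightarrow>
        limitin (htop H) (\<lambda>n. simple_spectral_integral H multE (s n) h) g sequentially"
      by (auto simp: spectral_integral_def)
    obtain f where f: "square_integrable M f" "h = W f" using p(2) W_surj by metis
    have \<phi>f: "square_integrable M (\<lambda>x. of_real (\<phi> x) * f x)"
      using int integrable_scalar_measure_W_iff[OF f(1) \<phi>] by (simp add: f(2))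
    obtain s :: "nat \<Rightarrow> real \<times> real \<Rightarrow> real" where s: "\<forall>n. simple_function borel (s n)"
      "\<forall>p. (\<lambda>n. s n p) \<longlonglongrightarrow> \<phi> p" "\<forall>n p. \<bar>s n p\<bar> \<le> \<bar>\<phi> p\<bar>"
      using ex_simple_functions_dominated[OF \<phi>] by blast
    have "g = W (\<lambda>x. of_real (\<phi> x) * f x)"
    proof (rule limitin_metric_unique[OF lim[OF s]])
      show "limitin (htop H) (\<lambda>n. simple_spectral_integral H multE (s n) h) (W (\<lambda>x. of_real (\<phi> x) * f x)) sequentially"
        unfolding f(2) by (rule simple_spectral_integral_tendsto[OF _ _ _ \<phi> f(1) \<phi>f]) (use s in auto)
    qed simp
    then show "p \<in> mult_op \<phi>" using mult_opI[OF f(1) \<phi>f] by (simp add: p f)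
  qed
qed

end

section \<open>Construction of isometries\<close>

context l2_isometry
begin

lemma hdist_W:
  assumes "square_integrable M f" "square_integrable M g"
  shows "hdist H (W f) (W g) = sqrt (l2_sqnorm M (\<lambda>x. f x - g x))"
  using assms by (simp add: hdist_def W_diff[symmetric] nrm_W square_integrable_diff)

lemma l2_tendsto_if_MCauchy:
  assumes f: "\<And>n. square_integrable M (f n)" and "MCauchy (\<lambda>n. W (f n))"
  shows "\<exists>g. l2_tendsto M f g"
proof (rule l2_complete[OF finite_M f])
  fix e :: real assume "e > 0"
  then have "sqrt e > 0" by simp
  then obtain N where N: "\<And>m n. m \<ge> N \<Longrightarrow> n \<ge> N \<Longrightarrow> hdist H (W (f m)) (W (f n)) < sqrt e"
    using assms(2) unfolding MCauchy_def by blast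
  have "l2_sqnorm M (\<lambda>x. f m x - f n x) < e" if "m \<ge> N" "n \<ge> N" for m n
    using N[OF that] by (simp add: hdist_W f)
  then show "\<exists>N. \<forall>m\<ge>N. \<forall>n\<ge>N. l2_sqnorm M (\<lambda>x. f m x - f n x) < e" by blast
qed

text \<open>The Riesz--Fischer theorem, transported by the isometry.\<close>

lemma mcomplete_if_surj:
  assumes surj: "\<And>h. h \<in> points H \<Longrightarrow> \<exists>f. square_integrable M f \<and> W f = h"
  shows mcomplete
  unfolding mcomplete_def
proof (intro allI impI)
  fix \<sigma> assume \<sigma>: "MCauchy \<sigma>"
  then have "\<exists>f. square_integrable M f \<and> W f = \<sigma> n" for n by (intro surj) (auto simp: MCauchy_def)
  then obtain f where f: "\<And>n. square_integrable M (f n)" "\<And>n. W (f n) = \<sigma> n" by metis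
  then obtain g where "l2_tendsto M f g" using l2_tendsto_if_MCauchy[of f] \<sigma> by auto
  from W_tendsto[OF this] show "\<exists>x. limitin (htop H) \<sigma> x sequentially" using f(2) by auto
qed

lemma W_range_closed:
  assumes f: "\<And>n. square_integrable M (f n)" and lim: "limitin (htop H) (\<lambda>n. W (f n)) h sequentially"
  shows "\<exists>g. square_integrable M g \<and> W g = h"
proof -
  have "MCauchy (\<lambda>n. W (f n))" using lim f by (intro convergent_imp_MCauchy) auto
  then obtain g where g: "l2_tendsto M f g" using l2_tendsto_if_MCauchy[of f, OF f] by blast
  have "W g = h" by (rule limitin_metric_unique[OF W_tendsto[OF g] lim]) simp
  then show ?thesis using l2_tendstoD(2)[OF g] by blast
qed

end

text \<open>A family in a Hilbert space with the Gram matrix of a total family of square integrable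
  functions is its image under an isometry: approximations by linear combinations determine it.\<close>

context complex_hilbert_space
begin

lemma ex_l2_isometry:
  fixes M :: "'m measure" and e :: "'i \<Rightarrow> 'm \<Rightarrow> complex" and y :: "'i \<Rightarrow> 'a"
  assumes fin: "finite_measure M" and e: "\<And>i. square_integrable M (e i)" and y: "\<And>i. y i \<in> points H"
    and gram: "\<And>i j. cip H (y i) (y j) = l2_inner M (e i) (e j)"
    and dense: "\<And>f \<epsilon>. square_integrable M f \<Longrightarrow> \<epsilon> > 0 \<Longrightarrow>
      \<exists>I c. finite I \<and> l2_sqnorm M (\<lambda>x. f x - (\<Sum>i\<in>I. c i * e i x)) < \<epsilon>"
  shows "\<exists>W. l2_isometry H M W \<and> (\<forall>i. W (e i) = y i)"
proof -
  let ?P = "\<lambda>I c x. \<Sum>i\<in>I. c i * e i x"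
  let ?Y = "\<lambda>I c. \<Sum>i\<in>I. smult H (c i) (y i)"
  have P: "square_integrable M (?P I c)" for I c by (intro square_integrable_sum square_integrable_cmult e)
  have Y: "?Y I c \<in> points H" for I c using y by simp
  have PY: "cip H (?Y I c) (?Y J d) = l2_inner M (?P I c) (?P J d)" for I c J d
  proof -
    have "l2_inner M (?P I c) (?P J d) = (\<Sum>i\<in>I. l2_inner M (\<lambda>x. c i * e i x) (?P J d))"
      by (intro l2_inner_sum_left P square_integrable_cmult e)
    also have "\<dots> = (\<Sum>i\<in>I. \<Sum>j\<in>J. l2_inner M (\<lambda>x. c i * e i x) (\<lambda>x. d j * e j x))"
      by (intro sum.cong refl l2_inner_sum_right square_integrable_cmult e)
    also have "\<dots> = (\<Sum>i\<in>I. \<Sum>j\<in>J. cip H (smult H (c i) (y i)) (smult H (d j) (y j)))"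
      by (simp only: l2_inner_cmult_left l2_inner_cmult_right gram[symmetric]
          cip_smult_left[OF y points_simps(4)[OF y]] cip_smult_right[OF y y])
    also have "\<dots> = (\<Sum>i\<in>I. cip H (smult H (c i) (y i)) (?Y J d))"
      using y by (simp add: cip_sum_right)
    also have "\<dots> = cip H (?Y I c) (?Y J d)"
      by (rule cip_sum_left[symmetric]) (use y Y in auto)
    finally show ?thesis by simp
  qed
  \<comment> \<open>\<open>h\<close> is a limit of combinations whose counterparts tend to \<open>f\<close>.  Passing to the limit in the Gram
    identity shows that such pairs respect inner products, so the choice of approximations is irrelevant.\<close>
  define rep where "rep f h \<longleftrightarrow> (\<exists>I c. l2_tendsto M (\<lambda>n. ?P (I n) (c n)) f \<and>
    limitin (htop H) (\<lambda>n. ?Y (I n) (c n)) h sequentially)" for f h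
  have rep_points: "h \<in> points H" if "rep f h" for f h
    using that limitin_points by (auto simp: rep_def)
  have rep_inner: "cip H h k = l2_inner M f g" if "rep f h" "rep g k" for f g h k
  proof -
    obtain I c where 1: "l2_tendsto M (\<lambda>n. ?P (I n) (c n)) f" "limitin (htop H) (\<lambda>n. ?Y (I n) (c n)) h sequentially"
      using \<open>rep f h\<close> unfolding rep_def by auto
    obtain J d where 2: "l2_tendsto M (\<lambda>n. ?P (J n) (d n)) g" "limitin (htop H) (\<lambda>n. ?Y (J n) (d n)) k sequentially"
      using \<open>rep g k\<close> unfolding rep_def by auto
    show ?thesis
      using cip_tendsto[OF Y 1(2) Y 2(2)] l2_tendsto_inner[OF 1(1) 2(1)] unfolding PY by (rule LIMSEQ_unique)
  qed
  have rep_ex: "\<exists>h. rep f h" if f: "square_integrable M f" for f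
  proof -
    have "\<exists>p. finite (fst p) \<and> l2_sqnorm M (\<lambda>x. f x - ?P (fst p) (snd p) x) < inverse (real (Suc n))" for n
      using dense[OF f, of "inverse (real (Suc n))"] by auto
    then obtain p where p: "\<And>n. l2_sqnorm M (\<lambda>x. f x - ?P (fst (p n)) (snd (p n)) x) < inverse (real (Suc n))" by metis
    define I c where "I n = fst (p n)" and "c n = snd (p n)" for n
    have close: "l2_sqnorm M (\<lambda>x. ?P (I n) (c n) x - f x) < inverse (real (Suc n))" for n
      using p[of n] by (subst l2_sqnorm_diff_commute) (simp add: I_def c_def)
    have "(\<lambda>n. l2_sqnorm M (\<lambda>x. ?P (I n) (c n) x - f x)) \<longlonglongrightarrow> 0"
      by (rule Lim_null_comparison[OF always_eventually LIMSEQ_inverse_real_of_nat])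
         (use close in \<open>auto simp: l2_sqnorm_nonneg less_imp_le\<close>)
    then have conv: "l2_tendsto M (\<lambda>n. ?P (I n) (c n)) f" using P f by (simp add: l2_tendsto_def)
    have dist: "(nrm H (?Y (I m) (c m) - ?Y (I n) (c n)))\<^sup>2 = l2_sqnorm M (\<lambda>x. ?P (I m) (c m) x - ?P (I n) (c n) x)" for m n
    proof -
      have "cip H (?Y (I m) (c m) - ?Y (I n) (c n)) (?Y (I m) (c m) - ?Y (I n) (c n)) =
          l2_inner M (\<lambda>x. ?P (I m) (c m) x - ?P (I n) (c n) x) (\<lambda>x. ?P (I m) (c m) x - ?P (I n) (c n) x)"
        using Y P by (simp add: cip_diff_left cip_diff_right l2_inner_diff_left l2_inner_diff_right square_integrable_diff PY)
      then show ?thesis using Y by (simp only: l2_inner_self cip_self points_simps(3) of_real_eq_iff)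
    qed
    have "MCauchy (\<lambda>n. ?Y (I n) (c n))"
      unfolding MCauchy_def
    proof (intro conjI allI impI)
      show "range (\<lambda>n. ?Y (I n) (c n)) \<subseteq> points H" using Y by blast
      fix \<epsilon> :: real assume \<epsilon>: "\<epsilon> > 0"
      then obtain N where N: "inverse (real (Suc N)) < \<epsilon>\<^sup>2 / 4" using reals_Archimedean[of "\<epsilon>\<^sup>2 / 4"] by auto
      show "\<exists>N. \<forall>m n. N \<le> m \<longrightarrow> N \<le> n \<longrightarrow> hdist H (?Y (I m) (c m)) (?Y (I n) (c n)) < \<epsilon>"
      proof (intro exI[of _ N] allI impI)
        fix m n assume mn: "N \<le> m" "N \<le> n"
        have small: "l2_sqnorm M (\<lambda>x. ?P (I k) (c k) x - f x) < \<epsilon>\<^sup>2 / 4" if "N \<le> k" for k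
        proof -
          have "inverse (real (Suc k)) \<le> inverse (real (Suc N))" using that by (simp add: le_imp_inverse_le)
          then show ?thesis using close[of k] N by linarith
        qed
        have "l2_sqnorm M (\<lambda>x. ?P (I m) (c m) x - ?P (I n) (c n) x) \<le>
            2 * l2_sqnorm M (\<lambda>x. ?P (I m) (c m) x - f x) + 2 * l2_sqnorm M (\<lambda>x. f x - ?P (I n) (c n) x)"
          by (rule l2_sqnorm_triangle[OF P f P])
        also have "\<dots> < \<epsilon>\<^sup>2"
          using small[OF mn(1)] small[OF mn(2)] l2_sqnorm_diff_commute[of M f "?P (I n) (c n)"] by simp
        finally have "(nrm H (?Y (I m) (c m) - ?Y (I n) (c n)))\<^sup>2 < \<epsilon>\<^sup>2" by (simp only: dist)
        then have "nrm H (?Y (I m) (c m) - ?Y (I n) (c n)) < \<epsilon>" using \<epsilon> by (rule power_less_imp_less_base[OF _ less_imp_le])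
        then show "hdist H (?Y (I m) (c m)) (?Y (I n) (c n)) < \<epsilon>" using Y by (simp add: hdist_def)
      qed
    qed
    then obtain h where "limitin (htop H) (\<lambda>n. ?Y (I n) (c n)) h sequentially"
      using complete unfolding mcomplete_def by blast
    then show ?thesis using conv unfolding rep_def by blast
  qed
  have rep_e: "rep (e i) (y i)" for i
    unfolding rep_def
  proof (intro exI conjI)
    show "l2_tendsto M (\<lambda>n. ?P ((\<lambda>_. {i}) n) ((\<lambda>_ _. 1) n)) (e i)" using l2_tendsto_const[OF e[of i]] by simp
    show "limitin (htop H) (\<lambda>n. ?Y ((\<lambda>_. {i}) n) ((\<lambda>_ _. 1) n)) (y i) sequentially"
      using y by (simp add: limitin_const_iff)
  qed
  define W where "W f = (SOME h. rep f h)" for f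
  have W: "rep f (W f)" if "square_integrable M f" for f
    unfolding W_def using rep_ex[OF that] by (rule someI_ex)
  have "l2_isometry H M W"
  proof (intro l2_isometry.intro complex_ip_space_axioms l2_isometry_axioms.intro)
    show "finite_measure M" by (rule fin)
    show "W f \<in> points H" if "square_integrable M f" for f by (rule rep_points[OF W[OF that]])
    show "cip H (W f) (W g) = l2_inner M f g" if "square_integrable M f" "square_integrable M g" for f g
      by (rule rep_inner[OF W[OF that(1)] W[OF that(2)]])
  qed
  moreover have "W (e i) = y i" for i
  proof -
    have "cip H (W (e i) - y i) (W (e i) - y i) = 0"
      using rep_points[OF W[OF e[of i]]] y[of i] rep_inner[OF W[OF e[of i]] W[OF e[of i]]] rep_inner[OF W[OF e[of i]] rep_e[of i]]
        rep_inner[OF rep_e[of i] W[OF e[of i]]] rep_inner[OF rep_e[of i] rep_e[of i]]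
      by (simp add: cip_diff_left cip_diff_right)
    then show ?thesis using cip_eq_0[of "W (e i) - y i"] rep_points[OF W[OF e[of i]]] y[of i] by simp
  qed
  ultimately show ?thesis by blast
qed

end

section \<open>Separability and graph closures\<close>

context complex_ip_space
begin

lemma limitin_add:
  assumes s: "\<And>n. s n \<in> points H" "limitin (htop H) s h sequentially"
    and t: "\<And>n. t n \<in> points H" "limitin (htop H) t k sequentially"
  shows "limitin (htop H) (\<lambda>n. s n + t n) (h + k) sequentially"
proof -
  have h: "h \<in> points H" and k: "k \<in> points H" using s t by (auto dest: limitin_points)
  have 1: "(\<lambda>n. nrm H (s n - h)) \<longlonglongrightarrow> 0" using limitin_iff_nrm[of s h, OF s(1) h] s(2) by blast
  have 2: "(\<lambda>n. nrm H (t n - k)) \<longlonglongrightarrow> 0" using limitin_iff_nrm[of t k, OF t(1) k] t(2) by blast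
  have "(\<lambda>n. nrm H ((s n + t n) - (h + k))) \<longlonglongrightarrow> 0"
  proof (rule Lim_null_comparison[OF always_eventually])
    show "\<forall>n. norm (nrm H ((s n + t n) - (h + k))) \<le> nrm H (s n - h) + nrm H (t n - k)"
    proof
      fix n
      have eq: "(s n + t n) - (h + k) = (s n - h) + (t n - k)" by simp
      have "nrm H ((s n + t n) - (h + k)) \<le> nrm H (s n - h) + nrm H (t n - k)"
        unfolding eq by (rule nrm_triangle[OF points_simps(3)[OF s(1) h] points_simps(3)[OF t(1) k]])
      then show "norm (nrm H ((s n + t n) - (h + k))) \<le> nrm H (s n - h) + nrm H (t n - k)"
        using nrm_nonneg[of "(s n + t n) - (h + k)"] s(1) t(1) h k by simp
    qed
    show "(\<lambda>n. nrm H (s n - h) + nrm H (t n - k)) \<longlonglongrightarrow> 0" using tendsto_add[OF 1 2] by simp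
  qed
  then show ?thesis using limitin_iff_nrm[of "\<lambda>n. s n + t n" "h + k"] s(1) t(1) h k by simp
qed

lemma nrm_smult: "x \<in> points H \<Longrightarrow> nrm H (smult H c x) = cmod c * nrm H x"
proof -
  assume x: "x \<in> points H"
  then have "cip H (smult H c x) (smult H c x) = (c * cnj c) * cip H x x"
    by (simp add: cip_smult_left cip_smult_right)
  also have "\<dots> = of_real ((cmod c * nrm H x)\<^sup>2)"
    using x by (simp add: complex_norm_square[symmetric] cip_self power_mult_distrib)
  finally show ?thesis using nrm_nonneg[OF x] by (simp add: nrm_def real_sqrt_mult)
qed

lemma separable_if_span_dense:
  fixes x :: "'i::countable \<Rightarrow> 'h"
  assumes x: "range x \<subseteq> points H" and dense: "htop H closure_of (span (range x)) = points H"
  shows "separable_space (htop H)"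
proof -
  \<comment> \<open>Lists of rational coefficients and indices are countable, and appending lists adds their values; so
    the closure \<open>C\<close> of these values is closed under addition and contains all multiples of the family.\<close>
  define S where "S l = (\<Sum>(a, b, i)\<leftarrow>l. smult H (Complex (of_rat a) (of_rat b)) (x i))" for l :: "(rat \<times> rat \<times> 'i) list"
  have xp: "x i \<in> points H" for i using x by blast
  have Sp: "S l \<in> points H" for l by (induction l) (auto simp: S_def xp)
  have S_append: "S l + S l' = S (l @ l')" for l l' by (simp add: S_def)
  define C where "C = htop H closure_of (range S)"
  have sub: "range S \<subseteq> points H" using Sp by blast
  have CE: "\<exists>s. (\<forall>n. s n \<in> range S) \<and> limitin (htop H) s h sequentially" if "h \<in> C" for h
    using in_closure_of_seq[OF sub] that unfolding C_def by blast
  have add: "h + k \<in> C" if h: "h \<in> C" and k: "k \<in> C" for h k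
  proof -
    obtain s where s: "\<forall>n. s n \<in> range S" "limitin (htop H) s h sequentially" using CE[OF h] by blast
    obtain t where t: "\<forall>n. t n \<in> range S" "limitin (htop H) t k sequentially" using CE[OF k] by blast
    have "s n \<in> points H" "t n \<in> points H" for n
      using subsetD[OF sub] s(1) t(1) by auto
    then have lim: "limitin (htop H) (\<lambda>n. s n + t n) (h + k) sequentially"
      by (intro limitin_add s(2) t(2))
    have "s n + t n \<in> range S" for n
    proof -
      obtain l l' where "s n = S l" "t n = S l'" using s(1)[rule_format, of n] t(1)[rule_format, of n] by auto
      then show ?thesis using S_append[of l l'] by auto
    qed
    then show ?thesis unfolding C_def by (rule in_closure_ofI[OF _ sub lim])
  qed
  have single: "smult H c (x i) \<in> C" for c i
    unfolding C_def in_closure_of_iff_nrm[OF sub]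
  proof (intro conjI allI impI)
    show "smult H c (x i) \<in> points H" using xp by simp
    fix e :: real assume e: "e > 0"
    define d where "d = e / (2 * (nrm H (x i) + 1))"
    have n0: "0 \<le> nrm H (x i)" by (rule nrm_nonneg[OF xp])
    then have d: "d > 0" using e by (simp add: d_def)
    obtain a where a: "of_rat a > Re c - d" "of_rat a < Re c" using of_rat_dense[of "Re c - d" "Re c"] d by auto
    obtain b where b: "of_rat b > Im c - d" "of_rat b < Im c" using of_rat_dense[of "Im c - d" "Im c"] d by auto
    have "cmod (c - Complex (of_rat a) (of_rat b)) \<le> \<bar>Re c - of_rat a\<bar> + \<bar>Im c - of_rat b\<bar>"
      using cmod_le[of "c - Complex (of_rat a) (of_rat b)"] by simp
    also have "\<dots> < 2 * d" using a b by simp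
    finally have "cmod (c - Complex (of_rat a) (of_rat b)) * nrm H (x i) \<le> 2 * d * nrm H (x i)"
      by (intro mult_right_mono n0) simp
    also have "\<dots> < e" using n0 e by (simp add: d_def field_simps)
    finally have "nrm H (smult H c (x i) - S [(a, b, i)]) < e"
      using nrm_smult[OF xp[of i], of "c - Complex (of_rat a) (of_rat b)"] by (simp add: S_def scale_left_diff_distrib)
    then show "\<exists>s\<in>range S. nrm H (smult H c (x i) - s) < e" by blast
  qed
  have zero: "0 \<in> C"
    using single[of 0 undefined] by simp
  have sum: "(\<Sum>a\<in>t. smult H (r a) a) \<in> C" if "finite t" "t \<subseteq> range x" for t r
    using that by (induction t rule: finite_induct) (auto intro: zero add single)
  have "span (range x) \<subseteq> C" using sum by (auto simp: span_explicit)
  then have "points H \<subseteq> htop H closure_of C" using dense closure_of_mono by metis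
  then have "points H \<subseteq> C" by (simp add: C_def)
  moreover have "C \<subseteq> points H" unfolding C_def by (metis closure_of_subset_topspace topspace_mtopology)
  ultimately have "htop H closure_of (range S) = points H" by (simp add: C_def)
  then show ?thesis
    unfolding separable_space_def using sub by (intro exI[of _ "range S"]) auto
qed

text \<open>The product topology is metrizable, so sequences suffice.\<close>

lemma op_closure_iff:
  assumes "T \<subseteq> points H \<times> points H"
  shows "p \<in> op_closure H T \<longleftrightarrow> (\<exists>s. (\<forall>n. s n \<in> T) \<and>
    limitin (htop H) (\<lambda>n. fst (s n)) (fst p) sequentially \<and> limitin (htop H) (\<lambda>n. snd (s n)) (snd p) sequentially)"
proof -
  interpret P: Metric_space12 "points H" "hdist H" "points H" "hdist H"
    by (intro Metric_space12.intro) unfold_locales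
  have "p \<in> op_closure H T \<longleftrightarrow> p \<in> points H \<times> points H \<and>
      (\<exists>s. range s \<subseteq> T \<inter> points H \<times> points H \<and> limitin P.Prod_metric.mtopology s p sequentially)"
    unfolding op_closure_def P.mtopology_prod_metric[symmetric] P.Prod_metric.closure_of_sequentially by simp
  also have "\<dots> \<longleftrightarrow> (\<exists>s. (\<forall>n. s n \<in> T) \<and> limitin P.Prod_metric.mtopology s p sequentially)"
  proof -
    have r: "range s \<subseteq> T \<inter> points H \<times> points H \<longleftrightarrow> (\<forall>n. s n \<in> T)" for s :: "nat \<Rightarrow> 'h \<times> 'h"
      using assms by blast
    show ?thesis unfolding r using P.Prod_metric.limitin_mspace by blast
  qed
  finally have "p \<in> op_closure H T \<longleftrightarrow>
      (\<exists>s. (\<forall>n. s n \<in> T) \<and> limitin (prod_topology (htop H) (htop H)) s p sequentially)"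
    unfolding P.mtopology_prod_metric .
  then show ?thesis by (simp add: limitin_pairwise o_def)
qed

end

section \<open>Realizations by total families\<close>

definition l2_total :: "'a measure \<Rightarrow> ('i \<Rightarrow> 'a \<Rightarrow> complex) \<Rightarrow> bool"
  where "l2_total M e \<longleftrightarrow> (\<forall>i. square_integrable M (e i)) \<and>
    (\<forall>f \<epsilon>. square_integrable M f \<longrightarrow> \<epsilon> > 0 \<longrightarrow>
      (\<exists>I c. finite I \<and> l2_sqnorm M (\<lambda>x. f x - (\<Sum>i\<in>I. c i * e i x)) < \<epsilon>))"

lemma l2_totalD:
  assumes "l2_total M e"
  shows "square_integrable M (e i)"
    "square_integrable M f \<Longrightarrow> \<epsilon> > 0 \<Longrightarrow>
      \<exists>I c. finite I \<and> l2_sqnorm M (\<lambda>x. f x - (\<Sum>i\<in>I. c i * e i x)) < \<epsilon>"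
  using assms by (auto simp: l2_total_def)

lemma l2_total_combination:
  "l2_total M e \<Longrightarrow> square_integrable M (\<lambda>x. \<Sum>i\<in>I. c i * e i x)"
  by (intro square_integrable_sum square_integrable_cmult l2_totalD)

lemma l2_total_tendsto:
  assumes e: "l2_total M e" and f: "square_integrable M f"
  shows "\<exists>I c. (\<forall>n. finite (I n)) \<and> l2_tendsto M (\<lambda>n x. \<Sum>i\<in>I n. c n i * e i x) f"
proof -
  have "\<exists>p. finite (fst p) \<and> l2_sqnorm M (\<lambda>x. f x - (\<Sum>i\<in>fst p. snd p i * e i x)) < inverse (real (Suc n))" for n
    using l2_totalD(2)[OF e f, of "inverse (real (Suc n))"] by auto
  then obtain p where fin: "\<And>n. finite (fst (p n))"
    and p: "\<And>n. l2_sqnorm M (\<lambda>x. f x - (\<Sum>i\<in>fst (p n). snd (p n) i * e i x)) < inverse (real (Suc n))" by metis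
  have "(\<lambda>n. l2_sqnorm M (\<lambda>x. (\<Sum>i\<in>fst (p n). snd (p n) i * e i x) - f x)) \<longlonglongrightarrow> 0"
  proof (rule Lim_null_comparison[OF always_eventually LIMSEQ_inverse_real_of_nat], intro allI)
    show "norm (l2_sqnorm M (\<lambda>x. (\<Sum>i\<in>fst (p n). snd (p n) i * e i x) - f x)) \<le> inverse (real (Suc n))" for n
      using p[of n] by (subst l2_sqnorm_diff_commute) (simp add: l2_sqnorm_nonneg)
  qed
  then have "l2_tendsto M (\<lambda>n x. \<Sum>i\<in>fst (p n). snd (p n) i * e i x) f"
    using l2_total_combination[OF e] f by (simp add: l2_tendsto_def)
  then show ?thesis using fin by (intro exI[of _ "\<lambda>n. fst (p n)"] exI[of _ "\<lambda>n. snd (p n)"]) simp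
qed

text \<open>The inner product of \<open>d\<close> with approximations of itself is 0.\<close>

lemma l2_total_orthogonal:
  assumes e: "l2_total M e" and d: "square_integrable M d" and orth: "\<And>i. l2_inner M d (e i) = 0"
  shows "AE x in M. d x = 0"
proof -
  obtain I c where lim: "l2_tendsto M (\<lambda>n x. \<Sum>i\<in>I n. c n i * e i x) d"
    using l2_total_tendsto[OF e d] by blast
  have "l2_inner M d (\<lambda>x. \<Sum>i\<in>I n. c n i * e i x) = 0" for n
  proof -
    have "l2_inner M d (\<lambda>x. \<Sum>i\<in>I n. c n i * e i x) = (\<Sum>i\<in>I n. l2_inner M d (\<lambda>x. c n i * e i x))"
      by (intro l2_inner_sum_right d square_integrable_cmult l2_totalD[OF e])
    then show ?thesis by (simp add: l2_inner_cmult_right orth)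
  qed
  then have "(\<lambda>n. 0) \<longlonglongrightarrow> l2_inner M d d"
    using l2_tendsto_inner[OF l2_tendsto_const[OF d] lim] by simp
  then have "l2_inner M d d = 0" by (simp add: LIMSEQ_const_iff)
  then show ?thesis using l2_sqnorm_eq_0_iff[OF d] by (simp add: l2_inner_self)
qed

lemma l2_inner_cong_AE:
  assumes "square_integrable M f" "square_integrable M f'" "square_integrable M g" "square_integrable M g'"
    "AE x in M. f x = f' x" "AE x in M. g x = g' x"
  shows "l2_inner M f g = l2_inner M f' g'"
  unfolding l2_inner_def
proof (rule integral_cong_AE)
  show "AE x in M. f x * cnj (g x) = f' x * cnj (g' x)" using assms(5,6) by eventually_elim simp
qed (use square_integrable_mult_cnj assms(1-4) in \<open>blast dest: borel_measurable_integrable\<close>)+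

text \<open>The square integrable functions modulo equality almost everywhere, realized as the space of
  their coefficients with respect to a total family.\<close>

lemma ex_l2_coefficient_space:
  fixes M :: "'m measure" and e :: "'i \<Rightarrow> 'm \<Rightarrow> complex"
  assumes fin: "finite_measure M" and e: "l2_total M e"
  shows "\<exists>(H :: ('i \<Rightarrow> complex) ip_space) W. l2_isometry H M W \<and>
    (\<forall>h\<in>points H. \<exists>f. square_integrable M f \<and> W f = h)"
proof -
  let ?S = "Collect (square_integrable M)"
  define V where "V f = (\<lambda>i. l2_inner M f (e i))" for f
  note e' = l2_totalD(1)[OF e]
  have V_add: "V (\<lambda>x. f x + g x) = V f + V g" if "f \<in> ?S" "g \<in> ?S" for f g
    using that e' by (auto simp: V_def l2_inner_add_left)
  have V_cmult: "V (\<lambda>x. c * f x) = (\<lambda>i. c * V f i)" for c f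
    by (simp add: V_def l2_inner_cmult_left)
  have V_zero: "V (\<lambda>_. 0) = 0" by (auto simp: V_def l2_inner_def)
  have V_eqD: "AE x in M. f x = g x" if fg: "f \<in> ?S" "g \<in> ?S" and eq: "V f = V g" for f g
  proof -
    have sq: "square_integrable M (\<lambda>x. f x - g x)" using fg by (auto intro: square_integrable_diff)
    have "l2_inner M (\<lambda>x. f x - g x) (e i) = 0" for i
      using fg e' fun_cong[OF eq, of i] by (simp add: V_def l2_inner_diff_left)
    from l2_total_orthogonal[OF e sq this] show ?thesis by simp
  qed
  \<comment> \<open>Coefficients determine a function almost everywhere, because the family is total; so representatives
    may be chosen arbitrarily in the inner product.\<close>
  define r where "r h = (SOME f. f \<in> ?S \<and> V f = h)" for h
  have r: "r (V f) \<in> ?S" "V (r (V f)) = V f" if "f \<in> ?S" for f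
    using someI_ex[of "\<lambda>g. g \<in> ?S \<and> V g = V f"] that unfolding r_def by blast+
  define H where "H = \<lparr>points = V ` ?S, smult = (\<lambda>c h i. c * h i), cip = (\<lambda>h k. l2_inner M (r h) (r k))\<rparr>"
  have pts: "points H = V ` ?S" and sm: "smult H = (\<lambda>c h i. c * h i)" by (simp_all add: H_def)
  have cipV: "cip H (V f) (V g) = l2_inner M f g" if "f \<in> ?S" "g \<in> ?S" for f g
    unfolding H_def using that r[OF that(1)] r[OF that(2)] V_eqD
    by (auto intro!: l2_inner_cong_AE)
  interpret V: vector_space "smult H"
    by unfold_locales (auto simp: sm algebra_simps)
  have ip: "complex_ip_space H"
  proof (intro complex_ip_space.intro V.vector_space_axioms complex_ip_space_axioms.intro)
    show "V.subspace (points H)"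
    proof (rule V.subspaceI)
      show "0 \<in> points H" unfolding pts using V_zero by (intro image_eqI[of _ _ "\<lambda>_. 0"]) auto
      fix h k assume "h \<in> points H" "k \<in> points H"
      then obtain f g where "f \<in> ?S" "g \<in> ?S" "h = V f" "k = V g" unfolding pts by blast
      then show "h + k \<in> points H"
        unfolding pts by (intro image_eqI[of _ _ "\<lambda>x. f x + g x"]) (auto simp: V_add intro: square_integrable_add)
    next
      fix c h assume "h \<in> points H"
      then obtain f where "f \<in> ?S" "h = V f" unfolding pts by blast
      then show "smult H c h \<in> points H"
        unfolding pts sm by (intro image_eqI[of _ _ "\<lambda>x. c * f x"]) (auto simp: V_cmult intro: square_integrable_cmult)
    qed
    fix h k assume hk: "h \<in> points H" "k \<in> points H"
    then obtain f g where f: "f \<in> ?S" "h = V f" and g: "g \<in> ?S" "k = V g" unfolding pts by blast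
    show "cip H h k = cnj (cip H k h)"
      unfolding f(2) g(2) cipV[OF f(1) g(1)] cipV[OF g(1) f(1)] by (rule l2_inner_commute)
    show "cip H (smult H c h) k = c * cip H h k" for c
    proof -
      have "(\<lambda>x. c * f x) \<in> ?S" using f(1) by (auto intro: square_integrable_cmult)
      moreover have "smult H c h = V (\<lambda>x. c * f x)" by (simp add: f(2) sm V_cmult)
      ultimately show ?thesis unfolding f(2) g(2) using f(1) g(1) by (simp add: cipV l2_inner_cmult_left)
    qed
    fix k' assume "k' \<in> points H"
    then obtain g' where g': "g' \<in> ?S" "k' = V g'" unfolding pts by blast
    have s: "(\<lambda>x. f x + g x) \<in> ?S" using f(1) g(1) by (auto intro: square_integrable_add)
    show "cip H (h + k) k' = cip H h k' + cip H k k'"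
      unfolding f(2) g(2) g'(2) V_add[OF f(1) g(1), symmetric] cipV[OF s g'(1)] cipV[OF f(1) g'(1)] cipV[OF g(1) g'(1)]
      using f(1) g(1) g'(1) by (simp add: l2_inner_add_left)
  next
    fix h assume "h \<in> points H"
    then obtain f where f: "f \<in> ?S" "h = V f" unfolding pts by blast
    show "0 \<le> Re (cip H h h)"
      unfolding f(2) cipV[OF f(1) f(1)] by (simp add: l2_inner_self l2_sqnorm_nonneg)
    assume "cip H h h = 0"
    then have "AE x in M. f x = 0"
      using f cipV[OF f(1) f(1)] l2_sqnorm_eq_0_iff[of M f] by (simp add: l2_inner_self)
    then have "l2_inner M f (e i) = l2_inner M (\<lambda>_. 0) (e i)" for i
      using f(1) e' by (intro l2_inner_cong_AE) auto
    then show "h = 0" using V_zero by (simp add: f(2) V_def fun_eq_iff)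
  qed
  have "l2_isometry H M V"
  proof (intro l2_isometry.intro ip l2_isometry_axioms.intro fin)
    show "V f \<in> points H" if "square_integrable M f" for f using that pts by blast
    show "cip H (V f) (V g) = l2_inner M f g" if "square_integrable M f" "square_integrable M g" for f g
      using that by (simp add: cipV)
  qed
  moreover have "\<forall>h\<in>points H. \<exists>f. square_integrable M f \<and> V f = h" unfolding pts by auto
  ultimately show ?thesis by blast
qed

context l2_isometry
begin

lemma W_combination:
  assumes "\<And>i. square_integrable M (e i)"
  shows "W (\<lambda>x. \<Sum>i\<in>I. c i * e i x) = (\<Sum>i\<in>I. smult H (c i) (W (e i)))"
  by (subst W_sum) (auto intro: square_integrable_cmult assms simp: W_smult[OF assms])

lemma span_dense_if_surj:
  assumes e: "l2_total M e" and surj: "\<And>h. h \<in> points H \<Longrightarrow> \<exists>f. square_integrable M f \<and> W f = h"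
  shows "htop H closure_of (span (range (\<lambda>i. W (e i)))) = points H"
proof
  show "htop H closure_of (span (range (\<lambda>i. W (e i)))) \<subseteq> points H"
    by (metis closure_of_subset_topspace topspace_mtopology)
  note e' = l2_totalD(1)[OF e]
  have sub: "span (range (\<lambda>i. W (e i))) \<subseteq> points H"
    by (rule span_minimal[OF _ subspace_points]) (auto simp: e')
  show "points H \<subseteq> htop H closure_of (span (range (\<lambda>i. W (e i))))"
  proof
    fix h assume "h \<in> points H"
    then obtain f where f: "square_integrable M f" "W f = h" using surj by blast
    obtain I c where lim: "l2_tendsto M (\<lambda>n x. \<Sum>i\<in>I n. c n i * e i x) f"
      using l2_total_tendsto[OF e f(1)] by blast
    show "h \<in> htop H closure_of (span (range (\<lambda>i. W (e i))))"
    proof (rule in_closure_ofI[OF _ sub])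
      show "limitin (htop H) (\<lambda>n. W (\<lambda>x. \<Sum>i\<in>I n. c n i * e i x)) h sequentially"
        using W_tendsto[OF lim] f(2) by simp
      show "W (\<lambda>x. \<Sum>i\<in>I n. c n i * e i x) \<in> span (range (\<lambda>i. W (e i)))" for n
        unfolding W_combination[OF e'] by (intro span_sum span_scale span_base) auto
    qed
  qed
qed

text \<open>The range is a subspace containing the family, and it is closed by completeness.\<close>

lemma surj_if_span_dense:
  assumes e: "\<And>i. square_integrable M (e i)"
    and dense: "htop H closure_of (span (range (\<lambda>i. W (e i)))) = points H" and h: "h \<in> points H"
  shows "\<exists>f. square_integrable M f \<and> W f = h"
proof -
  let ?R = "{h. \<exists>f. square_integrable M f \<and> W f = h}"
  have "subspace ?R"
  proof (rule subspaceI)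
    show "0 \<in> ?R" using W_zero by (auto intro!: exI[of _ "\<lambda>_. 0"])
    show "a + b \<in> ?R" if "a \<in> ?R" "b \<in> ?R" for a b
      using that W_add square_integrable_add by blast
    show "smult H c a \<in> ?R" if "a \<in> ?R" for c a
      using that W_smult square_integrable_cmult by blast
  qed
  then have sp: "span (range (\<lambda>i. W (e i))) \<subseteq> ?R" using e by (intro span_minimal) auto
  have sub: "span (range (\<lambda>i. W (e i))) \<subseteq> points H"
    by (rule span_minimal[OF _ subspace_points]) (auto simp: e)
  obtain s where s: "\<forall>n. s n \<in> span (range (\<lambda>i. W (e i)))" "limitin (htop H) s h sequentially"
    using in_closure_of_seq[OF sub, of h] h unfolding dense by blast
  have "\<exists>f. square_integrable M f \<and> W f = s n" for n using s(1) sp by blast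
  then obtain f where f: "\<And>n. square_integrable M (f n)" "\<And>n. W (f n) = s n" by metis
  show ?thesis by (rule W_range_closed[of f, OF f(1)]) (simp add: f(2) s(2))
qed

end

section \<open>Shift operators as multiplication operators\<close>

lemma (in module) combination_union:
  assumes "finite I" "finite J"
  shows "(\<Sum>i\<in>I. scale (c i) (x i)) + (\<Sum>i\<in>J. scale (d i) (x i)) =
    (\<Sum>i\<in>I \<union> J. scale ((if i \<in> I then c i else 0) + (if i \<in> J then d i else 0)) (x i))"
proof -
  have 1: "(\<Sum>i\<in>I. scale (c i) (x i)) = (\<Sum>i\<in>I \<union> J. scale (if i \<in> I then c i else 0) (x i))"
    using assms by (intro sum.mono_neutral_cong_left) auto
  have 2: "(\<Sum>i\<in>J. scale (d i) (x i)) = (\<Sum>i\<in>I \<union> J. scale (if i \<in> J then d i else 0) (x i))"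
    using assms by (intro sum.mono_neutral_cong_left) auto
  show ?thesis unfolding 1 2 by (simp add: scale_left_distrib sum.distrib)
qed

lemma (in complex_ip_space) linear_operator_shift:
  assumes x: "\<And>i. x i \<in> points H" and sv: "single_valued (shift_operator H x \<sigma>)"
  shows "linear_operator H (shift_operator H x \<sigma>)"
  unfolding linear_operator_def
proof (intro conjI sv)
  let ?T = "shift_operator H x \<sigma>"
  show "?T \<subseteq> points H \<times> points H" 
    unfolding shift_operator_def by (auto intro!: points_sum points_simps(4) x simp del: split_paired_All)
  show "(0, 0) \<in> ?T" unfolding shift_operator_def by (auto intro!: exI[of _ "{}"])
  show "\<forall>(h, g)\<in>?T. \<forall>(h', g')\<in>?T. (h + h', g + g') \<in> ?T"
  proof (clarify)
    fix h g h' g' assume "(h, g) \<in> ?T" "(h', g') \<in> ?T"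
    then obtain I c J d where "finite I" "h = (\<Sum>i\<in>I. smult H (c i) (x i))" "g = (\<Sum>i\<in>I. smult H (c i) (x (\<sigma> i)))"
      "finite J" "h' = (\<Sum>i\<in>J. smult H (d i) (x i))" "g' = (\<Sum>i\<in>J. smult H (d i) (x (\<sigma> i)))"
      unfolding shift_operator_def by blast
    then show "(h + h', g + g') \<in> ?T"
      unfolding shift_operator_def
      by (auto simp: combination_union intro!: exI[of _ "I \<union> J"]
          exI[of _ "\<lambda>i. (if i \<in> I then c i else 0) + (if i \<in> J then d i else 0)"])
  qed
  show "\<forall>c. \<forall>(h, g)\<in>?T. (smult H c h, smult H c g) \<in> ?T"
  proof (clarify)
    fix a h g assume "(h, g) \<in> ?T"
    then obtain I c where "finite I" "h = (\<Sum>i\<in>I. smult H (c i) (x i))" "g = (\<Sum>i\<in>I. smult H (c i) (x (\<sigma> i)))"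
      unfolding shift_operator_def by blast
    then show "(smult H a h, smult H a g) \<in> ?T"
      unfolding shift_operator_def
      by (auto simp: scale_sum_right intro!: exI[of _ I] exI[of _ "\<lambda>i. a * c i"])
  qed
qed

context l2_model
begin

lemma shift_operator_subset:
  assumes e: "\<And>i. square_integrable M (e i)" and shift: "\<And>i p. e (\<sigma> i) p = of_real (\<phi> p) * e i p"
  shows "shift_operator H (\<lambda>i. W (e i)) \<sigma> \<subseteq> mult_op \<phi>"
proof
  fix p assume "p \<in> shift_operator H (\<lambda>i. W (e i)) \<sigma>"
  then obtain I c where p: "p = ((\<Sum>i\<in>I. smult H (c i) (W (e i))), (\<Sum>i\<in>I. smult H (c i) (W (e (\<sigma> i)))))"
    by (auto simp: shift_operator_def)
  have eq: "(\<lambda>p. \<Sum>i\<in>I. c i * e (\<sigma> i) p) = (\<lambda>p. of_real (\<phi> p) * (\<Sum>i\<in>I. c i * e i p))"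
    by (simp add: shift sum_distrib_left mult.left_commute)
  have sq: "square_integrable M (\<lambda>p. \<Sum>i\<in>I. c i * e i p)" "square_integrable M (\<lambda>p. \<Sum>i\<in>I. c i * e (\<sigma> i) p)"
    by (intro square_integrable_sum square_integrable_cmult e)+
  have "p = (W (\<lambda>p. \<Sum>i\<in>I. c i * e i p), W (\<lambda>p. \<Sum>i\<in>I. c i * e (\<sigma> i) p))"
    by (simp add: p W_combination[of e, OF e] W_combination[of "\<lambda>i. e (\<sigma> i)", OF e])
  then show "p \<in> mult_op \<phi>" using mult_opI[OF sq(1)] sq(2) unfolding eq by simp
qed

text \<open>Essential self-adjointness: for \<open>f\<close> in the domain of multiplication by \<open>\<phi>\<close>, approximate
  \<open>(\<phi> + i) f\<close> by combinations of the total family.  Division by \<open>\<phi> + i\<close> does not leave their span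
  and is contractive, also after multiplication by \<open>\<phi>\<close>.\<close>

lemma op_closure_shift_operator:
  assumes e: "l2_total M e" and \<phi>: "\<phi> \<in> borel_measurable borel"
    and shift: "\<And>i p. e (\<sigma> i) p = of_real (\<phi> p) * e i p"
    and resolvent: "\<And>i p. (of_real (\<phi> p) + \<i>) * e (\<tau> i) p = e i p" and inj: "inj \<tau>"
  shows "op_closure H (shift_operator H (\<lambda>i. W (e i)) \<sigma>) = mult_op \<phi>"
proof
  let ?T = "shift_operator H (\<lambda>i. W (e i)) \<sigma>"
  note e' = l2_totalD(1)[OF e]
  note sub = shift_operator_subset[of e \<sigma> \<phi>, OF e' shift]
  have Tp: "?T \<subseteq> points H \<times> points H" using sub mult_op_subset by blast
  show "op_closure H ?T \<subseteq> mult_op \<phi>"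
  proof
    fix p assume "p \<in> op_closure H ?T"
    then obtain s where s: "\<forall>n. s n \<in> ?T" "limitin (htop H) (\<lambda>n. fst (s n)) (fst p) sequentially"
      "limitin (htop H) (\<lambda>n. snd (s n)) (snd p) sequentially"
      unfolding op_closure_iff[OF Tp] by blast
    have "(fst p, snd p) \<in> adjoint_op H (mult_op \<phi>)"
      by (rule adjoint_op_closed[OF mult_op_subset _ s(2,3)]) (use s(1) sub in \<open>auto simp: adjoint_mult_op[OF \<phi>]\<close>)
    then show "p \<in> mult_op \<phi>" by (simp add: adjoint_mult_op[OF \<phi>])
  qed
  show "mult_op \<phi> \<subseteq> op_closure H ?T"
  proof
    fix p assume "p \<in> mult_op \<phi>"
    then obtain f where f: "square_integrable M f" and \<phi>f: "square_integrable M (\<lambda>x. of_real (\<phi> x) * f x)"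
      and p: "p = (W f, W (\<lambda>x. of_real (\<phi> x) * f x))" by (rule mult_opE)
    let ?g = "\<lambda>x. of_real (\<phi> x) * f x + \<i> * f x"
    have g: "square_integrable M ?g" by (intro square_integrable_add \<phi>f square_integrable_cmult f)
    obtain I c where fin: "\<forall>n. finite (I n)" and lim: "l2_tendsto M (\<lambda>n x. \<Sum>i\<in>I n. c n i * e i x) ?g"
      using l2_total_tendsto[OF e g] by blast
    let ?P = "\<lambda>n x. \<Sum>i\<in>I n. c n i * e i x"
    let ?q = "\<lambda>n x. \<Sum>i\<in>I n. c n i * e (\<tau> i) x"
    have qP: "(of_real (\<phi> x) + \<i>) * ?q n x = ?P n x" for n x
      by (simp add: sum_distrib_left mult.left_commute resolvent)
    have q: "square_integrable M (?q n)" for n by (intro square_integrable_sum square_integrable_cmult e')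
    have \<phi>q_eq: "of_real (\<phi> x) * ?q n x = (\<Sum>i\<in>I n. c n i * e (\<sigma> (\<tau> i)) x)" for n x
      by (simp add: sum_distrib_left mult.left_commute shift)
    have \<phi>q: "square_integrable M (\<lambda>x. of_real (\<phi> x) * ?q n x)" for n
      unfolding \<phi>q_eq by (intro square_integrable_sum square_integrable_cmult e')
    have diff: "(of_real (\<phi> x) + \<i>) * (?q n x - f x) = ?P n x - ?g x" for n x
      unfolding right_diff_distrib qP by (simp add: distrib_right)
    have ge: "1 \<le> cmod (of_real (\<phi> x) + \<i>)" "\<bar>\<phi> x\<bar> \<le> cmod (of_real (\<phi> x) + \<i>)" for x
      using abs_Im_le_cmod[of "of_real (\<phi> x) + \<i>"] abs_Re_le_cmod[of "of_real (\<phi> x) + \<i>"] by auto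
    have Pg: "square_integrable M (\<lambda>x. ?P n x - ?g x)" for n
      by (intro square_integrable_diff l2_total_combination[OF e] g)
    have le1: "l2_sqnorm M (\<lambda>x. ?q n x - f x) \<le> l2_sqnorm M (\<lambda>x. ?P n x - ?g x)" for n
    proof (rule l2_sqnorm_mono[OF Pg])
      show "(\<lambda>x. ?q n x - f x) \<in> borel_measurable M" by (intro square_integrable_measurable square_integrable_diff q f)
      show "cmod (?q n x - f x) \<le> cmod (?P n x - ?g x)" for x
        unfolding diff[symmetric] norm_mult using mult_right_mono[OF ge(1)[of x] norm_ge_zero[of "?q n x - f x"]] by simp
    qed
    have le2: "l2_sqnorm M (\<lambda>x. of_real (\<phi> x) * ?q n x - of_real (\<phi> x) * f x) \<le> l2_sqnorm M (\<lambda>x. ?P n x - ?g x)" for n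
    proof (rule l2_sqnorm_mono[OF Pg])
      show "(\<lambda>x. of_real (\<phi> x) * ?q n x - of_real (\<phi> x) * f x) \<in> borel_measurable M"
        by (intro square_integrable_measurable square_integrable_diff \<phi>q \<phi>f)
      show "cmod (of_real (\<phi> x) * ?q n x - of_real (\<phi> x) * f x) \<le> cmod (?P n x - ?g x)" for x
        unfolding diff[symmetric] right_diff_distrib[symmetric] norm_mult
        using mult_right_mono[OF ge(2)[of x] norm_ge_zero[of "?q n x - f x"]] by simp
    qed
    have "(\<lambda>n. l2_sqnorm M (\<lambda>x. ?q n x - f x)) \<longlonglongrightarrow> 0"
      by (rule Lim_null_comparison[OF always_eventually l2_tendstoD(3)[OF lim]])
         (use le1 in \<open>simp add: l2_sqnorm_nonneg\<close>)
    then have 1: "l2_tendsto M ?q f" using q f by (simp add: l2_tendsto_def)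
    have "(\<lambda>n. l2_sqnorm M (\<lambda>x. of_real (\<phi> x) * ?q n x - of_real (\<phi> x) * f x)) \<longlonglongrightarrow> 0"
      by (rule Lim_null_comparison[OF always_eventually l2_tendstoD(3)[OF lim]])
         (use le2 in \<open>simp add: l2_sqnorm_nonneg\<close>)
    then have 2: "l2_tendsto M (\<lambda>n x. of_real (\<phi> x) * ?q n x) (\<lambda>x. of_real (\<phi> x) * f x)"
      using \<phi>q \<phi>f by (simp add: l2_tendsto_def)
    have "(W (?q n), W (\<lambda>x. of_real (\<phi> x) * ?q n x)) \<in> ?T" for n
    proof -
      have injI: "inj_on \<tau> (I n)" using inj by (rule inj_on_subset) simp
      \<comment> \<open>Reindex by \<open>\<tau>\<close> to exhibit the pair as an element of the shift operator.\<close>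
      let ?d = "\<lambda>j. c n (inv \<tau> j)"
      have "W (?q n) = (\<Sum>j\<in>\<tau> ` I n. smult H (?d j) (W (e j)))"
        unfolding W_combination[of "\<lambda>i. e (\<tau> i)", OF e'] by (simp add: sum.reindex[OF injI] inv_f_f[OF inj])
      moreover have "W (\<lambda>x. of_real (\<phi> x) * ?q n x) = (\<Sum>j\<in>\<tau> ` I n. smult H (?d j) (W (e (\<sigma> j))))"
        unfolding \<phi>q_eq W_combination[of "\<lambda>i. e (\<sigma> (\<tau> i))", OF e'] by (simp add: sum.reindex[OF injI] inv_f_f[OF inj])
      moreover have "finite (\<tau> ` I n)" using fin by simp
      ultimately show ?thesis
        unfolding shift_operator_def mem_Collect_eq by (intro exI[of _ "\<tau> ` I n"] exI[of _ ?d] conjI) simp_all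
    qed
    then show "p \<in> op_closure H ?T"
      unfolding op_closure_iff[OF Tp] p
      using W_tendsto[OF 1] W_tendsto[OF 2]
      by (intro exI[of _ "\<lambda>n. (W (?q n), W (\<lambda>x. of_real (\<phi> x) * ?q n x))"]) simp
  qed
qed

end

section \<open>Models of a moment sequence\<close>

lemma solves_moment_problemD:
  assumes "solves_moment_problem u \<mu>"
  shows "sets \<mu> = sets borel" "has_bochner_integral \<mu> (moment_fun i) (u i)"
  using assms unfolding solves_moment_problem_iff by blast+

text \<open>Already the characters of the Cayley transform, which are moment functions, are total.\<close>

lemma moment_fun_total:
  assumes "solves_moment_problem u \<mu>"
  shows "l2_total \<mu> moment_fun"
  unfolding l2_total_def
proof (intro conjI allI impI)
  note s = solves_moment_problemD[OF assms]
  show "square_integrable \<mu> (moment_fun i)" for i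
    by (rule solution_square_integrable[OF s])
  fix f and \<epsilon> :: real assume f: "square_integrable \<mu> f" and \<epsilon>: "\<epsilon> > 0"
  interpret T: torus_map \<mu> plane_to_torus
    by (rule torus_map_plane[OF solution_finite_measure[OF assms] s(1)])
  obtain I a where I: "finite I" "l2_sqnorm \<mu> (\<lambda>x. f x - (\<Sum>p\<in>I. a p * character p (plane_to_torus x))) < \<epsilon>"
    using T.approximableD[OF T.square_integrable_approximable[OF f] \<epsilon>] .
  define h :: "int \<times> int \<Rightarrow> idx" where "h p = (0, - fst p, fst p, 0, - snd p, snd p)" for p
  have inj: "inj h" by (auto simp: inj_def h_def prod_eq_iff)
  have "(\<Sum>p\<in>I. a p * character p (plane_to_torus x)) = (\<Sum>i\<in>h ` I. a (inv h i) * moment_fun i x)" for x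
    unfolding character_plane_to_torus
    by (simp add: sum.reindex[OF inj_on_subset[OF inj subset_UNIV]] inv_f_f[OF inj] h_def[symmetric])
  then show "\<exists>I c. finite I \<and> l2_sqnorm \<mu> (\<lambda>x. f x - (\<Sum>i\<in>I. c i * moment_fun i x)) < \<epsilon>"
    using I by (intro exI[of _ "h ` I"] exI[of _ "\<lambda>i. a (inv h i)"]) simp
qed

lemma moment_model_iff:
  "moment_model u H x \<longleftrightarrow> complex_hilbert_space H \<and> separable_space (htop H) \<and>
    range x \<subseteq> points H \<and> htop H closure_of (module.span (smult H) (range x)) = points H \<and>
    (\<forall>i j. cip H (x i) (x j) = u (gram_index i j))"
  unfolding moment_model_def gram_index_def by (simp add: split_paired_all)

text \<open>Represent each square integrable function by its inner products with the moment functions.\<close>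

theorem moment_model_exists:
  assumes "solves_moment_problem u \<mu>"
  shows "\<exists>(H :: (idx \<Rightarrow> complex) ip_space) x. moment_model u H x"
proof -
  note s = solves_moment_problemD[OF assms]
  note tot = moment_fun_total[OF assms]
  note e = l2_totalD(1)[OF tot]
  obtain H :: "(idx \<Rightarrow> complex) ip_space" and W where W: "l2_isometry H \<mu> W"
    and surj: "\<forall>h\<in>points H. \<exists>f. square_integrable \<mu> f \<and> W f = h"
    using ex_l2_coefficient_space[OF solution_finite_measure[OF assms] tot] by blast
  interpret W: l2_isometry H \<mu> W by fact
  have "complex_hilbert_space H"
    using W.mcomplete_if_surj surj
    by (intro complex_hilbert_space.intro W.complex_ip_space_axioms complex_hilbert_space_axioms.intro) blast
  moreover have sub: "range (\<lambda>i. W (moment_fun i)) \<subseteq> points H" using e by auto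
  moreover have dense: "htop H closure_of (W.span (range (\<lambda>i. W (moment_fun i)))) = points H"
    using W.span_dense_if_surj[OF tot] surj by blast
  moreover have "separable_space (htop H)" by (rule W.separable_if_span_dense[OF sub dense])
  moreover have "cip H (W (moment_fun i)) (W (moment_fun j)) = u (gram_index i j)" for i j
    by (simp add: W.W_inner e solution_inner[OF s(2)])
  ultimately have "moment_model u H (\<lambda>i. W (moment_fun i))"
    unfolding moment_model_iff by blast
  then show ?thesis by blast
qed

text \<open>Every model is unitarily equivalent to the square integrable functions, its vectors corresponding
  to the moment functions, because the Gram matrices agree and both families are total.\<close>

lemma moment_model_l2_model:
  assumes "solves_moment_problem u \<mu>" and model: "moment_model u H x"
  shows "\<exists>W. l2_model H \<mu> W \<and> (\<forall>i. W (moment_fun i) = x i)"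
proof -
  note s = solves_moment_problemD[OF assms(1)] and m = model[unfolded moment_model_iff]
  note tot = moment_fun_total[OF assms(1)]
  interpret complex_hilbert_space H using m by blast
  have "\<exists>W. l2_isometry H \<mu> W \<and> (\<forall>i. W (moment_fun i) = x i)"
  proof (rule ex_l2_isometry[OF solution_finite_measure[OF assms(1)] l2_totalD(1)[OF tot]])
    show "x i \<in> points H" for i using m by blast
    show "cip H (x i) (x j) = l2_inner \<mu> (moment_fun i) (moment_fun j)" for i j
      unfolding solution_inner[OF s(2)] using m by blast
    show "\<exists>I c. finite I \<and> l2_sqnorm \<mu> (\<lambda>x. f x - (\<Sum>i\<in>I. c i * moment_fun i x)) < \<epsilon>"
      if "square_integrable \<mu> f" "\<epsilon> > 0" for f \<epsilon> by (rule l2_totalD(2)[OF tot that])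
  qed
  then obtain W where W: "l2_isometry H \<mu> W" and Wx: "\<forall>i. W (moment_fun i) = x i" by blast
  interpret W: l2_isometry H \<mu> W by fact
  have "htop H closure_of (span (range (\<lambda>i. W (moment_fun i)))) = points H"
  proof -
    have x: "(\<lambda>i. W (moment_fun i)) = x" using Wx by blast
    show ?thesis unfolding x using m by blast
  qed
  then have "l2_model H \<mu> W"
    by (intro l2_model.intro W l2_model_axioms.intro s(1) W.surj_if_span_dense[of moment_fun, OF l2_totalD(1)[OF tot]])
  then show ?thesis using Wx by blast
qed

section \<open>Spectral measures of the model operators\<close>

context complex_ip_space
begin

lemma spectral_measureD:
  assumes E: "spectral_measure H E" and \<Delta>: "\<Delta> \<in> sets borel" and h: "h \<in> points H"
  shows "E \<Delta> h \<in> points H" "k \<in> points H \<Longrightarrow> E \<Delta> (h + k) = E \<Delta> h + E \<Delta> k"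
    "E \<Delta> (smult H c h) = smult H c (E \<Delta> h)" "k \<in> points H \<Longrightarrow> cip H (E \<Delta> h) k = cip H h (E \<Delta> k)"
    "\<Delta>' \<in> sets borel \<Longrightarrow> E \<Delta> (E \<Delta>' h) = E (\<Delta> \<inter> \<Delta>') h" "E UNIV h = h"
proof -
  have P: "orth_projection H (E \<Delta>)" using E \<Delta> unfolding spectral_measure_def by blast
  show "E \<Delta> h \<in> points H" "k \<in> points H \<Longrightarrow> E \<Delta> (h + k) = E \<Delta> h + E \<Delta> k"
    "E \<Delta> (smult H c h) = smult H c (E \<Delta> h)" "k \<in> points H \<Longrightarrow> cip H (E \<Delta> h) k = cip H h (E \<Delta> k)"
    using P h unfolding orth_projection_def by blast+
  show "\<Delta>' \<in> sets borel \<Longrightarrow> E \<Delta> (E \<Delta>' h) = E (\<Delta> \<inter> \<Delta>') h" "E UNIV h = h"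
    using E \<Delta> h unfolding spectral_measure_def by metis+
qed

lemma spectral_measure_cip_self:
  assumes E: "spectral_measure H E" and \<Delta>: "\<Delta> \<in> sets borel" and h: "h \<in> points H"
  shows "cip H (E \<Delta> h) h = of_real ((nrm H (E \<Delta> h))\<^sup>2)"
proof -
  note D = spectral_measureD[OF E \<Delta> h]
  have "cip H (E \<Delta> h) h = cip H (E \<Delta> (E \<Delta> h)) h" using D(5)[OF \<Delta>] by simp
  also have "\<dots> = cip H (E \<Delta> h) (E \<Delta> h)" by (rule spectral_measureD(4)[OF E \<Delta> D(1) h])
  finally show ?thesis by (simp add: cip_self[OF D(1)])
qed

lemma spectral_measure_contraction:
  assumes E: "spectral_measure H E" and \<Delta>: "\<Delta> \<in> sets borel" and h: "h \<in> points H"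
  shows "nrm H (E \<Delta> h) \<le> nrm H h"
proof -
  note p = spectral_measureD(1)[OF E \<Delta> h]
  have "(nrm H (E \<Delta> h))\<^sup>2 \<le> nrm H (E \<Delta> h) * nrm H h"
    using Re_cip_le_nrm[OF p h] by (simp add: spectral_measure_cip_self[OF E \<Delta> h])
  then show ?thesis
    using nrm_nonneg[OF p] nrm_nonneg[OF h]
    by (cases "nrm H (E \<Delta> h) = 0") (auto simp: power2_eq_square)
qed

lemma spectral_measure_tendsto:
  assumes E: "spectral_measure H E" and \<Delta>: "\<Delta> \<in> sets borel"
    and s: "\<And>n. s n \<in> points H" "limitin (htop H) s h sequentially"
  shows "limitin (htop H) (\<lambda>n. E \<Delta> (s n)) (E \<Delta> h) sequentially"
proof -
  have h: "h \<in> points H" using s(2) by (rule limitin_points)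
  note p = spectral_measureD(1)[OF E \<Delta>]
  have 0: "(\<lambda>n. nrm H (s n - h)) \<longlonglongrightarrow> 0" using limitin_iff_nrm[of s h, OF s(1) h] s(2) by blast
  have "(\<lambda>n. nrm H (E \<Delta> (s n) - E \<Delta> h)) \<longlonglongrightarrow> 0"
  proof (rule Lim_null_comparison[OF always_eventually 0], intro allI)
    fix n
    have "E \<Delta> (s n) = E \<Delta> (s n - h) + E \<Delta> h"
      using spectral_measureD(2)[OF E \<Delta> points_simps(3)[OF s(1) h] h, of n] by simp
    then have "nrm H (E \<Delta> (s n) - E \<Delta> h) \<le> nrm H (s n - h)"
      using spectral_measure_contraction[OF E \<Delta> points_simps(3)[OF s(1) h], of n] by simp
    then show "norm (nrm H (E \<Delta> (s n) - E \<Delta> h)) \<le> nrm H (s n - h)"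
      using nrm_nonneg[OF points_simps(3)[OF p[OF s(1)] p[OF h]], of n] by simp
  qed
  then show ?thesis using limitin_iff_nrm[of "\<lambda>n. E \<Delta> (s n)" "E \<Delta> h", OF p[OF s(1)] p[OF h]] by blast
qed

lemma sets_scalar_measure: "sets (scalar_measure H E h) = sets borel"
  using sets.sigma_sets_eq[of "borel :: (real \<times> real) measure"] by (simp add: scalar_measure_def)

lemma emeasure_scalar_measure:
  assumes E: "spectral_measure H E" and h: "h \<in> points H" and \<Delta>: "\<Delta> \<in> sets borel"
  shows "emeasure (scalar_measure H E h) \<Delta> = ennreal ((nrm H (E \<Delta> h))\<^sup>2)"
proof -
  have eq: "ennreal (Re (cip H (E \<Delta> h) h)) = ennreal ((nrm H (E \<Delta> h))\<^sup>2)" if "\<Delta> \<in> sets borel" for \<Delta>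
    by (simp add: spectral_measure_cip_self[OF E that h])
  have "emeasure (scalar_measure H E h) \<Delta> = ennreal (Re (cip H (E \<Delta> h) h))"
  proof (rule emeasure_measure_of[OF scalar_measure_def])
    \<comment> \<open>Adding one more empty set to a disjoint union leaves its value unchanged.\<close>
    have E0: "E {} h = 0"
    proof -
      have "(\<Union>j :: nat. {} :: (real \<times> real) set) = {}" by simp
      then have "limitin (htop H) (\<lambda>n. \<Sum>j<n. E {} h) (E {} h) sequentially"
        using E h unfolding spectral_measure_def by (elim conjE) (drule spec[of _ "\<lambda>_ :: nat. {}"], auto simp: disjoint_family_on_def)
      then have "limitin (htop H) (\<lambda>n. \<Sum>j<Suc n. E {} h) (E {} h) sequentially"
        by (rule limitin_sequentially_offset[where k = 1, simplified])
      moreover have p: "E {} h \<in> points H" using spectral_measureD(1)[OF E _ h] by simp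
      ultimately have "limitin (htop H) (\<lambda>n. (\<Sum>j<n. E {} h) + E {} h) (E {} h) sequentially"
        by (simp add: add.commute)
      moreover have "limitin (htop H) (\<lambda>n. (\<Sum>j<n. E {} h) + E {} h) (E {} h + E {} h) sequentially"
        by (intro limitin_add) (use p \<open>limitin (htop H) (\<lambda>n. \<Sum>j<n. E {} h) (E {} h) sequentially\<close> in \<open>auto simp: limitin_const_iff\<close>)
      ultimately have "E {} h = E {} h + E {} h" by (rule limitin_metric_unique) simp
      then show ?thesis by simp
    qed
    show "positive (sets (scalar_measure H E h)) (\<lambda>\<Delta>. ennreal (Re (cip H (E \<Delta> h) h)))"
      using E0 h by (simp add: positive_def)
    show "countably_additive (sets (scalar_measure H E h)) (\<lambda>\<Delta>. ennreal (Re (cip H (E \<Delta> h) h)))"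
      unfolding countably_additive_def
    proof (intro allI impI)
      fix D :: "nat \<Rightarrow> (real \<times> real) set"
      assume "range D \<subseteq> sets (scalar_measure H E h)" "disjoint_family D"
      then have D: "range D \<subseteq> sets borel" "disjoint_family D"
        by (simp_all only: sets_scalar_measure)
      then have Db: "D j \<in> sets borel" for j by auto
      have "limitin (htop H) (\<lambda>n. \<Sum>j<n. E (D j) h) (E (\<Union>j. D j) h) sequentially"
        using E D h unfolding spectral_measure_def by blast
      then have "(\<lambda>n. cip H (\<Sum>j<n. E (D j) h) h) \<longlonglongrightarrow> cip H (E (\<Union>j. D j) h) h"
        using spectral_measureD(1)[OF E Db h] h by (intro cip_tendsto) (auto simp: limitin_const_iff)
      then have "(\<lambda>n. \<Sum>j<n. cip H (E (D j) h) h) \<longlonglongrightarrow> cip H (E (\<Union>j. D j) h) h"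
        using spectral_measureD(1)[OF E Db h] h by (simp add: cip_sum_left)
      then have "(\<lambda>n. Re (\<Sum>j<n. cip H (E (D j) h) h)) \<longlonglongrightarrow> Re (cip H (E (\<Union>j. D j) h) h)"
        by (rule tendsto_Re)
      then have "(\<lambda>j. Re (cip H (E (D j) h) h)) sums Re (cip H (E (\<Union>j. D j) h) h)"
        by (simp add: sums_def)
      then show "(\<Sum>j. ennreal (Re (cip H (E (D j) h) h))) = ennreal (Re (cip H (E (\<Union> (range D)) h) h))"
        by (intro suminf_ennreal_eq) (auto simp: spectral_measure_cip_self[OF E Db h])
    qed
  qed (use \<Delta> in \<open>auto simp: scalar_measure_def\<close>)
  then show ?thesis using eq[OF \<Delta>] by simp
qed

lemma finite_scalar_measure:
  assumes "spectral_measure H E" "h \<in> points H"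
  shows "finite_measure (scalar_measure H E h)"
  by (rule finite_measureI)
     (use emeasure_scalar_measure[OF assms, of UNIV] sets_eq_imp_space_eq[OF sets_scalar_measure[of E h]] in simp)

lemma measure_scalar_measure:
  assumes "spectral_measure H E" "h \<in> points H" "\<Delta> \<in> sets borel"
  shows "complex_of_real (measure (scalar_measure H E h) \<Delta>) = cip H (E \<Delta> h) h"
  by (simp add: measure_def emeasure_scalar_measure[OF assms] spectral_measure_cip_self[OF assms(1,3,2)])

end

text \<open>Simple functions are combinations of indicators of their level sets.\<close>

lemma l2_total_indicators:
  fixes M :: "'a measure"
  assumes fin: "finite_measure M"
  shows "l2_total M (\<lambda>\<Delta> x. if \<Delta> \<in> sets M then indicator \<Delta> x else 0)"
  unfolding l2_total_def
proof (intro conjI allI impI)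
  let ?e = "\<lambda>\<Delta> x. if \<Delta> \<in> sets M then indicator \<Delta> x else 0 :: complex"
  have e: "square_integrable M (?e \<Delta>)" for \<Delta>
    by (rule square_integrable_bounded[OF fin, where C = 1]) (cases "\<Delta> \<in> sets M"; simp add: indicator_def)+
  then show "square_integrable M (?e \<Delta>)" for \<Delta> .
  fix f :: "'a \<Rightarrow> complex" and \<epsilon> :: real assume f: "square_integrable M f" and \<epsilon>: "\<epsilon> > 0"
  obtain s where s: "\<And>i. simple_function M (s i)" "\<And>x. x \<in> space M \<Longrightarrow> (\<lambda>i. s i x) \<longlonglongrightarrow> f x"
     "\<And>i x. x \<in> space M \<Longrightarrow> dist (s i x) 0 \<le> 2 * dist (f x) 0"
    using borel_measurable_implies_sequence_metric[OF square_integrable_measurable[OF f], of 0] by simp metis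
  have "l2_tendsto M s f"
    by (rule l2_tendsto_dominated[OF _ _ f, where C = 2])
       (use s square_integrable_measurable[OF f] in \<open>auto intro: borel_measurable_simple_function\<close>)
  from order_tendstoD(2)[OF l2_tendstoD(3)[OF this] \<epsilon>]
  obtain n where n: "l2_sqnorm M (\<lambda>x. s n x - f x) < \<epsilon>"
    using eventually_happens'[OF sequentially_bot] by blast
  define P where "P y = s n -` {y} \<inter> space M" for y
  have fin: "finite (s n ` space M)" and P: "P y \<in> sets M" for y
    using simple_functionD[OF s(1)] by (auto simp: P_def)
  have inj: "inj_on P (s n ` space M)"
  proof (rule inj_onI)
    fix y z assume "y \<in> s n ` space M" "P y = P z"
    then obtain x where "x \<in> space M" "y = s n x" "x \<in> P z" by (auto simp: P_def)
    then show "y = z" by (auto simp: P_def)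
  qed
  have sn: "s n x = (\<Sum>\<Delta>\<in>P ` s n ` space M. inv_into (s n ` space M) P \<Delta> * ?e \<Delta> x)" if x: "x \<in> space M" for x
  proof -
    have "(\<Sum>\<Delta>\<in>P ` s n ` space M. inv_into (s n ` space M) P \<Delta> * ?e \<Delta> x) = (\<Sum>y\<in>s n ` space M. y * indicator (P y) x)"
      by (subst sum.reindex[OF inj]) (simp add: inv_into_f_f[OF inj] P)
    also have "\<dots> = (\<Sum>y\<in>s n ` space M. if y = s n x then y else 0)"
      using x by (intro sum.cong refl) (auto simp: P_def indicator_def)
    also have "\<dots> = s n x" using fin x by simp
    finally show ?thesis by simp
  qed
  have "l2_sqnorm M (\<lambda>x. f x - (\<Sum>\<Delta>\<in>P ` s n ` space M. inv_into (s n ` space M) P \<Delta> * ?e \<Delta> x)) =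
      l2_sqnorm M (\<lambda>x. f x - s n x)"
    unfolding l2_sqnorm_def by (intro Bochner_Integration.integral_cong refl) (simp only: sn[symmetric])
  also have "\<dots> < \<epsilon>" using n by (simp only: l2_sqnorm_diff_commute[of M f "s n"])
  finally have less: "l2_sqnorm M (\<lambda>x. f x - (\<Sum>\<Delta>\<in>P ` s n ` space M. inv_into (s n ` space M) P \<Delta> * ?e \<Delta> x)) < \<epsilon>" .
  show "\<exists>I c. finite I \<and> l2_sqnorm M (\<lambda>x. f x - (\<Sum>\<Delta>\<in>I. c \<Delta> * ?e \<Delta> x)) < \<epsilon>"
    by (rule exI[of _ "P ` s n ` space M"], rule exI[of _ "inv_into (s n ` space M) P"],
        rule conjI[OF finite_imageI[OF fin] less])
qed

text \<open>The cyclic subspace of a vector under a spectral measure is a copy of the square integrable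
  functions for its scalar measure: the vectors \<open>E \<Delta> h\<close> have the Gram matrix of the indicators.\<close>

lemma (in complex_hilbert_space) ex_l2_spectral:
  assumes E: "spectral_measure H E" and h: "h \<in> points H"
  shows "\<exists>W. l2_spectral H (scalar_measure H E h) W E \<and> W (\<lambda>_. 1) = h"
proof -
  let ?\<nu> = "scalar_measure H E h"
  note fin = finite_scalar_measure[OF E h] and sets = sets_scalar_measure[of E h]
  interpret \<nu>: finite_measure ?\<nu> by (rule fin)
  define e :: "(real \<times> real) set \<Rightarrow> real \<times> real \<Rightarrow> complex"
    where "e \<Delta> = (\<lambda>x. if \<Delta> \<in> sets ?\<nu> then indicator \<Delta> x else 0)" for \<Delta>
  have tot: "l2_total ?\<nu> e" unfolding e_def by (rule l2_total_indicators[OF fin])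
  define y where "y \<Delta> = (if \<Delta> \<in> sets borel then E \<Delta> h else 0)" for \<Delta>
  note p = spectral_measureD(1)[OF E _ h]
  have y: "y \<Delta> \<in> points H" for \<Delta> by (simp add: y_def p)
  have "\<exists>W. l2_isometry H ?\<nu> W \<and> (\<forall>\<Delta>. W (e \<Delta>) = y \<Delta>)"
  proof (rule ex_l2_isometry[OF fin l2_totalD(1)[OF tot] y])
    fix \<Delta> \<Delta>'
    show "cip H (y \<Delta>) (y \<Delta>') = l2_inner ?\<nu> (e \<Delta>) (e \<Delta>')"
    proof (cases "\<Delta> \<in> sets borel \<and> \<Delta>' \<in> sets borel")
      case True
      then have b: "\<Delta> \<in> sets borel" "\<Delta>' \<in> sets borel" "\<Delta>' \<inter> \<Delta> \<in> sets borel" by auto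
      have "cip H (y \<Delta>) (y \<Delta>') = cip H (E \<Delta>' (E \<Delta> h)) h"
        using b spectral_measureD(4)[OF E b(2) p[OF b(1)] h] by (simp add: y_def)
      also have "\<dots> = of_real (measure ?\<nu> (\<Delta>' \<inter> \<Delta>))"
        using spectral_measureD(5)[OF E b(2) h b(1)] measure_scalar_measure[OF E h b(3)] by simp
      also have "\<dots> = (LINT x|?\<nu>. indicator (\<Delta>' \<inter> \<Delta>) x)"
        using \<nu>.has_bochner_integral_complex_indicator[of "\<Delta>' \<inter> \<Delta>"] b(3) sets by (simp add: has_bochner_integral_iff)
      also have "\<dots> = l2_inner ?\<nu> (e \<Delta>) (e \<Delta>')"
        unfolding l2_inner_def e_def using b sets
        by (intro Bochner_Integration.integral_cong refl) (auto simp: indicator_def)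
      finally show ?thesis .
    next
      case False
      have zero: "y A = 0 \<and> e A = (\<lambda>_. 0)" if "A \<notin> sets borel" for A
        using that sets by (simp add: y_def e_def)
      from False consider "y \<Delta> = 0 \<and> e \<Delta> = (\<lambda>_. 0)" | "y \<Delta>' = 0 \<and> e \<Delta>' = (\<lambda>_. 0)"
        using zero by blast
      then show ?thesis
        by cases (simp_all add: l2_inner_def cip_zero_left[OF y] cip_zero_right[OF y])
    qed
    show "\<exists>I c. finite I \<and> l2_sqnorm ?\<nu> (\<lambda>x. f x - (\<Sum>i\<in>I. c i * e i x)) < \<epsilon>"
      if "square_integrable ?\<nu> f" "\<epsilon> > 0" for f \<epsilon> by (rule l2_totalD(2)[OF tot that])
  qed
  then obtain W where W: "l2_isometry H ?\<nu> W" and We: "\<And>\<Delta>. W (e \<Delta>) = y \<Delta>" by blast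
  interpret W: l2_isometry H ?\<nu> W by fact
  have E_W: "E \<Delta> (W f) = W (\<lambda>x. indicator \<Delta> x * f x)"
    if \<Delta>: "\<Delta> \<in> sets borel" and f: "square_integrable ?\<nu> f" for \<Delta> f
  proof -
    have \<Delta>': "\<Delta> \<in> sets ?\<nu>" using \<Delta> sets by simp
    note e' = l2_totalD(1)[OF tot] and pE = spectral_measureD[OF E \<Delta>]
    have on_e: "E \<Delta> (W (e \<Delta>')) = W (\<lambda>x. indicator \<Delta> x * e \<Delta>' x)" for \<Delta>'
    proof (cases "\<Delta>' \<in> sets borel")
      case True
      then have "(\<lambda>x. indicator \<Delta> x * e \<Delta>' x) = e (\<Delta> \<inter> \<Delta>')"
        using \<Delta> sets by (auto simp: e_def indicator_def)
      then show ?thesis using True \<Delta> pE(5)[OF h True] by (simp add: We y_def)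
    next
      case False
      then have "e \<Delta>' = (\<lambda>_. 0)" using sets by (auto simp: e_def)
      moreover have "E \<Delta> 0 = 0" using pE(2)[of 0 0] by simp
      ultimately show ?thesis by (simp add: W.W_zero)
    qed
    obtain I c where fin: "\<forall>n. finite (I n)" and lim: "l2_tendsto ?\<nu> (\<lambda>n x. \<Sum>i\<in>I n. c n i * e i x) f"
      using l2_total_tendsto[OF tot f] by blast
    let ?P = "\<lambda>n x. \<Sum>i\<in>I n. c n i * e i x"
    note P = l2_tendstoD(1)[OF lim]
    have E_sum: "E \<Delta> (\<Sum>i\<in>J. g i) = (\<Sum>i\<in>J. E \<Delta> (g i))" if "\<And>i. g i \<in> points H" for J and g :: "(real \<times> real) set \<Rightarrow> 'a"
    proof (induction J rule: infinite_finite_induct)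
      case (insert i J)
      then show ?case using pE(2)[of "g i" "\<Sum>i\<in>J. g i"] that by simp
    qed (use pE(2)[of 0 0] in simp_all)
    have sqe: "square_integrable ?\<nu> (\<lambda>x. indicator \<Delta> x * e i x)" for i
      by (rule square_integrable_indicator[OF e' \<Delta>'])
    have EP: "E \<Delta> (W (?P n)) = W (\<lambda>x. indicator \<Delta> x * ?P n x)" for n
    proof -
      have "E \<Delta> (W (?P n)) = (\<Sum>i\<in>I n. smult H (c n i) (E \<Delta> (W (e i))))"
        unfolding W.W_combination[OF e'] using W.W_points[OF e'] by (simp add: E_sum pE(3))
      also have "\<dots> = W (\<lambda>x. \<Sum>i\<in>I n. c n i * (indicator \<Delta> x * e i x))"
        unfolding on_e by (rule W.W_combination[of "\<lambda>i x. indicator \<Delta> x * e i x", OF sqe, symmetric])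
      also have "(\<lambda>x. \<Sum>i\<in>I n. c n i * (indicator \<Delta> x * e i x)) = (\<lambda>x. indicator \<Delta> x * ?P n x)"
        by (simp add: sum_distrib_left mult.left_commute)
      finally show ?thesis .
    qed
    have "l2_tendsto ?\<nu> (\<lambda>n x. indicator \<Delta> x * ?P n x) (\<lambda>x. indicator \<Delta> x * f x)"
    proof -
      have "l2_sqnorm ?\<nu> (\<lambda>x. indicator \<Delta> x * ?P n x - indicator \<Delta> x * f x) \<le> l2_sqnorm ?\<nu> (\<lambda>x. ?P n x - f x)" for n
      proof (rule l2_sqnorm_mono[OF square_integrable_diff[OF P f]])
        show "(\<lambda>x. indicator \<Delta> x * ?P n x - indicator \<Delta> x * f x) \<in> borel_measurable ?\<nu>"
          by (intro square_integrable_measurable square_integrable_diff square_integrable_indicator P f \<Delta>')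
        show "cmod (indicator \<Delta> x * ?P n x - indicator \<Delta> x * f x) \<le> cmod (?P n x - f x)" for x
          by (simp add: indicator_def)
      qed
      then have "(\<lambda>n. l2_sqnorm ?\<nu> (\<lambda>x. indicator \<Delta> x * ?P n x - indicator \<Delta> x * f x)) \<longlonglongrightarrow> 0"
        by (intro Lim_null_comparison[OF always_eventually l2_tendstoD(3)[OF lim]]) (simp add: l2_sqnorm_nonneg)
      then show ?thesis
        using square_integrable_indicator[OF P \<Delta>'] square_integrable_indicator[OF f \<Delta>'] by (simp add: l2_tendsto_def)
    qed
    from W.W_tendsto[OF this] have "limitin (htop H) (\<lambda>n. E \<Delta> (W (?P n))) (W (\<lambda>x. indicator \<Delta> x * f x)) sequentially"
      unfolding EP .
    moreover have "limitin (htop H) (\<lambda>n. E \<Delta> (W (?P n))) (E \<Delta> (W f)) sequentially"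
      by (rule spectral_measure_tendsto[OF E \<Delta> _ W.W_tendsto[OF lim]]) (simp add: P)
    ultimately have "W (\<lambda>x. indicator \<Delta> x * f x) = E \<Delta> (W f)" by (rule limitin_metric_unique) simp
    then show ?thesis by simp
  qed
  have "l2_spectral H ?\<nu> W E"
    by (intro l2_spectral.intro W l2_spectral_axioms.intro sets E_W)
  moreover have "W (\<lambda>_. 1) = h"
  proof -
    have "e UNIV = (\<lambda>_. 1)" using sets by (auto simp: e_def)
    then show ?thesis using We[of UNIV] spectral_measureD(6)[of E UNIV, OF E _ h] by (simp add: y_def)
  qed
  ultimately show ?thesis by blast
qed

text \<open>A symmetric operator has no eigenvalue off the real line.\<close>

lemma (in complex_ip_space) self_adjoint_resolvent_unique:
  assumes A: "self_adjoint H A" and hg: "(h, g) \<in> A" "(h', g') \<in> A"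
    and eq: "g + smult H c h = g' + smult H c h'" and c: "Im c \<noteq> 0"
  shows "h = h'"
proof -
  have lin: "linear_operator H A" and adj: "adjoint_op H A = A" using A by (auto simp: self_adjoint_def)
  have "A \<subseteq> points H \<times> points H" using lin unfolding linear_operator_def by blast
  then have pts: "h \<in> points H" "g \<in> points H" "h' \<in> points H" "g' \<in> points H" using hg by auto
  have "(smult H (-1) h', smult H (-1) g') \<in> A" using lin hg(2) unfolding linear_operator_def by blast
  then have "(h + smult H (-1) h', g + smult H (-1) g') \<in> A" using lin hg(1) unfolding linear_operator_def by blast
  then have d: "(h - h', g - g') \<in> A" by simp
  then have sym: "cip H (g - g') (h - h') = cip H (h - h') (g - g')" using adj unfolding adjoint_op_def by blast
  have "g - g' = smult H c h' - smult H c h" using eq by (simp add: algebra_simps)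
  then have e: "g - g' = smult H (- c) (h - h')" by (simp add: scale_right_diff_distrib)
  have dp: "h - h' \<in> points H" using pts by simp
  have "- c * cip H (h - h') (h - h') = - cnj c * cip H (h - h') (h - h')"
    using sym unfolding e cip_smult_left[OF dp dp] cip_smult_right[OF dp dp] by simp
  then have "(c - cnj c) * cip H (h - h') (h - h') = 0" by (simp add: algebra_simps)
  moreover have "c - cnj c \<noteq> 0" using c by (simp add: complex_eq_iff)
  ultimately show ?thesis using cip_eq_0[OF dp] by simp
qed

text \<open>Dividing by \<open>\<phi> + c\<close> produces a pair of the operator with the same value of \<open>g + c h\<close>, and such a pair
  is unique.  Hence the Cayley transform acts as multiplication by \<open>(\<phi> - c) / (\<phi> + c)\<close>.\<close>

lemma (in l2_spectral) resolvent_step: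
  assumes A: "self_adjoint H A" "spectral_integral H E \<phi> = A" and \<phi>: "\<phi> \<in> borel_measurable borel"
    and c: "c = \<i> \<or> c = - \<i>" and f: "square_integrable M f"
    and hg: "(h, g) \<in> A" "g + smult H c h = W f"
  shows "g - smult H c h = W (\<lambda>x. (of_real (\<phi> x) - c) / (of_real (\<phi> x) + c) * f x)"
proof -
  have [measurable]: "f \<in> borel_measurable M" "\<phi> \<in> borel_measurable M"
    using square_integrable_measurable[OF f] \<phi> by (simp_all add: borel_measurable_M)
  have ge: "1 \<le> cmod (of_real (\<phi> x) + c)" "\<bar>\<phi> x\<bar> \<le> cmod (of_real (\<phi> x) + c)" for x
    using abs_Im_le_cmod[of "of_real (\<phi> x) + c"] abs_Re_le_cmod[of "of_real (\<phi> x) + c"] c by auto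
  then have pos: "0 < cmod (of_real (\<phi> x) + c)" for x using less_le_trans[OF zero_less_one] by blast
  then have ne: "of_real (\<phi> x) + c \<noteq> 0" for x by (metis norm_zero less_irrefl)
  define k where "k x = f x / (of_real (\<phi> x) + c)" for x
  have k: "square_integrable M k"
  proof (rule square_integrable_bound[OF f, where C = 1])
    show "k \<in> borel_measurable M" unfolding k_def by measurable
    show "cmod (k x) \<le> 1 * cmod (f x)" for x
      using ge(1)[of x] pos[of x] by (simp add: k_def norm_divide divide_le_eq mult_le_cancel_left1)
  qed
  have \<phi>k: "square_integrable M (\<lambda>x. of_real (\<phi> x) * k x)"
  proof (rule square_integrable_bound[OF f, where C = 1])
    show "(\<lambda>x. of_real (\<phi> x) * k x) \<in> borel_measurable M" unfolding k_def by measurable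
    show "cmod (of_real (\<phi> x) * k x) \<le> 1 * cmod (f x)" for x
      using mult_right_mono[OF ge(2)[of x], of "cmod (f x)"] pos[of x]
      by (simp add: k_def norm_mult norm_divide divide_le_eq mult.commute)
  qed
  note ck = square_integrable_cmult[OF k, of c]
  have "(\<lambda>x. of_real (\<phi> x) * k x + c * k x) = f"
  proof
    fix x
    have "of_real (\<phi> x) * k x + c * k x = (of_real (\<phi> x) + c) * k x" by (rule distrib_right[symmetric])
    then show "of_real (\<phi> x) * k x + c * k x = f x" using ne[of x] by (simp add: k_def)
  qed
  then have sum: "W (\<lambda>x. of_real (\<phi> x) * k x) + smult H c (W k) = W f"
    using W_add[OF \<phi>k ck] by (simp add: W_smult[OF k])
  have mem: "(W k, W (\<lambda>x. of_real (\<phi> x) * k x)) \<in> A" using spectral_integral_W[OF k \<phi> \<phi>k] A(2) by simp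
  have h: "h = W k"
    by (rule self_adjoint_resolvent_unique[OF A(1) hg(1) mem, of c]) (use hg(2) sum c in auto)
  have g: "g = W (\<lambda>x. of_real (\<phi> x) * k x)" using hg(2) sum unfolding h by (metis add_right_cancel)
  have "(\<lambda>x. of_real (\<phi> x) * k x - c * k x) = (\<lambda>x. (of_real (\<phi> x) - c) / (of_real (\<phi> x) + c) * f x)"
  proof
    fix x
    have "of_real (\<phi> x) * k x - c * k x = (of_real (\<phi> x) - c) * k x" by (rule left_diff_distrib[symmetric])
    then show "of_real (\<phi> x) * k x - c * k x = (of_real (\<phi> x) - c) / (of_real (\<phi> x) + c) * f x" by (simp add: k_def)
  qed
  then show ?thesis using W_diff[OF \<phi>k ck] unfolding h g W_smult[OF k] by simp
qed

text \<open>A spectral measure of the two operators is determined on the vector of the constant function.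
  Starting from this vector, the Cayley transforms of the operators generate the vectors of all
  characters.  In the calculus of \<open>E\<close> they are multiplications by the same functions, so the scalar
  measure has the same integrals of characters as \<open>M\<close>.\<close>

lemma (in l2_model) scalar_measure_eq:
  assumes H: "complex_hilbert_space H" and e: "\<And>i. square_integrable M (moment_fun i)"
    and E: "joint_spectral_measure H (mult_op fst) (mult_op snd) E"
  shows "scalar_measure H E (W (\<lambda>_. 1)) = M"
proof -
  have spec: "spectral_measure H E" and fst: "spectral_integral H E fst = mult_op fst"
    and snd: "spectral_integral H E snd = mult_op snd"
    using E by (auto simp: joint_spectral_measure_def)
  have mf: "fst \<in> borel_measurable (borel :: (real \<times> real) measure)" "snd \<in> borel_measurable (borel :: (real \<times> real) measure)"
    by (auto intro!: borel_measurable_continuous_onI continuous_intros)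
  interpret finite_measure M by (rule finite_M)
  have one: "square_integrable M (\<lambda>_. 1)" by (simp add: square_integrable_def)
  let ?\<nu> = "scalar_measure H E (W (\<lambda>_. 1))"
  obtain V where V: "l2_spectral H ?\<nu> V E" and V1: "V (\<lambda>_. 1) = W (\<lambda>_. 1)"
    using complex_hilbert_space.ex_l2_spectral[OF H spec W_points[OF one]] by blast
  interpret V: l2_spectral H ?\<nu> V E by fact
  interpret T: torus_map ?\<nu> plane_to_torus by (rule torus_map_plane[OF V.finite_M V.sets_M])
  interpret TM: torus_map M plane_to_torus by (rule torus_map_plane[OF finite_M sets_M_borel])
  have step: "W (moment_fun i') = V (\<lambda>x. (of_real (\<phi> x) - c) / (of_real (\<phi> x) + c) * f x)"
    if \<phi>: "\<phi> \<in> borel_measurable borel" "spectral_integral H E \<phi> = mult_op \<phi>" and c: "c = \<i> \<or> c = - \<i>"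
      and f: "square_integrable ?\<nu> f" "W (moment_fun i) = V f"
      and j: "\<And>x. moment_fun j' x = of_real (\<phi> x) * moment_fun j x"
        "\<And>x. moment_fun i x = (of_real (\<phi> x) + c) * moment_fun j x"
        "\<And>x. moment_fun i' x = (of_real (\<phi> x) - c) * moment_fun j x"
    for \<phi> c f i i' j j'
  proof -
    have j': "(\<lambda>x. of_real (\<phi> x) * moment_fun j x) = moment_fun j'" by (rule ext) (rule j(1)[symmetric])
    have i: "(\<lambda>x. moment_fun j' x + c * moment_fun j x) = moment_fun i"
      and i': "(\<lambda>x. moment_fun j' x - c * moment_fun j x) = moment_fun i'"
      by (rule ext, simp only: j distrib_right left_diff_distrib)+
    note cj = square_integrable_cmult[OF e, of c j]
    have mem: "(W (moment_fun j), W (moment_fun j')) \<in> mult_op \<phi>"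
      using mult_opI[OF e[of j], of \<phi>] e[of j'] unfolding j' by blast
    have "W (moment_fun j') + smult H c (W (moment_fun j)) = V f"
      using W_add[OF e cj, of j'] f(2) unfolding i by (simp add: W_smult[OF e])
    from V.resolvent_step[OF self_adjoint_mult_op[OF \<phi>(1)] \<phi>(2,1) c f(1) mem this]
    show ?thesis using W_diff[OF e cj, of j'] unfolding i' by (simp add: W_smult[OF e])
  qed
  define idx :: "int \<times> int \<Rightarrow> idx" where "idx p = (0, - fst p, fst p, 0, - snd p, snd p)" for p
  let ?ch = "\<lambda>p x. character p (plane_to_torus x)"
  \<comment> \<open>Both calculi assign the same vector to the character \<open>p\<close>; propagate this from 0 by steps of size 1.\<close>
  define claim where "claim p \<longleftrightarrow> W (moment_fun (idx p)) = V (?ch p)" for p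
  have ch_add: "?ch (p + q) x = ?ch q x * ?ch p x" for p q x
    using character_add[OF plane_to_torus_in_torus] by (simp add: mult.commute)
  have up1: "claim (a + 1, b)" if "claim (a, b)" for a b
  proof -
    have "W (moment_fun (idx (a + 1, b))) = V (\<lambda>x. (of_real (fst x) - \<i>) / (of_real (fst x) + \<i>) * ?ch (a, b) x)"
    proof (rule step[OF mf(1) fst _ T.square_integrable_character that[unfolded claim_def]])
      show "moment_fun (1, - a - 1, a, 0, - b, b) x = of_real (fst x) * moment_fun (0, - a - 1, a, 0, - b, b) x" for x
        using moment_fun_steps(1)[of 0] by simp
      show "moment_fun (idx (a, b)) x = (of_real (fst x) + \<i>) * moment_fun (0, - a - 1, a, 0, - b, b) x" for x
        using moment_fun_steps(2)[of 0 "- a - 1"] by (simp add: idx_def)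
      show "moment_fun (idx (a + 1, b)) x = (of_real (fst x) - \<i>) * moment_fun (0, - a - 1, a, 0, - b, b) x" for x
        using moment_fun_steps(3)[of 0 "- a - 1" a] by (simp add: idx_def)
    qed simp
    also have "(\<lambda>x. (of_real (fst x) - \<i>) / (of_real (fst x) + \<i>) * ?ch (a, b) x) = ?ch (a + 1, b)"
      using ch_add[of "(a, b)" "(1, 0)"] by (simp add: character_def plane_to_torus_def)
    finally show ?thesis by (simp add: claim_def)
  qed
  have down1: "claim (a - 1, b)" if "claim (a, b)" for a b
  proof -
    have "W (moment_fun (idx (a - 1, b))) = V (\<lambda>x. (of_real (fst x) - - \<i>) / (of_real (fst x) + - \<i>) * ?ch (a, b) x)"
    proof (rule step[OF mf(1) fst _ T.square_integrable_character that[unfolded claim_def]])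
      show "moment_fun (1, - a, a - 1, 0, - b, b) x = of_real (fst x) * moment_fun (0, - a, a - 1, 0, - b, b) x" for x
        using moment_fun_steps(1)[of 0] by simp
      show "moment_fun (idx (a, b)) x = (of_real (fst x) + - \<i>) * moment_fun (0, - a, a - 1, 0, - b, b) x" for x
        using moment_fun_steps(3)[of 0 "- a" "a - 1"] by (simp add: idx_def)
      show "moment_fun (idx (a - 1, b)) x = (of_real (fst x) - - \<i>) * moment_fun (0, - a, a - 1, 0, - b, b) x" for x
        using moment_fun_steps(2)[of 0 "- a" "a - 1"] by (simp add: idx_def)
    qed simp
    also have "(\<lambda>x. (of_real (fst x) - - \<i>) / (of_real (fst x) + - \<i>) * ?ch (a, b) x) = ?ch (a - 1, b)"
      using ch_add[of "(a, b)" "(- 1, 0)"] by (simp add: character_def plane_to_torus_def power_int_minus)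
    finally show ?thesis by (simp add: claim_def)
  qed
  have up2: "claim (a, b + 1)" if "claim (a, b)" for a b
  proof -
    have "W (moment_fun (idx (a, b + 1))) = V (\<lambda>x. (of_real (snd x) - \<i>) / (of_real (snd x) + \<i>) * ?ch (a, b) x)"
    proof (rule step[OF mf(2) snd _ T.square_integrable_character that[unfolded claim_def]])
      show "moment_fun (0, - a, a, 1, - b - 1, b) x = of_real (snd x) * moment_fun (0, - a, a, 0, - b - 1, b) x" for x
        using moment_fun_steps(4)[of 0 "- a" a 0] by simp
      show "moment_fun (idx (a, b)) x = (of_real (snd x) + \<i>) * moment_fun (0, - a, a, 0, - b - 1, b) x" for x
        using moment_fun_steps(5)[of 0 "- a" a 0 "- b - 1"] by (simp add: idx_def)
      show "moment_fun (idx (a, b + 1)) x = (of_real (snd x) - \<i>) * moment_fun (0, - a, a, 0, - b - 1, b) x" for x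
        using moment_fun_steps(6)[of 0 "- a" a 0 "- b - 1" b] by (simp add: idx_def)
    qed simp
    also have "(\<lambda>x. (of_real (snd x) - \<i>) / (of_real (snd x) + \<i>) * ?ch (a, b) x) = ?ch (a, b + 1)"
      using ch_add[of "(a, b)" "(0, 1)"] by (simp add: character_def plane_to_torus_def)
    finally show ?thesis by (simp add: claim_def)
  qed
  have down2: "claim (a, b - 1)" if "claim (a, b)" for a b
  proof -
    have "W (moment_fun (idx (a, b - 1))) = V (\<lambda>x. (of_real (snd x) - - \<i>) / (of_real (snd x) + - \<i>) * ?ch (a, b) x)"
    proof (rule step[OF mf(2) snd _ T.square_integrable_character that[unfolded claim_def]])
      show "moment_fun (0, - a, a, 1, - b, b - 1) x = of_real (snd x) * moment_fun (0, - a, a, 0, - b, b - 1) x" for x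
        using moment_fun_steps(4)[of 0 "- a" a 0] by simp
      show "moment_fun (idx (a, b)) x = (of_real (snd x) + - \<i>) * moment_fun (0, - a, a, 0, - b, b - 1) x" for x
        using moment_fun_steps(6)[of 0 "- a" a 0 "- b" "b - 1"] by (simp add: idx_def)
      show "moment_fun (idx (a, b - 1)) x = (of_real (snd x) - - \<i>) * moment_fun (0, - a, a, 0, - b, b - 1) x" for x
        using moment_fun_steps(5)[of 0 "- a" a 0 "- b" "b - 1"] by (simp add: idx_def)
    qed simp
    also have "(\<lambda>x. (of_real (snd x) - - \<i>) / (of_real (snd x) + - \<i>) * ?ch (a, b) x) = ?ch (a, b - 1)"
      using ch_add[of "(a, b)" "(0, - 1)"] by (simp add: character_def plane_to_torus_def power_int_minus)
    finally show ?thesis by (simp add: claim_def)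
  qed
  have mf0: "moment_fun (idx (0, 0)) = (\<lambda>_. 1)" by (auto simp: moment_fun_def idx_def)
  have "claim (0, 0)" by (simp add: claim_def mf0 V1)
  then have "claim (a, 0)" for a by (induction a rule: int_induct[where k = 0]) (auto intro: up1 down1)
  then have claim: "claim (a, b)" for a b by (induction b rule: int_induct[where k = 0]) (auto intro: up2 down2)
  show ?thesis
  proof (rule torus_measure_eqI[OF T.torus_map_axioms TM.torus_map_axioms])
    show "sets M = sets ?\<nu>" using V.sets_M sets_M_borel by simp
    fix p :: "int \<times> int"
    obtain a b where p: "p = (a, b)" by (cases p)
    have V1': "square_integrable ?\<nu> (\<lambda>_. 1)"
      by (rule square_integrable_bounded[OF V.finite_M, where C = 1]) auto
    have "(LINT x|?\<nu>. ?ch p x) = cip H (V (?ch p)) (V (\<lambda>_. 1))"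
      by (simp add: V.W_inner[OF T.square_integrable_character V1'] l2_inner_def)
    also have "\<dots> = cip H (W (moment_fun (idx p))) (W (\<lambda>_. 1))"
      using claim[of a b] by (simp add: claim_def V1 p)
    also have "\<dots> = (LINT x|M. moment_fun (idx p) x)"
      by (simp add: W_inner[OF e one] l2_inner_def)
    also have "\<dots> = (LINT x|M. ?ch p x)" unfolding character_plane_to_torus idx_def ..
    finally show "(LINT x|?\<nu>. ?ch p x) = (LINT x|M. ?ch p x)" .
  qed
qed

text \<open>In the unitarily equivalent space of square integrable functions the closures are the multiplications
  by the two coordinates.\<close>

lemma moment_model_operators:
  fixes H :: "'h::ab_group_add ip_space"
  assumes \<mu>: "solves_moment_problem u \<mu>" and model: "moment_model u H x"
  shows "linear_operator H (A0 H x)" "linear_operator H (B0 H x)"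
    "self_adjoint H (op_closure H (A0 H x))" "self_adjoint H (op_closure H (B0 H x))"
    "commuting H (op_closure H (A0 H x)) (op_closure H (B0 H x))"
    "\<exists>E. joint_spectral_measure H (op_closure H (A0 H x)) (op_closure H (B0 H x)) E"
    "joint_spectral_measure H (op_closure H (A0 H x)) (op_closure H (B0 H x)) E \<Longrightarrow> \<Delta> \<in> sets borel \<Longrightarrow>
      complex_of_real (measure \<mu> \<Delta>) = cip H (E \<Delta> (x (0, 0, 0, 0, 0, 0))) (x (0, 0, 0, 0, 0, 0))"
proof -
  obtain W where W: "l2_model H \<mu> W" and Wx: "\<forall>i. W (moment_fun i) = x i"
    using moment_model_l2_model[OF \<mu> model] by blast
  interpret l2_model H \<mu> W by fact
  have H: "complex_hilbert_space H" using model unfolding moment_model_iff by blast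
  note tot = moment_fun_total[OF \<mu>]
  note e = l2_totalD(1)[OF tot]
  have x: "(\<lambda>i. W (moment_fun i)) = x" using Wx by blast
  have xp: "x i \<in> points H" for i using W_points[OF e[of i]] Wx by metis
  have m: "fst \<in> borel_measurable (borel :: (real \<times> real) measure)" "snd \<in> borel_measurable (borel :: (real \<times> real) measure)"
    by (auto intro!: borel_measurable_continuous_onI continuous_intros)
  let ?\<sigma> = "\<lambda>(m, k, l, n, r, t). (m + 1, k, l, n, r, t) :: idx"
    and ?\<sigma>' = "\<lambda>(m, k, l, n, r, t). (m, k, l, n + 1, r, t) :: idx"
  have s1: "moment_fun (?\<sigma> i) p = of_real (fst p) * moment_fun i p" for i p
    by (cases i) (simp only: prod.case moment_fun_steps)
  have s2: "moment_fun (?\<sigma>' i) p = of_real (snd p) * moment_fun i p" for i p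
    by (cases i) (simp only: prod.case moment_fun_steps)
  have subA: "A0 H x \<subseteq> mult_op fst"
    using shift_operator_subset[of moment_fun ?\<sigma> fst, OF e s1] unfolding A0_def x .
  have subB: "B0 H x \<subseteq> mult_op snd"
    using shift_operator_subset[of moment_fun ?\<sigma>' snd, OF e s2] unfolding B0_def x .
  have sv: "single_valued (mult_op fst)" "single_valued (mult_op snd)"
    using linear_operator_mult_op[OF m(1)] linear_operator_mult_op[OF m(2)] unfolding linear_operator_def by blast+
  show "linear_operator H (A0 H x)"
    using single_valued_subset[OF subA] sv(1) linear_operator_shift[of x, OF xp] unfolding A0_def by blast
  show "linear_operator H (B0 H x)"
    using single_valued_subset[OF subB] sv(2) linear_operator_shift[of x, OF xp] unfolding B0_def by blast
  have A: "op_closure H (A0 H x) = mult_op fst"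
    using op_closure_shift_operator[OF tot m(1), of ?\<sigma> "\<lambda>(m, k, l, n, r, t). (m, k - 1, l, n, r, t)", OF s1]
    unfolding A0_def x
  proof (rule meta_mp)
    show "(of_real (fst p) + \<i>) * moment_fun (case i of (m, k, l, n, r, t) \<Rightarrow> (m, k - 1, l, n, r, t)) p = moment_fun i p" for i p
      using moment_fun_steps(2)[of _ "fst (snd i) - 1"] by (cases i) simp
  qed (auto simp: inj_def)
  have B: "op_closure H (B0 H x) = mult_op snd"
    using op_closure_shift_operator[OF tot m(2), of ?\<sigma>' "\<lambda>(m, k, l, n, r, t). (m, k, l, n, r - 1, t)", OF s2]
    unfolding B0_def x
  proof (rule meta_mp)
    show "(of_real (snd p) + \<i>) * moment_fun (case i of (m, k, l, n, r, t) \<Rightarrow> (m, k, l, n, r - 1, t)) p = moment_fun i p" for i p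
      using moment_fun_steps(5)[of _ _ _ _ "fst (snd (snd (snd (snd i)))) - 1"] by (cases i) simp
  qed (auto simp: inj_def)
  show "self_adjoint H (op_closure H (A0 H x))" "self_adjoint H (op_closure H (B0 H x))"
    "commuting H (op_closure H (A0 H x)) (op_closure H (B0 H x))"
    unfolding A B by (intro self_adjoint_mult_op commuting_mult_op m)+
  show "\<exists>E. joint_spectral_measure H (op_closure H (A0 H x)) (op_closure H (B0 H x)) E"
    unfolding A B joint_spectral_measure_def
    using spectral_measure_multE spectral_integral_multE[OF m(1)] spectral_integral_multE[OF m(2)] by metis
  assume E: "joint_spectral_measure H (op_closure H (A0 H x)) (op_closure H (B0 H x)) E" and \<Delta>: "\<Delta> \<in> sets borel"
  have spec: "spectral_measure H E" using E unfolding joint_spectral_measure_def by blast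
  have "moment_fun (0, 0, 0, 0, 0, 0) = (\<lambda>_. 1)" by (auto simp: moment_fun_def)
  then have x0: "W (\<lambda>_. 1) = x (0, 0, 0, 0, 0, 0)" using Wx by metis
  have "scalar_measure H E (x (0, 0, 0, 0, 0, 0)) = \<mu>"
    using scalar_measure_eq[OF H e E[unfolded A B]] unfolding x0 .
  then show "complex_of_real (measure \<mu> \<Delta>) = cip H (E \<Delta> (x (0, 0, 0, 0, 0, 0))) (x (0, 0, 0, 0, 0, 0))"
    using measure_scalar_measure[OF spec xp \<Delta>] by metis
qed

theorem theorem2:
  fixes u :: "idx \<Rightarrow> complex"
  shows
    "((\<exists>\<mu>. solves_moment_problem u \<mu>) \<longleftrightarrow> positivity_condition u \<and> consistency_condition u) \<and>
     (positivity_condition u \<and> consistency_condition u \<longrightarrow>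
       (\<exists>!\<mu>. solves_moment_problem u \<mu>) \<and>
       (\<exists>(H :: (idx \<Rightarrow> complex) ip_space) x. moment_model u H x) \<and>
       (\<forall>(H :: 'h::ab_group_add ip_space) x. moment_model u H x \<longrightarrow>
         linear_operator H (A0 H x) \<and> linear_operator H (B0 H x) \<and>
         (let A = op_closure H (A0 H x); B = op_closure H (B0 H x) in
           self_adjoint H A \<and> self_adjoint H B \<and> commuting H A B \<and>
           (\<exists>E. joint_spectral_measure H A B E) \<and>
           (\<forall>E. joint_spectral_measure H A B E \<longrightarrow>
             (\<forall>\<mu>. solves_moment_problem u \<mu> \<longrightarrow>
               (\<forall>\<Delta> \<in> sets borel.
                 complex_of_real (measure \<mu> \<Delta>) = cip H (E \<Delta> (x (0, 0, 0, 0, 0, 0))) (x (0, 0, 0, 0, 0, 0))))))))"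
proof (intro conjI impI)
  show "(\<exists>\<mu>. solves_moment_problem u \<mu>) \<longleftrightarrow> positivity_condition u \<and> consistency_condition u"
  proof
    assume "\<exists>\<mu>. solves_moment_problem u \<mu>"
    then obtain \<mu> where "solves_moment_problem u \<mu>" ..
    note s = solves_moment_problemD[OF this]
    show "positivity_condition u \<and> consistency_condition u"
      using solution_positive[OF s] solution_consistent[OF s(2)] ..
  next
    assume "positivity_condition u \<and> consistency_condition u"
    then show "\<exists>\<mu>. solves_moment_problem u \<mu>" using moment_solution_exists by blast
  qed
  assume pc: "positivity_condition u \<and> consistency_condition u"
  then obtain \<mu>0 where \<mu>0: "solves_moment_problem u \<mu>0" using moment_solution_exists by blast
  show "\<exists>!\<mu>. solves_moment_problem u \<mu>"
    using \<mu>0 moment_solution_unique by blast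
  show "\<exists>(H :: (idx \<Rightarrow> complex) ip_space) x. moment_model u H x"
    by (rule moment_model_exists[OF \<mu>0])
  show "\<forall>(H :: 'h ip_space) x. moment_model u H x \<longrightarrow>
         linear_operator H (A0 H x) \<and> linear_operator H (B0 H x) \<and>
         (let A = op_closure H (A0 H x); B = op_closure H (B0 H x) in
           self_adjoint H A \<and> self_adjoint H B \<and> commuting H A B \<and>
           (\<exists>E. joint_spectral_measure H A B E) \<and>
           (\<forall>E. joint_spectral_measure H A B E \<longrightarrow>
             (\<forall>\<mu>. solves_moment_problem u \<mu> \<longrightarrow>
               (\<forall>\<Delta> \<in> sets borel.
                 complex_of_real (measure \<mu> \<Delta>) = cip H (E \<Delta> (x (0, 0, 0, 0, 0, 0))) (x (0, 0, 0, 0, 0, 0))))))"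
    unfolding Let_def
    by (intro allI impI ballI conjI moment_model_operators(1-6)[OF \<mu>0] moment_model_operators(7))
qed

end
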